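(* Let $n\geq1$ and let $A$ be a subalgebra of $\mathcal M([0,1]^n)$. (i) $A$ is finitely generated, separating, and distinct from $\mathcal M([0,1]^n)$ if and only if $A$ is generated by a basic set $\mathcal H_{\Delta,\mathbf a}$ for some weighted triangulation $(\Delta,\mathbf a)=(\Delta,(a_1,\ldots,a_u))$ of $[0,1]^n$ such that $a_j\neq1$ for some $j\in\{1,\ldots,u\}$. (ii) If $A$ is finitely generated, separating, and distinct from $\mathcal M([0,1]^n)$, then for every weighted triangulation $(\Delta,\mathbf a)=(\Delta,(a_1,\ldots,a_u))$ of $[0,1]^n$ such that $\mathcal H_{\Delta,\mathbf a}$ is a basic generating set of $A$, one has $a_j\neq1$ for some $j\in\{1,\ldots,u\}$.
   Context: A McNaughton function on $[0,1]^n$ is a continuous function $f\colon[0,1]^n\to[0,1]$ for which there are finitely many affine functions with integer coefficients $p_1,\ldots,p_m$ such that for every $x$ there is $j$ with $f(x)=p_j(x)$. $\mathcal M([0,1]^n)$ is the MV-algebra of all McNaughton functions with pointwise operations $f\oplus g=\min(1,f+g)$, $\neg f=1-f$, $0$ the zero function. $A$ is separating if for all $x\neq y$ in $[0,1]^n$ there is $f\in A$ with $f(x)\neq f(y)$. For a rational point $x=(c_1/d_1,\ldots,c_n/d_n)$ with $c_i,d_i$ coprime, $\mathrm{den}(x)$ is the least common multiple of $d_1,\ldots,d_n$. A weighted triangulation of $[0,1]^n$ is a pair $(\Delta,\mathbf a)$ where $\Delta$ is a triangulation of $[0,1]^n$ with rational vertices $v_1,\ldots,v_u$ and $\mathbf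 a=(a_1,\ldots,a_u)$ are positive integers with $a_i$ dividing $\mathrm{den}(v_i)$. The $i$-th hat of $(\Delta,\mathbf a)$ is the function $h_i\colon[0,1]^n\to[0,1]$ affine on every simplex of $\Delta$ with $h_i(v_i)=a_i/\mathrm{den}(v_i)$ and $h_i(v_j)=0$ for $j\neq i$; $\mathcal H_{\Delta,\mathbf a}$ is the set of these hats, and it is called basic if every affine piece of every hat has integer coefficients (i.e. all hats lie in $\mathcal M([0,1]^n)$). *)

theory Defs
  imports "HOL-Analysis.Analysis"
begin

abbreviation cube :: "(real^'n) set" where
  "cube \<equiv> cbox 0 1"

definition int_affine :: "(real^'n \<Rightarrow> real) \<Rightarrow> bool" where
  "int_affine p \<longleftrightarrow> (\<exists>(b::int^'n) (c::int). \<forall>x. p x = (\<Sum>i\<in>UNIV. of_int (b $ i) * x $ i) + of_int c)"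

text \<open>Functions on the cube are extensional, i.e. \<^const>\<open>undefined\<close> outside of it, so that
  equality of such HOL functions is equality of functions on the cube.\<close>

definition McNaughton :: "(real^'n \<Rightarrow> real) set" where
  "McNaughton = {f \<in> cube \<rightarrow>\<^sub>E {0..1}. continuous_on cube f \<and>
     (\<exists>P. finite P \<and> (\<forall>p\<in>P. int_affine p) \<and> (\<forall>x\<in>cube. \<exists>p\<in>P. f x = p x))}"

definition mv_zero :: "real^'n \<Rightarrow> real" where
  "mv_zero = (\<lambda>x\<in>cube. 0)"

definition mv_plus :: "(real^'n \<Rightarrow> real) \<Rightarrow> (real^'n \<Rightarrow> real) \<Rightarrow> real^'n \<Rightarrow> real" where
  "mv_plus f g = (\<lambda>x\<in>cube. min 1 (f x + g x))"

definition mv_neg :: "(real^'n \<Rightarrow> real) \<Rightarrow> real^'n \<Rightarrow> real" where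
  "mv_neg f = (\<lambda>x\<in>cube. 1 - f x)"

definition mv_closed :: "(real^'n \<Rightarrow> real) set \<Rightarrow> bool" where
  "mv_closed A \<longleftrightarrow> mv_zero \<in> A \<and> (\<forall>f\<in>A. \<forall>g\<in>A. mv_plus f g \<in> A) \<and> (\<forall>f\<in>A. mv_neg f \<in> A)"

definition mv_subalgebra :: "(real^'n \<Rightarrow> real) set \<Rightarrow> bool" where
  "mv_subalgebra A \<longleftrightarrow> A \<subseteq> McNaughton \<and> mv_closed A"

definition generates :: "(real^'n \<Rightarrow> real) set \<Rightarrow> (real^'n \<Rightarrow> real) set \<Rightarrow> bool" where
  "generates S A \<longleftrightarrow> mv_closed hull S = A"

definition finitely_generated :: "(real^'n \<Rightarrow> real) set \<Rightarrow> bool" where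
  "finitely_generated A \<longleftrightarrow> (\<exists>S. finite S \<and> generates S A)"

definition separating :: "(real^'n \<Rightarrow> real) set \<Rightarrow> bool" where
  "separating A \<longleftrightarrow> (\<forall>x\<in>cube. \<forall>y\<in>cube. x \<noteq> y \<longrightarrow> (\<exists>f\<in>A. f x \<noteq> f y))"

definition denom :: "real \<Rightarrow> nat" where
  "denom r = (THE d. d > 0 \<and> (\<exists>c::int. coprime c (int d) \<and> r = of_int c / of_nat d))"

lemma denom_eqI:
  assumes "d > 0" "coprime c (int d)"
  shows "denom (of_int c / of_nat d) = d"
  unfolding denom_def
proof (rule the_equality)
  show "0 < d \<and> (\<exists>c'::int. coprime c' (int d) \<and> (of_int c / of_nat d :: real) = of_int c' / of_nat d)"
    using assms by auto
next
  fix e assume "0 < e \<and> (\<exists>c'::int. coprime c' (int e) \<and> (of_int c / of_nat d :: real) = of_int c' / of_nat e)"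
  then obtain c' :: int where e: "e > 0" "coprime c' (int e)"
    and eq: "(of_int c / of_nat d :: real) = of_int c' / of_nat e" by auto
  have "real_of_int (c * int e) = real_of_int (c' * int d)"
    using eq e assms by (simp add: field_simps)
  then have *: "c * int e = c' * int d" by (simp only: of_int_eq_iff)
  have "int e dvd int d"
    using * e(2) by (metis coprime_commute coprime_dvd_mult_right_iff dvd_triv_right)
  moreover have "int d dvd int e"
    using * assms(2) by (metis coprime_commute coprime_dvd_mult_right_iff dvd_triv_right)
  ultimately show "e = d" by (simp add: dvd_antisym)
qed

definition den :: "real^'n \<Rightarrow> nat" where
  "den x = (LCM i\<in>UNIV. denom (x $ i))"

definition vertices :: "(real^'n) set set \<Rightarrow> (real^'n) set" where
  "vertices \<Delta> = {v. {v} \<in> \<Delta>}"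

text \<open>The family of weights is indexed by the vertices themselves; the values of \<open>a\<close> at
  other points are never used.\<close>

definition weighted_triangulation :: "(real^'n) set set \<Rightarrow> (real^'n \<Rightarrow> nat) \<Rightarrow> bool" where
  "weighted_triangulation \<Delta> a \<longleftrightarrow>
     simplicial_complex \<Delta> \<and> \<Union>\<Delta> = cube \<and>
     (\<forall>v\<in>vertices \<Delta>. (\<forall>i. v $ i \<in> \<rat>) \<and> a v > 0 \<and> a v dvd den v)"

definition affine_fun_on :: "(real^'n) set \<Rightarrow> (real^'n \<Rightarrow> real) \<Rightarrow> bool" where
  "affine_fun_on S f \<longleftrightarrow> (\<exists>b c. \<forall>x\<in>S. f x = b \<bullet> x + c)"

text \<open>A function affine on the simplices of a triangulation is determined by arbitrary prescribed
  values at the vertices, so for each vertex \<open>v\<close> exactly one \<open>h\<close> satisfies the following.\<close>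

definition is_hat :: "(real^'n) set set \<Rightarrow> (real^'n \<Rightarrow> nat) \<Rightarrow> real^'n \<Rightarrow> (real^'n \<Rightarrow> real) \<Rightarrow> bool" where
  "is_hat \<Delta> a v h \<longleftrightarrow>
     h \<in> cube \<rightarrow>\<^sub>E {0..1} \<and> (\<forall>T\<in>\<Delta>. affine_fun_on T h) \<and>
     h v = real (a v) / real (den v) \<and> (\<forall>w\<in>vertices \<Delta>. w \<noteq> v \<longrightarrow> h w = 0)"

definition hats :: "(real^'n) set set \<Rightarrow> (real^'n \<Rightarrow> nat) \<Rightarrow> (real^'n \<Rightarrow> real) set" where
  "hats \<Delta> a = {h. \<exists>v\<in>vertices \<Delta>. is_hat \<Delta> a v h}"

text \<open>A hat is continuous and piecewise affine, so it is a McNaughton function exactly if all its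
  affine pieces have integer coefficients.\<close>

definition basic :: "(real^'n) set set \<Rightarrow> (real^'n \<Rightarrow> nat) \<Rightarrow> bool" where
  "basic \<Delta> a \<longleftrightarrow> hats \<Delta> a \<subseteq> McNaughton"

end

theory Submission
  imports Defs
begin

text \<open>For the existence of hats generating \<open>A\<close>, let \<open>S\<close> be a finite set of generators. As \<open>A\<close> is
  separating, \<open>x \<mapsto> (f x, 1 - f x)\<^sub>f\<close> embeds the cube into an orthant, whose coordinates pull back to
  elements of \<open>A\<close>. A Farey subdivision of the standard fan at the sum of two
  vectors \<open>v\<close>, \<open>w\<close> replaces the corresponding coordinates \<open>g\<close>, \<open>h\<close> by \<open>min g h\<close>, \<open>g - min g h\<close> and
  \<open>h - min g h\<close>, so that the coordinates remain in \<open>A\<close> and generate it. Finitely many subdivisions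
  make every integral functional from a given finite set have constant sign on each cone; for the functionals
  that cut out the cones over the images of the cells on which all generators are affine, the cones meeting the image of the
  cube then pull back to a triangulation, and the coordinates to its hats. The weight of a vertex is
  its denominator divided by the degree of the corresponding primitive vector.

  Conversely, a coordinate function is a combination of the hats with coefficients
  \<open>v $ i * den v / a v\<close>. Hence hats separate points, and if all weights are \<open>1\<close> they generate the
  coordinates, which generate all McNaughton functions. If some weight \<open>a v\<close> is not \<open>1\<close>, then all
  functions in \<open>A\<close> take at \<open>v\<close> a multiple of \<open>a v / den v\<close> as value, whereas some McNaughton
  function takes the value \<open>1 / den v\<close>.\<close>

section \<open>MV-algebras of functions on the cube\<close>

text \<open>The obstacle is that the hats must stay inside \<open>A\<close>. A triangulation on
  which the generators are affine is easy to find, but its hats, and those of its refinements, need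
  not lie in \<open>A\<close>. Hence the subdivision takes place in the target of the embedding,
  where the first coordinates are in \<open>A\<close> by construction and each step is an
  MV-operation on them. The price is that unimodularity holds for the lattice of the orthant, not
  for that of the cube. The embedding respects integrality, but its inverse on a cell does so only
  up to a factor, because a Gram determinant has to be divided out. So a primitive vector of degree
  \<open>d\<close> lies over a rational point \<open>p\<close> with \<open>d\<close> dividing
  \<open>den p\<close>, and the quotient, which is the weight, may exceed 1. Separation enters only
  through the injectivity of the embedding: it makes the Gram matrices invertible and the points of
  the cube recoverable from their coordinates.\<close>

lemma mem_by_cube:
  assumes "f \<in> A" "\<And>x. x \<in> cube \<Longrightarrow> f x = g x" "f \<in> extensional cube" "g \<in> extensional cube"
  shows "g \<in> A"
  using extensionalityI[OF assms(3,4,2)] assms(1) by simp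

lemma restrict_mem_by_cube:
  assumes "f \<in> A" "\<And>x. x \<in> cube \<Longrightarrow> f x = g x" "f \<in> extensional cube"
  shows "restrict g cube \<in> A"
  by (rule mem_by_cube[OF assms(1)]) (use assms in auto)

lemma mv_closed_one:
  assumes "mv_closed A"
  shows "(\<lambda>x\<in>cube. 1) \<in> A"
proof -
  have "mv_neg mv_zero \<in> A" using assms by (simp add: mv_closed_def)
  then show ?thesis
    by (rule mem_by_cube) (auto simp: mv_neg_def mv_zero_def)
qed

lemma mv_closed_times:
  assumes "mv_closed A" "f \<in> A" "g \<in> A"
  shows "(\<lambda>x\<in>cube. max 0 (f x + g x - 1)) \<in> A"
proof -
  have "mv_neg (mv_plus (mv_neg f) (mv_neg g)) \<in> A" using assms by (simp add: mv_closed_def)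
  then show ?thesis
    by (rule mem_by_cube) (auto simp: mv_neg_def mv_plus_def)
qed

lemma mv_closed_diff:
  assumes "mv_closed A" "f \<in> A" "g \<in> A"
  shows "(\<lambda>x\<in>cube. max 0 (f x - g x)) \<in> A"
proof -
  have "mv_neg g \<in> A" using assms by (simp add: mv_closed_def)
  from mv_closed_times[OF assms(1,2) this] show ?thesis
    by (rule mem_by_cube) (auto simp: mv_neg_def)
qed

text \<open>This is the MV-term for the meet, the Lukasiewicz product of \<open>f\<close> with
  \<open>mv_plus (mv_neg f) g\<close>.\<close>

lemma mv_closed_min:
  assumes "mv_closed A" "A \<subseteq> cube \<rightarrow>\<^sub>E {0..1}" "f \<in> A" "g \<in> A"
  shows "(\<lambda>x\<in>cube. min (f x) (g x)) \<in> A"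
proof -
  have "mv_plus (mv_neg f) g \<in> A" using assms by (simp add: mv_closed_def)
  note * = mv_closed_times[OF assms(1,3) this]
  have "0 \<le> f x \<and> 0 \<le> g x" if "x \<in> cube" for x
    using assms(2-4) that by fastforce
  then show ?thesis
    by (intro mem_by_cube[OF *]) (simp_all add: mv_neg_def mv_plus_def, force simp: min_def max_def)
qed

lemma mv_closed_max:
  assumes "mv_closed A" "A \<subseteq> cube \<rightarrow>\<^sub>E {0..1}" "f \<in> A" "g \<in> A"
  shows "(\<lambda>x\<in>cube. max (f x) (g x)) \<in> A"
proof -
  have "mv_neg f \<in> A" "mv_neg g \<in> A" using assms by (simp_all add: mv_closed_def)
  from mv_closed_min[OF assms(1,2) this]
  have "mv_neg (\<lambda>x\<in>cube. min (mv_neg f x) (mv_neg g x)) \<in> A"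
    using assms(1) by (simp add: mv_closed_def)
  then show ?thesis
    by (rule mem_by_cube) (auto simp: mv_neg_def)
qed

lemma mv_closed_Min:
  assumes "mv_closed A" "A \<subseteq> cube \<rightarrow>\<^sub>E {0..1}" "finite I" "I \<noteq> {}" "\<And>i. i \<in> I \<Longrightarrow> f i \<in> A"
  shows "(\<lambda>x\<in>cube. Min ((\<lambda>i. f i x) ` I)) \<in> A"
  using assms(3-5)
proof (induction I rule: finite_ne_induct)
  case (singleton i)
  then have "f i \<in> A" by auto
  then show ?case
    by (rule restrict_mem_by_cube) (use assms(2) \<open>f i \<in> A\<close> in \<open>auto simp: PiE_def\<close>)
next
  case (insert i I)
  then have "(\<lambda>x\<in>cube. min (f i x) ((\<lambda>x\<in>cube. Min ((\<lambda>j. f j x) ` I)) x)) \<in> A"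
    by (intro mv_closed_min[OF assms(1,2)]) auto
  then show ?case
    by (rule restrict_mem_by_cube) (simp_all add: insert.hyps)
qed

lemma mv_closed_Max:
  assumes "mv_closed A" "A \<subseteq> cube \<rightarrow>\<^sub>E {0..1}" "finite I" "I \<noteq> {}" "\<And>i. i \<in> I \<Longrightarrow> f i \<in> A"
  shows "(\<lambda>x\<in>cube. Max ((\<lambda>i. f i x) ` I)) \<in> A"
  using assms(3-5)
proof (induction I rule: finite_ne_induct)
  case (singleton i)
  then have "f i \<in> A" by auto
  then show ?case
    by (rule restrict_mem_by_cube) (use assms(2) \<open>f i \<in> A\<close> in \<open>auto simp: PiE_def\<close>)
next
  case (insert i I)
  then have "(\<lambda>x\<in>cube. max (f i x) ((\<lambda>x\<in>cube. Max ((\<lambda>j. f j x) ` I)) x)) \<in> A"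
    by (intro mv_closed_max[OF assms(1,2)]) auto
  then show ?case
    by (rule restrict_mem_by_cube) (simp_all add: insert.hyps)
qed

lemma mv_closed_clipped_sum:
  assumes "mv_closed A" "A \<subseteq> cube \<rightarrow>\<^sub>E {0..1}" "finite I" "\<And>i. i \<in> I \<Longrightarrow> f i \<in> A"
  shows "(\<lambda>x\<in>cube. min 1 (\<Sum>i\<in>I. f i x)) \<in> A"
  using assms(3-4)
proof (induction I)
  case empty
  have "mv_zero \<in> A" using assms(1) by (simp add: mv_closed_def)
  then show ?case
    by (rule restrict_mem_by_cube) (simp_all add: mv_zero_def)
next
  case (insert i I)
  then have "mv_plus (f i) (\<lambda>x\<in>cube. min 1 (\<Sum>i\<in>I. f i x)) \<in> A"
    using assms(1) unfolding mv_closed_def by blast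
  moreover have "0 \<le> f i x" if "x \<in> cube" for x
    using assms(2) insert.prems[of i] that by fastforce
  ultimately show ?case
    by (elim restrict_mem_by_cube)
      (simp_all add: mv_plus_def insert.hyps, force simp: min_def)
qed

lemma mv_closed_nat_sum:
  assumes A: "mv_closed A" "A \<subseteq> cube \<rightarrow>\<^sub>E {0..1}" and fin: "finite I"
    and f: "\<And>i. i \<in> I \<Longrightarrow> f i \<in> A"
    and g: "g \<in> cube \<rightarrow>\<^sub>E {0..1}" "\<And>x. x \<in> cube \<Longrightarrow> g x = (\<Sum>i\<in>I. real (k i) * f i x)"
  shows "g \<in> A"
proof -
  \<comment> \<open>The index set repeats \<open>f i\<close> exactly \<open>k i\<close> times.
    Truncation is harmless, because the total is \<open>g\<close>, which is at most 1.\<close>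
  have "(\<lambda>x\<in>cube. min 1 (\<Sum>(i, j)\<in>(SIGMA i:I. {..<k i}). f i x)) \<in> A"
    using mv_closed_clipped_sum[OF A, of "SIGMA i:I. {..<k i}" "\<lambda>(i, j). f i"] fin f
    by (auto simp: case_prod_unfold)
  moreover have "(\<Sum>(i, j)\<in>(SIGMA i:I. {..<k i}). f i x) = g x" if "x \<in> cube" for x
    using fin that by (simp add: g(2) flip: sum.Sigma)
  ultimately show ?thesis
    using g(1) by (elim mem_by_cube)
      (auto simp: PiE_def Pi_def extensional_def min_def)
qed

lemma mv_closed_hull: "mv_closed (mv_closed hull S)"
  by (rule hull_in) (auto simp: mv_closed_def)

lemma McNaughton_subset: "McNaughton \<subseteq> cube \<rightarrow>\<^sub>E {0..1}"
  by (auto simp: McNaughton_def)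

section \<open>McNaughton functions are generated by the coordinates\<close>

lemma sum_int_coeff_minus_axis:
  fixes b :: "int^'n" and x :: "real^'n"
  shows "(\<Sum>j\<in>UNIV. of_int ((b - axis i 1) $ j) * x $ j) = (\<Sum>j\<in>UNIV. of_int (b $ j) * x $ j) - x $ i"
proof -
  have "(\<Sum>j\<in>UNIV. of_int ((b - axis i 1) $ j) * x $ j)
      = (\<Sum>j\<in>UNIV. of_int (b $ j) * x $ j - (if j = i then x $ j else 0))"
    by (rule sum.cong) (auto simp: axis_def algebra_simps)
  then show ?thesis by (simp add: sum_subtractf)
qed

text \<open>The left side is an MV-term in \<open>t\<close> and the clipped values of
  \<open>q\<close> and \<open>q + 1\<close>. The second factor is 1 if \<open>q\<close> is
  nonnegative; if \<open>q\<close> is negative, it restores what clipping \<open>q\<close> to 0 has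
  forgotten.\<close>

lemma clip_add:
  fixes q t :: real
  assumes "0 \<le> t" "t \<le> 1"
  shows "max 0 (min 1 (max 0 (min 1 q) + t) + max 0 (min 1 (q + 1)) - 1) = max 0 (min 1 (q + t))"
  using assms unfolding max_def min_def by (auto split: if_splits)

lemma clipped_int_affine_mem:
  fixes A :: "(real^'n \<Rightarrow> real) set"
  assumes A: "mv_closed A" and coord: "\<And>i. (\<lambda>x\<in>cube. x $ i) \<in> A"
  shows "(\<lambda>x\<in>cube. max 0 (min 1 ((\<Sum>i\<in>UNIV. of_int (b $ i) * x $ i) + of_int c))) \<in> A"
proof -
  define L where "L b c x = (\<Sum>i\<in>UNIV. of_int (b $ i) * x $ i) + of_int c" for b :: "int^'n" and c :: int and x :: "real^'n"
  define sz where "sz b = nat (\<Sum>i\<in>UNIV. \<bar>b $ i\<bar>)" for b :: "int^'n"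
  \<comment> \<open>By \<open>clip_add\<close>, one unit can be removed from a positive coefficient.\<close>
  have "(\<lambda>x\<in>cube. max 0 (min 1 (L b c x))) \<in> A"
  proof (induction "sz b" arbitrary: b c rule: less_induct)
    case less
    \<comment> \<open>Stated for every \<open>b'\<close> of the size of \<open>b\<close>, so that
      the case of a negative coefficient can apply it to \<open>-b\<close>; negation then turns
      \<open>L (-b) (1 - c)\<close> into \<open>L b c\<close>.\<close>
    have pos: "(\<lambda>x\<in>cube. max 0 (min 1 (L b' c' x))) \<in> A" if sz: "sz b' = sz b" and i: "b' $ i > 0" for b' c' i
    proof -
      let ?b = "b' - axis i 1"
      have "(\<Sum>j\<in>UNIV. \<bar>?b $ j\<bar>) < (\<Sum>j\<in>UNIV. \<bar>b' $ j\<bar>)"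
        by (rule sum_strict_mono_ex1) (use i in \<open>auto simp: axis_def intro!: bexI[of _ i]\<close>)
      moreover have "0 \<le> (\<Sum>j\<in>UNIV. \<bar>?b $ j\<bar>)" by (rule sum_nonneg) simp
      ultimately have "sz ?b < sz b'" unfolding sz_def by (simp only: nat_less_eq_zless)
      then have "sz ?b < sz b" using sz by simp
      note IH = less.hyps[OF this]
      have "mv_plus (\<lambda>x\<in>cube. max 0 (min 1 (L ?b c' x))) (\<lambda>x\<in>cube. x $ i) \<in> A"
        using IH coord A unfolding mv_closed_def by blast
      note mv_closed_times[OF A this IH[of "c' + 1"]]
      moreover have "L b' c' x = L ?b c' x + x $ i" "L ?b (c' + 1) x = L ?b c' x + 1" for x
        by (simp_all add: L_def sum_int_coeff_minus_axis del: vector_minus_component)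
      moreover have "0 \<le> x $ i \<and> x $ i \<le> 1" if "x \<in> cube" for x :: "real^'n"
        using that by (auto simp: mem_box_cart)
      ultimately show ?thesis
        by (elim restrict_mem_by_cube) (simp_all add: mv_plus_def clip_add)
    qed
    consider "\<And>i. b $ i = 0" | i where "b $ i > 0" | i where "b $ i < 0"
      by (meson linorder_neqE)
    then show ?case
    proof cases
      case 1
      have eq: "L b c x = of_int c" for x using 1 by (simp add: L_def)
      have "mv_zero \<in> A" using A by (simp add: mv_closed_def)
      then have z: "(\<lambda>x\<in>cube. 0) \<in> A" unfolding mv_zero_def .
      show ?thesis
      proof (cases "c \<le> 0")
        case True
        with z show ?thesis by (elim restrict_mem_by_cube) (simp_all add: eq)
      next
        case False
        with mv_closed_one[OF A] show ?thesis by (elim restrict_mem_by_cube) (simp_all add: eq)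
      qed
    next
      case 2
      then show ?thesis by (intro pos) auto
    next
      case 3
      then have "(\<lambda>x\<in>cube. max 0 (min 1 (L (-b) (1 - c) x))) \<in> A"
        by (intro pos[of _ i]) (auto simp: sz_def)
      then have "mv_neg (\<lambda>x\<in>cube. max 0 (min 1 (L (-b) (1 - c) x))) \<in> A"
        using A unfolding mv_closed_def by blast
      then show ?thesis
        by (rule restrict_mem_by_cube) (auto simp: mv_neg_def L_def sum_negf)
    qed
  qed
  then show ?thesis by (simp only: L_def)
qed

text \<open>Let \<open>s\<close> be the last time at which some piece \<open>p\<close> that starts
  above \<open>F\<close> is below \<open>F\<close>. If \<open>s < 1\<close>, a piece
  \<open>q\<close> equals \<open>F\<close> at \<open>s\<close> and at a later time \<open>t\<close>.
  By maximality \<open>q\<close> starts below \<open>F\<close>, and \<open>p\<close> is above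
  \<open>F\<close> at \<open>t\<close>. So the affine function \<open>p - q\<close> is positive at 0
  and at \<open>t\<close> but not at \<open>s\<close>, which is impossible.\<close>

lemma exists_piece_below_on_segment:
  fixes F :: "real \<Rightarrow> real"
  assumes cont: "continuous_on {0..1} F" and fin: "finite P"
    and aff: "\<And>p. p \<in> P \<Longrightarrow> \<exists>a b. \<forall>t. p t = a * t + b"
    and cover: "\<And>t. t \<in> {0..1} \<Longrightarrow> \<exists>p\<in>P. F t = p t"
  shows "\<exists>p\<in>P. p 0 \<ge> F 0 \<and> p 1 \<le> F 1"
proof -
  have contp: "continuous_on S p" if "p \<in> P" for p :: "real \<Rightarrow> real" and S
  proof -
    obtain a b where "\<And>t. p t = a * t + b" using aff[OF \<open>p \<in> P\<close>] by auto
    then have "p = (\<lambda>t. a * t + b)" by auto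
    then show ?thesis by (auto intro!: continuous_intros)
  qed
  define T where "T = (\<Union>p\<in>{p\<in>P. p 0 \<ge> F 0}. {t\<in>{0..1}. p t \<le> F t})"
  have "closed T"
    unfolding T_def
  proof (intro closed_UN ballI)
    show "finite {p \<in> P. F 0 \<le> p 0}" using fin by simp
  next
    fix p assume "p \<in> {p \<in> P. F 0 \<le> p 0}"
    then show "closed {t \<in> {0..1}. p t \<le> F t}"
      using cont contp by (intro continuous_on_closed_Collect_le) auto
  qed
  moreover have "bounded T" by (rule bounded_subset[of "{0..1}"]) (auto simp: T_def)
  ultimately have "compact T" by (simp add: compact_eq_bounded_closed)
  moreover have "0 \<in> T" using cover[of 0] by (force simp: T_def)
  ultimately obtain s where s: "s \<in> T" "\<And>t. t \<in> T \<Longrightarrow> t \<le> s"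
    by (metis compact_attains_sup empty_iff)
  obtain p where p: "p \<in> P" "p 0 \<ge> F 0" "p s \<le> F s" and s01: "0 \<le> s" "s \<le> 1" using s by (auto simp: T_def)
  show ?thesis
  proof (cases "s = 1")
    case True
    with p show ?thesis by auto
  next
    case False
    then have "s < 1" using s01 by simp
    \<comment> \<open>Finitely many pieces cover the times after \<open>s\<close>, so one of them
      equals \<open>F\<close> at times accumulating at \<open>s\<close>.\<close>
    have "s \<in> closure {s<..1}" using \<open>s < 1\<close> by simp
    also have "{s<..1} \<subseteq> \<Union>((\<lambda>q. {t\<in>{s<..1}. F t = q t}) ` P)"
      using cover s01 by fastforce
    then have "closure {s<..1} \<subseteq> closure (\<Union>((\<lambda>q. {t\<in>{s<..1}. F t = q t}) ` P))"
      by (rule closure_mono)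
    also have "\<dots> \<subseteq> (\<Union>q\<in>P. closure {t\<in>{s<..1}. F t = q t})"
      using fin by (intro closure_minimal closed_UN) (auto intro: closure_subset[THEN subsetD])
    finally obtain q where q: "q \<in> P" and cl: "s \<in> closure {t\<in>{s<..1}. F t = q t}" by blast
    have "closed {t\<in>{0..1}. F t = q t}"
      using cont contp[OF q] by (intro continuous_closed_preimage_constant[of _ "\<lambda>t. F t - q t" 0, simplified] continuous_intros) auto
    moreover have "{t\<in>{s<..1}. F t = q t} \<subseteq> {t\<in>{0..1}. F t = q t}" using s01 by auto
    ultimately have "s \<in> {t\<in>{0..1}. F t = q t}" using cl closure_minimal by blast
    then have qs: "F s = q s" by simp
    have "{t\<in>{s<..1}. F t = q t} \<noteq> {}" using cl closure_empty by (metis empty_iff)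
    then obtain t where t: "s < t" "t \<le> 1" "F t = q t" by auto
    have "t \<notin> T" using s(2) t by force
    then have "p t > q t" using p t s01 by (force simp: T_def)
    have "q 0 < F 0"
    proof (rule ccontr)
      assume "\<not> q 0 < F 0"
      then have "t \<in> T" using q t s01 unfolding T_def by (intro UN_I[of q]) auto
      then show False using \<open>t \<notin> T\<close> by simp
    qed
    obtain a b where a: "\<And>t. p t = a * t + b" using aff[OF p(1)] by auto
    obtain a' b' where a': "\<And>t. q t = a' * t + b'" using aff[OF q] by auto
    have h: "(a - a') * t + (b - b') > 0" "b - b' > 0" "(a - a') * s + (b - b') \<le> 0"
      using \<open>p t > q t\<close> \<open>q 0 < F 0\<close> p qs by (auto simp: a a' algebra_simps)
    show ?thesis
    proof (cases "a \<ge> a'")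
      case True
      then have "(a - a') * s \<ge> 0" using s01 by simp
      with h show ?thesis by linarith
    next
      case False
      then have "(a - a') * s \<ge> (a - a') * t" using t by (simp add: mult_left_mono_neg)
      with h show ?thesis by linarith
    qed
  qed
qed

lemma int_affine_line:
  assumes "int_affine p"
  shows "\<exists>a b. \<forall>t. p (y + t *\<^sub>R (x - y)) = a * t + b"
proof -
  obtain b :: "int^'a" and c :: int where p: "\<And>x. p x = (\<Sum>i\<in>UNIV. of_int (b $ i) * x $ i) + of_int c"
    using assms by (auto simp: int_affine_def)
  have "p (y + t *\<^sub>R (x - y)) = (\<Sum>i\<in>UNIV. of_int (b $ i) * (x $ i - y $ i)) * t + p y" for t
    by (simp add: p algebra_simps sum.distrib sum_subtractf sum_distrib_left)
  then show ?thesis by blast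
qed

lemma exists_piece_below:
  fixes f :: "real^'n \<Rightarrow> real"
  assumes cont: "continuous_on cube f" and P: "finite P" "\<And>p. p \<in> P \<Longrightarrow> int_affine p"
    and cover: "\<And>x. x \<in> cube \<Longrightarrow> \<exists>p\<in>P. f x = p x"
    and xy: "x \<in> cube" "y \<in> cube"
  shows "\<exists>p\<in>P. p y \<ge> f y \<and> p x \<le> f x"
proof -
  define l where "l t = y + t *\<^sub>R (x - y)" for t :: real
  have l: "l t \<in> cube" if "t \<in> {0..1}" for t
  proof -
    have "l t = (1 - t) *\<^sub>R y + t *\<^sub>R x" by (simp add: l_def algebra_simps)
    then show ?thesis using convexD_alt[OF convex_box(1) xy(2,1), of t] that by auto
  qed
  have "continuous_on {0..1} (f \<circ> l)"
    by (rule continuous_on_compose) (use l in \<open>auto simp: l_def intro!: continuous_intros continuous_on_subset[OF cont]\<close>)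
  moreover have "\<exists>p\<in>(\<lambda>p. p \<circ> l) ` P. (f \<circ> l) t = p t" if "t \<in> {0..1}" for t
    using cover[OF l[OF that]] by auto
  moreover have "\<exists>a b. \<forall>t. p t = a * t + b" if "p \<in> (\<lambda>p. p \<circ> l) ` P" for p
    using that int_affine_line[OF P(2), of _ y x] by (auto simp: l_def)
  ultimately have "\<exists>p\<in>(\<lambda>p. p \<circ> l) ` P. p 0 \<ge> (f \<circ> l) 0 \<and> p 1 \<le> (f \<circ> l) 1"
    using P(1) by (intro exists_piece_below_on_segment) auto
  then show ?thesis by (auto simp: l_def)
qed

theorem McNaughton_subset_if_coordinates:
  fixes A :: "(real^'n \<Rightarrow> real) set"
  assumes A: "mv_closed A" "A \<subseteq> cube \<rightarrow>\<^sub>E {0..1}" and coord: "\<And>i. (\<lambda>x\<in>cube. x $ i) \<in> A"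
  shows "McNaughton \<subseteq> A"
proof
  fix f :: "real^'n \<Rightarrow> real" assume "f \<in> McNaughton"
  then obtain P where f: "f \<in> cube \<rightarrow>\<^sub>E {0..1}" "continuous_on cube f" and P: "finite P" "\<And>p. p \<in> P \<Longrightarrow> int_affine p"
    and cover: "\<And>x. x \<in> cube \<Longrightarrow> \<exists>p\<in>P. f x = p x"
    by (auto simp: McNaughton_def)
  have f01: "0 \<le> f x" "f x \<le> 1" if "x \<in> cube" for x using f that by auto
  have seg: "\<exists>p\<in>P. p y \<ge> f y \<and> p x \<le> f x" if "x \<in> cube" "y \<in> cube" for x y
    by (rule exists_piece_below[OF f(2) P cover that])
  \<comment> \<open>\<open>f\<close> is the maximum over \<open>Z \<in> \<Y>\<close> of the minima of the pieces in \<open>Z\<close>.\<close>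
  define \<Y> where "\<Y> = {Y. Y \<subseteq> P \<and> Y \<noteq> {} \<and> (\<forall>x\<in>cube. \<exists>p\<in>Y. p x \<le> f x)}"
  define Y where "Y x = {p\<in>P. p x \<ge> f x}" for x
  \<comment> \<open>By \<open>seg\<close>, the pieces above \<open>f\<close> at \<open>x\<close>
    include, for each point of the cube, one that is below \<open>f\<close> there.\<close>
  have Y: "Y x \<in> \<Y>" if "x \<in> cube" for x
    using seg[OF _ that] cover[OF that] by (force simp: Y_def \<Y>_def)
  have fin: "finite \<Y>" using P(1) by (auto simp: \<Y>_def intro: finite_subset[of _ "Pow P"])
  have ne: "\<Y> \<noteq> {}" using Y[of 0] by (auto simp: mem_box_cart)
  have finY: "finite Z" "Z \<noteq> {}" if "Z \<in> \<Y>" for Z using that P(1) by (auto simp: \<Y>_def intro: finite_subset)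
  define m where "m Z x = Min ((\<lambda>p. max 0 (min 1 (p x))) ` Z)" for Z :: "(real^'n \<Rightarrow> real) set" and x :: "real^'n"
  have "(\<lambda>x\<in>cube. m Z x) \<in> A" if Z: "Z \<in> \<Y>" for Z
  proof -
    have "(\<lambda>x\<in>cube. max 0 (min 1 (p x))) \<in> A" if "p \<in> Z" for p
    proof -
      have "int_affine p" using P(2) that Z by (auto simp: \<Y>_def)
      then show ?thesis using clipped_int_affine_mem[OF A(1) coord] unfolding int_affine_def by auto
    qed
    from mv_closed_Min[OF A finY[OF Z], where f="\<lambda>p. \<lambda>x\<in>cube. max 0 (min 1 (p x))", OF this]
    have "(\<lambda>x\<in>cube. Min ((\<lambda>p. (\<lambda>x\<in>cube. max 0 (min 1 (p x))) x) ` Z)) \<in> A" by simp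
    then show ?thesis
      by (elim restrict_mem_by_cube) (simp_all add: m_def)
  qed
  then have "(\<lambda>x\<in>cube. Max ((\<lambda>Z. (\<lambda>x\<in>cube. m Z x) x) ` \<Y>)) \<in> A"
    by (rule mv_closed_Max[OF A fin ne])
  then have "(\<lambda>x\<in>cube. Max ((\<lambda>Z. m Z x) ` \<Y>)) \<in> A"
    by (elim restrict_mem_by_cube) simp_all
  then show "f \<in> A"
  proof (rule mem_by_cube)
    fix x :: "real^'n" assume x: "x \<in> cube"
    have "Max ((\<lambda>Z. m Z x) ` \<Y>) = f x"
    proof (rule antisym)
      have "m Z x \<le> f x" if Z: "Z \<in> \<Y>" for Z
      proof -
        obtain p where "p \<in> Z" "p x \<le> f x" using Z x by (auto simp: \<Y>_def)
        then have "m Z x \<le> max 0 (min 1 (p x))" using finY[OF Z] by (auto simp: m_def intro!: Min_le)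
        also have "\<dots> \<le> f x" using \<open>p x \<le> f x\<close> f01[OF x] by auto
        finally show ?thesis .
      qed
      then show "Max ((\<lambda>Z. m Z x) ` \<Y>) \<le> f x" using fin ne by simp
      have "f x \<le> m (Y x) x"
        using finY[OF Y[OF x]] f01[OF x] by (auto simp: m_def Y_def)
      also have "\<dots> \<le> Max ((\<lambda>Z. m Z x) ` \<Y>)" using fin Y[OF x] by (auto intro!: Max_ge)
      finally show "f x \<le> Max ((\<lambda>Z. m Z x) ` \<Y>)" .
    qed
    then show "(\<lambda>x\<in>cube. Max ((\<lambda>Z. m Z x) ` \<Y>)) x = f x" using x by simp
  qed (use f in \<open>auto simp: PiE_def\<close>)
qed

section \<open>Piecewise affine functions and hats\<close>

lemma affine_independent_interpolation:
  fixes C :: "'a::euclidean_space set"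
  assumes "\<not> affine_dependent C"
  shows "\<exists>b c. \<forall>v\<in>C. b \<bullet> v + c = val v"
proof (cases "C = {}")
  case False
  then obtain a where a: "a \<in> C" by auto
  define S where "S = C - {a}"
  have C: "C = insert a S" "a \<notin> S" using a by (auto simp: S_def)
  have "independent ((\<lambda>x. x - a) ` S)" using assms affine_dependent_iff_dependent[OF C(2)] C(1) by simp
  then obtain g where g: "linear g" "\<And>x. x \<in> (\<lambda>x. x - a) ` S \<Longrightarrow> g x = val (x + a) - val a"
    using linear_independent_extend[of "(\<lambda>x. x - a) ` S" "\<lambda>x. val (x + a) - val a"] by blast
  \<comment> \<open>The vector that represents the linear functional \<open>g\<close> by the inner
    product.\<close>
  define w where "w = adjoint g 1"
  have adj: "w \<bullet> x = g x" for x
    using adjoint_works[OF g(1), of x 1] by (simp add: inner_commute w_def)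
  have "w \<bullet> v + (val a - w \<bullet> a) = val v" if "v \<in> C" for v
  proof (cases "v = a")
    case False
    then have "g (v - a) = val v - val a" using that C by (subst g(2)) auto
    then have "w \<bullet> (v - a) = val v - val a" by (simp only: adj)
    then show ?thesis by (simp add: inner_diff_right)
  qed simp
  then show ?thesis by blast
qed simp

lemma affine_fun_on_convex_sum:
  fixes f :: "real^'n \<Rightarrow> real"
  assumes "affine_fun_on T f" "finite C" "C \<subseteq> T" "(\<Sum>v\<in>C. u v) = 1" "(\<Sum>v\<in>C. u v *\<^sub>R v) \<in> T"
  shows "f (\<Sum>v\<in>C. u v *\<^sub>R v) = (\<Sum>v\<in>C. u v * f v)"
proof -
  obtain b c where f: "\<And>x. x \<in> T \<Longrightarrow> f x = b \<bullet> x + c" using assms(1) by (auto simp: affine_fun_on_def)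
  have "(\<Sum>v\<in>C. u v * f v) = (\<Sum>v\<in>C. u v * (b \<bullet> v + c))"
    using f assms(3) by (intro sum.cong) auto
  also have "\<dots> = b \<bullet> (\<Sum>v\<in>C. u v *\<^sub>R v) + c"
    using assms(4) by (simp add: algebra_simps sum.distrib inner_sum_right flip: sum_distrib_left)
  finally show ?thesis using f[OF assms(5)] by simp
qed

lemma affine_fun_on_subset: "affine_fun_on T f \<Longrightarrow> S \<subseteq> T \<Longrightarrow> affine_fun_on S f"
  unfolding affine_fun_on_def by blast

lemma affine_fun_on_cong: "affine_fun_on T f \<Longrightarrow> (\<And>x. x \<in> T \<Longrightarrow> f x = g x) \<Longrightarrow> affine_fun_on T g"
  unfolding affine_fun_on_def by auto

lemma affine_fun_on_sum:
  assumes "\<And>i. i \<in> I \<Longrightarrow> affine_fun_on T (f i)"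
  shows "affine_fun_on T (\<lambda>x. \<Sum>i\<in>I. k i * f i x)"
proof -
  from assms have "\<forall>i\<in>I. \<exists>b c. \<forall>x\<in>T. f i x = b \<bullet> x + c" by (simp add: affine_fun_on_def)
  then obtain b where "\<forall>i\<in>I. \<exists>c. \<forall>x\<in>T. f i x = b i \<bullet> x + c" unfolding bchoice_iff by blast
  then obtain c where bc: "\<And>i x. i \<in> I \<Longrightarrow> x \<in> T \<Longrightarrow> f i x = b i \<bullet> x + c i" unfolding bchoice_iff by blast
  have "(\<Sum>i\<in>I. k i * f i x) = (\<Sum>i\<in>I. k i *\<^sub>R b i) \<bullet> x + (\<Sum>i\<in>I. k i * c i)" if "x \<in> T" for x
    by (simp add: bc that inner_sum_left sum.distrib distrib_left)
  then show ?thesis unfolding affine_fun_on_def by blast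
qed

lemma simplex_of_complex:
  assumes "simplicial_complex \<Delta>" "T \<in> \<Delta>"
  obtains C where "finite C" "\<not> affine_dependent C" "T = convex hull C" "C \<subseteq> vertices \<Delta>" "C \<subseteq> T"
proof -
  obtain C where C: "\<not> affine_dependent C" "T = convex hull C"
    using assms by (auto simp: simplicial_complex_def simplex_def)
  have "{v} \<in> \<Delta>" if "v \<in> C" for v
  proof -
    have "{v} face_of T" unfolding C(2) face_of_convex_hull_affine_independent[OF C(1)]
      using that by (intro exI[of _ "{v}"]) auto
    then show ?thesis using assms unfolding simplicial_complex_def by blast
  qed
  then have "C \<subseteq> vertices \<Delta>" by (auto simp: vertices_def)
  then show ?thesis using that[OF aff_independent_finite[OF C(1)] C] C(2) hull_subset[of C convex] by simp
qed

lemma finite_vertices: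
  assumes "simplicial_complex \<Delta>"
  shows "finite (vertices \<Delta>)"
proof -
  have "finite ((\<lambda>v. {v}) ` vertices \<Delta>)"
    by (rule finite_subset[of _ \<Delta>]) (use assms in \<open>auto simp: vertices_def simplicial_complex_def\<close>)
  then show ?thesis by (rule finite_imageD) auto
qed

lemma point_of_complex:
  assumes "simplicial_complex \<Delta>" "T \<in> \<Delta>" "x \<in> T"
  obtains C u where "finite C" "C \<subseteq> vertices \<Delta>" "C \<subseteq> T" "\<And>v. v \<in> C \<Longrightarrow> 0 \<le> u v"
    "(\<Sum>v\<in>C. u v) = (1::real)" "x = (\<Sum>v\<in>C. u v *\<^sub>R v)"
proof -
  obtain C where C: "finite C" "T = convex hull C" "C \<subseteq> vertices \<Delta>" "C \<subseteq> T"
    using simplex_of_complex[OF assms(1,2)] by metis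
  obtain u where "\<forall>v\<in>C. 0 \<le> u v" "(\<Sum>v\<in>C. u v) = (1::real)" "(\<Sum>v\<in>C. u v *\<^sub>R v) = x"
    using assms(3) C(1,2) by (auto simp: convex_hull_finite)
  then show ?thesis using that[of C u] C by auto
qed

lemma piecewise_affine_eqI:
  fixes f g :: "real^'n \<Rightarrow> real"
  assumes "simplicial_complex \<Delta>" "T \<in> \<Delta>" "x \<in> T" "affine_fun_on T f" "affine_fun_on T g"
    "\<And>v. v \<in> vertices \<Delta> \<Longrightarrow> v \<in> T \<Longrightarrow> f v = g v"
  shows "f x = g x"
proof -
  obtain C u where C: "finite C" "C \<subseteq> vertices \<Delta>" "C \<subseteq> T" and "\<And>v. v \<in> C \<Longrightarrow> 0 \<le> u v"
    and u: "(\<Sum>v\<in>C. u v) = (1::real)" and x: "x = (\<Sum>v\<in>C. u v *\<^sub>R v)"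
    by (rule point_of_complex[OF assms(1-3)]) blast
  have "f x = (\<Sum>v\<in>C. u v * f v)" "g x = (\<Sum>v\<in>C. u v * g v)"
    using assms(3) C u unfolding x by (auto intro!: affine_fun_on_convex_sum assms(4,5))
  moreover have "(\<Sum>v\<in>C. u v * f v) = (\<Sum>v\<in>C. u v * g v)"
    using assms(6) C by (intro sum.cong) auto
  ultimately show ?thesis by simp
qed

text \<open>Each simplex is interpolated separately. Two simplices meet in a common simplex, on
  which the interpolants agree at the vertices and therefore everywhere, so it does not matter which
  simplex is picked for a point.\<close>

lemma exists_piecewise_affine:
  fixes \<Delta> :: "(real^'n) set set"
  assumes sc: "simplicial_complex \<Delta>"
  shows "\<exists>f. (\<forall>T\<in>\<Delta>. affine_fun_on T f) \<and> (\<forall>v\<in>vertices \<Delta>. f v = val v)"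
proof -
  have "\<exists>b c. \<forall>v\<in>vertices \<Delta> \<inter> T. b \<bullet> v + c = val v" if T: "T \<in> \<Delta>" for T
  proof -
    obtain C where C: "\<not> affine_dependent C" "T = convex hull C"
      using simplex_of_complex[OF sc T] by metis
    \<comment> \<open>A vertex of the complex that lies in \<open>T\<close> is a face of
      \<open>T\<close>, hence one of the independent points spanning it.\<close>
    have "v \<in> C" if "v \<in> vertices \<Delta>" "v \<in> T" for v
    proof -
      have "T \<inter> {v} face_of T" using that T sc unfolding simplicial_complex_def vertices_def by blast
      then have "{v} face_of T" using that by (simp add: Int_absorb1)
      then obtain c where "c \<subseteq> C" "{v} = convex hull c"
        using face_of_convex_hull_affine_independent[OF C(1)] C(2) by metis
      then show ?thesis using hull_subset[of c convex] by (cases "c = {}") auto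
    qed
    then show ?thesis using affine_independent_interpolation[OF C(1), of val] by blast
  qed
  then obtain b c where bc: "\<And>T v. T \<in> \<Delta> \<Longrightarrow> v \<in> vertices \<Delta> \<Longrightarrow> v \<in> T \<Longrightarrow> b T \<bullet> v + c T = val v" by (metis IntI)
  define S where "S x = (SOME T. T \<in> \<Delta> \<and> x \<in> T)" for x
  have S: "S x \<in> \<Delta> \<and> x \<in> S x" if "T \<in> \<Delta>" "x \<in> T" for x T
    unfolding S_def by (rule someI[of _ T]) (use that in auto)
  define f where "f x = b (S x) \<bullet> x + c (S x)" for x
  have aff: "affine_fun_on W (\<lambda>x. b T \<bullet> x + c T)" for W T by (auto simp: affine_fun_on_def)
  have "f x = b T \<bullet> x + c T" if T: "T \<in> \<Delta>" "x \<in> T" for x T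
    unfolding f_def
  proof (rule piecewise_affine_eqI[OF sc, of "S x \<inter> T" x "\<lambda>z. b (S x) \<bullet> z + c (S x)" "\<lambda>x. b T \<bullet> x + c T"])
    show "S x \<inter> T \<in> \<Delta>" using sc S[OF T] T unfolding simplicial_complex_def by blast
  qed (use S[OF T] T bc in \<open>auto intro!: aff\<close>)
  then have "\<forall>T\<in>\<Delta>. affine_fun_on T f" unfolding affine_fun_on_def by blast
  moreover have "f v = val v" if "v \<in> vertices \<Delta>" for v
    using that S[of "{v}" v] bc[of "S v" v] by (auto simp: f_def vertices_def)
  ultimately show ?thesis by blast
qed

section \<open>Denominators of rational points\<close>

lemma denom_rat:
  assumes "r \<in> \<rat>"
  obtains c :: int where "denom r > 0" "coprime c (int (denom r))" "r = of_int c / of_nat (denom r)"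
proof -
  obtain c d :: int where d: "d > 0" "coprime c d" "r = of_int c / of_int d"
    using Rats_cases'[OF assms] by metis
  then have "denom r = nat d" using denom_eqI[of "nat d" c] by auto
  with d that show ?thesis by auto
qed

lemma den_pos:
  fixes v :: "real^'n"
  assumes "\<forall>i. v $ i \<in> \<rat>"
  shows "den v > 0"
proof -
  have "0 \<noteq> denom (v $ i)" for i using denom_rat[of "v $ i"] assms by (metis less_numeral_extra(3))
  then have "0 \<notin> range (\<lambda>i. denom (v $ i))" by blast
  then have "den v \<noteq> 0" unfolding den_def by (subst Lcm_0_iff) auto
  then show ?thesis by simp
qed

lemma den_times_int:
  fixes v :: "real^'n"
  assumes "\<forall>i. v $ i \<in> \<rat>"
  shows "of_nat (den v) * v $ i \<in> \<int>"
proof -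
  obtain c :: int where c: "denom (v $ i) > 0" "v $ i = of_int c / of_nat (denom (v $ i))"
    using denom_rat[of "v $ i"] assms by metis
  have "denom (v $ i) dvd den v" by (auto simp: den_def)
  then obtain k where k: "den v = denom (v $ i) * k" by auto
  have "of_nat (den v) * v $ i = of_nat k * (of_nat (denom (v $ i)) * v $ i)" by (simp add: k mult_ac)
  also have "of_nat (denom (v $ i)) * v $ i = of_int c" using c by (simp add: field_simps)
  finally have "of_nat (den v) * v $ i = of_int (int k * c)" by simp
  then show ?thesis by (metis Ints_of_int)
qed

text \<open>Bezout's identity is used twice: it combines \<open>v $ j\<close> and \<open>1\<close>
  to \<open>1 / d\<close>, and then \<open>1 / L\<close> and \<open>1 / d\<close> to
  \<open>gcd d L / (L * d) = 1 / lcm d L\<close>. The set \<open>J\<close> lets the denominators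
  enter one at a time.\<close>

lemma int_combination_inverse_Lcm:
  fixes v :: "real^'n"
  assumes rat: "\<forall>i. v $ i \<in> \<rat>" and "finite J"
  shows "\<exists>(b::int^'n) (c::int). (\<Sum>i\<in>UNIV. of_int (b $ i) * v $ i) + of_int c = 1 / real (LCM i\<in>J. denom (v $ i))"
  using \<open>finite J\<close>
proof (induction J)
  case empty
  show ?case by (intro exI[of _ 0] exI[of _ 1]) simp
next
  case (insert j J)
  define L where "L = (LCM i\<in>J. denom (v $ i))"
  obtain b :: "int^'n" and c :: int where bc: "(\<Sum>i\<in>UNIV. of_int (b $ i) * v $ i) + of_int c = 1 / real L"
    using insert.IH by (auto simp: L_def)
  obtain e :: int where d: "denom (v $ j) > 0" "coprime e (int (denom (v $ j)))" "v $ j = of_int e / of_nat (denom (v $ j))"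
    using denom_rat[of "v $ j"] rat by metis
  define d where "d = denom (v $ j)"
  have "0 \<noteq> denom (v $ i)" for i using denom_rat[of "v $ i"] rat by (metis less_numeral_extra(3))
  then have "0 \<notin> (\<lambda>i. denom (v $ i)) ` J" by blast
  then have "L \<noteq> 0" unfolding L_def using insert.hyps by (subst Lcm_0_iff) auto
  then have L0: "L > 0" by simp
  obtain p q :: int where pq: "p * e + q * int d = 1"
    using d(2) bezout_int[of e "int d"] by (auto simp: d_def coprime_iff_gcd_eq_1)
  obtain r s :: int where rs: "r * int d + s * int L = gcd (int d) (int L)"
    using bezout_int[of "int d" "int L"] by auto
  define b' where "b' = (\<chi> i. r * b $ i + (if i = j then s * p else 0))"
  define c' where "c' = r * c + s * q"
  have "(\<Sum>i\<in>UNIV. of_int (b' $ i) * v $ i) = of_int r * (\<Sum>i\<in>UNIV. of_int (b $ i) * v $ i) + of_int (s * p) * v $ j"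
  proof -
    have "(\<Sum>i\<in>UNIV. of_int (b' $ i) * v $ i)
        = (\<Sum>i\<in>UNIV. of_int r * (of_int (b $ i) * v $ i) + (if i = j then of_int (s * p) * v $ i else 0))"
      by (rule sum.cong) (auto simp: b'_def algebra_simps)
    then show ?thesis by (simp add: sum.distrib sum_distrib_left)
  qed
  then have "(\<Sum>i\<in>UNIV. of_int (b' $ i) * v $ i) + of_int c'
      = of_int r * ((\<Sum>i\<in>UNIV. of_int (b $ i) * v $ i) + of_int c) + of_int s * (of_int p * v $ j + of_int q)"
    by (simp add: c'_def algebra_simps)
  also have "\<dots> = of_int r / real L + of_int s * (of_int p * v $ j + of_int q)" by (simp add: bc)
  also have "of_int p * v $ j + of_int q = of_int (p * e + q * int d) / real d"
    using d by (simp add: d_def field_simps)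
  also have "\<dots> = 1 / real d" by (simp add: pq)
  also have "of_int r / real L + of_int s * (1 / real d) = of_int (r * int d + s * int L) / (real L * real d)"
    using L0 d by (simp add: d_def field_simps)
  also have "\<dots> = real (gcd d L) / (real L * real d)" unfolding rs by simp
  also have "\<dots> = real (gcd d L) / (real (gcd d L) * real (lcm d L))"
    using prod_gcd_lcm_nat[of d L] by (metis mult.commute of_nat_mult)
  also have "\<dots> = 1 / real (lcm d L)" using d by (simp add: d_def)
  finally show ?case by (auto simp: d_def L_def)
qed

lemma ex_McNaughton_value_inverse_den:
  fixes v :: "real^'n"
  assumes "v \<in> cube" "\<forall>i. v $ i \<in> \<rat>"
  shows "\<exists>f\<in>McNaughton. f v = 1 / real (den v)"
proof -
  obtain b :: "int^'n" and c :: int where bc: "(\<Sum>i\<in>UNIV. of_int (b $ i) * v $ i) + of_int c = 1 / real (den v)"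
    using int_combination_inverse_Lcm[OF assms(2), of UNIV] by (auto simp: den_def)
  define p where "p x = (\<Sum>i\<in>UNIV. of_int (b $ i) * x $ i) + of_int c" for x :: "real^'n"
  have "int_affine p" by (auto simp: int_affine_def p_def)
  moreover have "int_affine (\<lambda>x::real^'n. 0)"
    unfolding int_affine_def by (intro exI[of _ 0]) simp
  moreover have "int_affine (\<lambda>x::real^'n. 1)"
    unfolding int_affine_def by (intro exI[of _ 0] exI[of _ 1]) simp
  moreover have "continuous_on cube (\<lambda>x\<in>cube. max 0 (min 1 (p x)))"
    unfolding p_def by (subst continuous_on_cong[OF refl restrict_apply]) (auto intro!: continuous_intros)
  ultimately have "(\<lambda>x\<in>cube. max 0 (min 1 (p x))) \<in> McNaughton"
    unfolding McNaughton_def by (auto intro!: exI[of _ "{p, \<lambda>x. 0, \<lambda>x. 1}"] simp: min_def max_def)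
  moreover have "max 0 (min 1 (p v)) = 1 / real (den v)"
    using den_pos[OF assms(2)] by (simp add: p_def bc)
  ultimately show ?thesis using assms(1) by (intro bexI) auto
qed

section \<open>Hats of a weighted triangulation\<close>

context
  fixes \<Delta> :: "(real^'n) set set" and a :: "real^'n \<Rightarrow> nat"
  assumes wt: "weighted_triangulation \<Delta> a"
begin

lemma wt_complex: "simplicial_complex \<Delta>" and wt_Union: "\<Union>\<Delta> = cube"
  using wt by (auto simp: weighted_triangulation_def)

lemma wt_vertex:
  assumes "v \<in> vertices \<Delta>"
  shows "v \<in> cube" "\<forall>i. v $ i \<in> \<rat>" "a v > 0" "a v dvd den v" "den v > 0"
proof -
  show "v \<in> cube" using assms wt_Union by (auto simp: vertices_def)
  show "\<forall>i. v $ i \<in> \<rat>" "a v > 0" "a v dvd den v"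
    using assms wt by (auto simp: weighted_triangulation_def)
  then show "den v > 0" by (intro den_pos)
qed

lemma hat_ex1:
  assumes v: "v \<in> vertices \<Delta>"
  shows "\<exists>!h. is_hat \<Delta> a v h"
proof -
  define r where "r = real (a v) / real (den v)"
  have "a v \<le> den v" using wt_vertex[OF v] by (auto intro: dvd_imp_le)
  then have r: "0 \<le> r" "r \<le> 1" using wt_vertex[OF v] by (auto simp: r_def)
  obtain f where f: "\<And>T. T \<in> \<Delta> \<Longrightarrow> affine_fun_on T f" "\<And>w. w \<in> vertices \<Delta> \<Longrightarrow> f w = (if w = v then r else 0)"
    using exists_piecewise_affine[OF wt_complex, of "\<lambda>w. if w = v then r else 0"] by blast
  have f01: "0 \<le> f x \<and> f x \<le> 1" if x: "x \<in> cube" for x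
  proof -
    obtain T where T: "T \<in> \<Delta>" "x \<in> T" using wt_Union x by blast
    obtain C u where C: "finite C" "C \<subseteq> vertices \<Delta>" "C \<subseteq> T" and u: "\<And>v. v \<in> C \<Longrightarrow> 0 \<le> u v"
      "(\<Sum>v\<in>C. u v) = (1::real)" and x: "x = (\<Sum>v\<in>C. u v *\<^sub>R v)"
      by (rule point_of_complex[OF wt_complex T]) blast
    have fx: "f x = (\<Sum>v\<in>C. u v * f v)"
      unfolding x by (rule affine_fun_on_convex_sum[OF f(1)[OF T(1)] C(1,3) u(2)]) (use T x in simp)
    have f01: "0 \<le> f v \<and> f v \<le> 1" if "v \<in> C" for v using C that r by (auto simp: f(2) subset_iff)
    have "0 \<le> (\<Sum>v\<in>C. u v * f v)" using u f01 by (intro sum_nonneg mult_nonneg_nonneg) auto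
    moreover have "(\<Sum>v\<in>C. u v * f v) \<le> (\<Sum>v\<in>C. u v * 1)"
      using u(1) f01 by (intro sum_mono mult_left_mono) auto
    ultimately show ?thesis using fx u by simp
  qed
  have sub: "T \<subseteq> cube" if "T \<in> \<Delta>" for T using wt_Union that by blast
  have vs: "w \<in> cube" if "w \<in> vertices \<Delta>" for w using wt_vertex that by blast
  have "is_hat \<Delta> a v (restrict f cube)"
    unfolding is_hat_def
  proof (intro conjI ballI impI)
    show "restrict f cube \<in> cube \<rightarrow>\<^sub>E {0..1}" using f01 by auto
    show "affine_fun_on T (restrict f cube)" if "T \<in> \<Delta>" for T
      using f(1)[OF that] by (rule affine_fun_on_cong) (use sub[OF that] in auto)
  qed (use vs v in \<open>simp_all add: f(2) r_def\<close>)
  moreover have "g = h" if "is_hat \<Delta> a v g" "is_hat \<Delta> a v h" for g h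
  proof (rule extensionalityI)
    show "g \<in> extensional cube" "h \<in> extensional cube" using that by (auto simp: is_hat_def PiE_def)
    fix x :: "real^'n" assume "x \<in> cube"
    then obtain T where T: "T \<in> \<Delta>" "x \<in> T" using wt_Union by blast
    show "g x = h x"
      by (rule piecewise_affine_eqI[OF wt_complex T]) (use that T in \<open>auto simp: is_hat_def, metis\<close>)
  qed
  ultimately show ?thesis by blast
qed

definition hat :: "real^'n \<Rightarrow> real^'n \<Rightarrow> real" where "hat v = (THE h. is_hat \<Delta> a v h)"

lemma is_hat_hat: "v \<in> vertices \<Delta> \<Longrightarrow> is_hat \<Delta> a v (hat v)"
  unfolding hat_def by (rule theI'[of "is_hat \<Delta> a v"]) (rule hat_ex1)

lemma hats_eq: "hats \<Delta> a = hat ` vertices \<Delta>"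
  using hat_ex1 is_hat_hat unfolding hats_def by blast

text \<open>Both sides are affine on each simplex, and \<open>real (den v) / real (a v)\<close> is
  the reciprocal of the height of \<open>hat v\<close> at its vertex.\<close>

lemma affine_eq_sum_hats:
  fixes p :: "real^'n \<Rightarrow> real"
  assumes p: "affine_fun_on UNIV p" and x: "x \<in> cube"
  shows "p x = (\<Sum>v\<in>vertices \<Delta>. p v * (real (den v) / real (a v)) * hat v x)"
proof -
  obtain T where T: "T \<in> \<Delta>" "x \<in> T" using wt_Union x by blast
  show ?thesis
  proof (rule piecewise_affine_eqI[OF wt_complex T])
    show "affine_fun_on T p" by (rule affine_fun_on_subset[OF p]) simp
    show "affine_fun_on T (\<lambda>x. \<Sum>v\<in>vertices \<Delta>. p v * (real (den v) / real (a v)) * hat v x)"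
      by (rule affine_fun_on_sum) (use is_hat_hat T in \<open>auto simp: is_hat_def\<close>)
    fix w assume w: "w \<in> vertices \<Delta>"
    have "(\<Sum>v\<in>vertices \<Delta>. p v * (real (den v) / real (a v)) * hat v w)
        = (\<Sum>v\<in>vertices \<Delta>. if v = w then p v else 0)"
    proof (rule sum.cong[OF refl])
      fix v assume v: "v \<in> vertices \<Delta>"
      show "p v * (real (den v) / real (a v)) * hat v w = (if v = w then p v else 0)"
        using is_hat_hat[OF v] w wt_vertex[OF v] unfolding is_hat_def by auto
    qed
    then show "p w = (\<Sum>v\<in>vertices \<Delta>. p v * (real (den v) / real (a v)) * hat v w)"
      using finite_vertices[OF wt_complex] w by simp
  qed
qed

lemma coordinate_eq_sum_hats:
  assumes "x \<in> cube"
  shows "x $ i = (\<Sum>v\<in>vertices \<Delta>. v $ i * (real (den v) / real (a v)) * hat v x)"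
proof (rule affine_eq_sum_hats[OF _ assms])
  show "affine_fun_on UNIV (\<lambda>x::real^'n. x $ i)"
    unfolding affine_fun_on_def by (rule exI[of _ "axis i 1"], rule exI[of _ 0]) (simp add: inner_axis inner_commute)
qed

lemma hats_finitely_generated_separating:
  assumes "generates (hats \<Delta> a) A"
  shows "finitely_generated A" "separating A"
proof -
  show "finitely_generated A"
    using assms finite_vertices[OF wt_complex] by (auto simp: finitely_generated_def hats_eq)
  have sub: "hats \<Delta> a \<subseteq> A" using assms hull_subset[of "hats \<Delta> a" mv_closed] by (simp add: generates_def)
  show "separating A"
    unfolding separating_def
  proof (intro ballI impI, rule ccontr)
    fix x y :: "real^'n" assume xy: "x \<in> cube" "y \<in> cube" "x \<noteq> y" "\<not> (\<exists>f\<in>A. f x \<noteq> f y)"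
    then have "hat v x = hat v y" if "v \<in> vertices \<Delta>" for v
      using that sub hats_eq by blast
    then have "x $ i = y $ i" for i
      by (simp add: coordinate_eq_sum_hats[OF xy(1)] coordinate_eq_sum_hats[OF xy(2)])
    then show False using xy by (simp add: vec_eq_iff)
  qed
qed

lemma generated_by_hats_neq_McNaughton:
  assumes gen: "generates (hats \<Delta> a) A" and v: "v \<in> vertices \<Delta>" "a v \<noteq> 1"
  shows "A \<noteq> McNaughton"
proof
  assume AM: "A = McNaughton"
  obtain k where k: "den v = a v * k" using wt_vertex[OF v(1)] by auto
  \<comment> \<open>Since \<open>k = den v / a v\<close>, the values at \<open>v\<close> are
    multiples of \<open>a v / den v\<close>. Negation and truncation respect this because 1 is such
    a multiple.\<close>
  define B where "B = {f :: real^'n \<Rightarrow> real. real k * f v \<in> \<int>}"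
  have kpos: "k > 0" using wt_vertex[OF v(1)] k by (auto intro!: gr0I)
  have vc: "v \<in> cube" by (rule wt_vertex[OF v(1)])
  have "mv_closed B"
    unfolding mv_closed_def B_def mv_zero_def mv_plus_def mv_neg_def
    using vc by (auto simp: min_def algebra_simps)
  moreover have "hats \<Delta> a \<subseteq> B"
  proof
    fix h assume "h \<in> hats \<Delta> a"
    then obtain w where "w \<in> vertices \<Delta>" "is_hat \<Delta> a w h" by (auto simp: hats_def)
    then have "h v = 0 \<or> h v = real (a v) / real (den v)" using v unfolding is_hat_def by auto
    moreover have "real k * (real (a v) / real (den v)) = 1"
      using kpos wt_vertex[OF v(1)] by (simp add: k)
    ultimately show "h \<in> B" by (auto simp: B_def)
  qed
  ultimately have "A \<subseteq> B" using gen hull_minimal[of "hats \<Delta> a" B mv_closed] by (simp add: generates_def)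
  then have "real k * (1 / real (den v)) \<in> \<int>"
    using ex_McNaughton_value_inverse_den[OF vc wt_vertex(2)[OF v(1)]] AM by (auto simp: B_def)
  moreover have "real k * (1 / real (den v)) = 1 / real (a v)" using kpos by (simp add: k)
  ultimately obtain z :: int where "1 / real (a v) = of_int z" by (auto elim: Ints_cases)
  then have "real_of_int (z * int (a v)) = 1" using wt_vertex(3)[OF v(1)] by (simp add: field_simps)
  then have "z * int (a v) = 1" by (simp only: of_int_eq_1_iff)
  then have "int (a v) dvd 1" by (metis dvd_triv_right)
  then show False using v by simp
qed

lemma McNaughton_subset_if_unit_weights:
  assumes gen: "generates (hats \<Delta> a) A" and A: "A \<subseteq> cube \<rightarrow>\<^sub>E {0..1}"
    and one: "\<And>v. v \<in> vertices \<Delta> \<Longrightarrow> a v = 1"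
  shows "McNaughton \<subseteq> A"
proof (rule McNaughton_subset_if_coordinates)
  show cl: "mv_closed A" using gen mv_closed_hull unfolding generates_def by blast
  show "A \<subseteq> cube \<rightarrow>\<^sub>E {0..1}" by fact
  have sub: "hats \<Delta> a \<subseteq> A" using gen hull_subset[of "hats \<Delta> a" mv_closed] by (simp add: generates_def)
  fix i
  \<comment> \<open>Natural coefficients are required, because a sum in the MV-algebra can only
    repeat summands.\<close>
  have "\<exists>k. real k = real (den v) * v $ i" if v: "v \<in> vertices \<Delta>" for v
  proof -
    obtain z where z: "real (den v) * v $ i = of_int z"
      using den_times_int[OF wt_vertex(2)[OF v]] by (metis Ints_cases)
    have "0 \<le> v $ i" using wt_vertex(1)[OF v] by (simp add: mem_box_cart)
    then have "0 \<le> real_of_int z" by (simp flip: z)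
    then show ?thesis using z by (intro exI[of _ "nat z"]) simp
  qed
  then obtain k where k: "\<And>v. v \<in> vertices \<Delta> \<Longrightarrow> real (k v) = real (den v) * v $ i" by metis
  show "(\<lambda>x\<in>cube. x $ i) \<in> A"
  proof (rule mv_closed_nat_sum[OF cl A finite_vertices[OF wt_complex], of hat _ k])
    show "hat v \<in> A" if "v \<in> vertices \<Delta>" for v using that sub hats_eq by blast
    show "(\<lambda>x\<in>cube. x $ i) \<in> cube \<rightarrow>\<^sub>E {0..1}" by (auto simp: mem_box_cart)
    fix x :: "real^'n" assume x: "x \<in> cube"
    have "x $ i = (\<Sum>v\<in>vertices \<Delta>. real (k v) * hat v x)"
      unfolding coordinate_eq_sum_hats[OF x, of i] by (rule sum.cong) (auto simp: k one)
    then show "(\<lambda>x\<in>cube. x $ i) x = (\<Sum>v\<in>vertices \<Delta>. real (k v) * hat v x)" using x by simp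
  qed
qed

end

section \<open>Unimodular subdivisions of an orthant\<close>

text \<open>The index type may be infinite. Later \<open>G\<close> consists of the pairs of a
  generator from a finite set and a truth value.\<close>

definition orthant :: "'k set \<Rightarrow> ('k \<Rightarrow> real) set" where
  "orthant G = {y. (\<forall>i. 0 \<le> y i) \<and> (\<forall>i. i \<notin> G \<longrightarrow> y i = 0)}"

text \<open>A unimodular fan with support the orthant is encoded by its primitive vectors \<open>V\<close> and the
  function \<open>c\<close> giving the coordinates of a point \<open>y\<close> in the cone that carries it, so that the cones
  are the sets \<open>{v. c y v \<noteq> 0}\<close> and their subsets. The next-to-last clause says that different
  cones do not overlap, the preceding one that the cones are unimodular. Distinctness of the new
  vector from the old ones and the fact that each vector spans a ray follow from the last two clauses.\<close>

definition fan :: "'k set \<Rightarrow> ('k \<Rightarrow> real) set \<Rightarrow> (('k \<Rightarrow> real) \<Rightarrow> ('k \<Rightarrow> real) \<Rightarrow> real) \<Rightarrow> bool" where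
  "fan G V c \<longleftrightarrow> finite V \<and> V \<subseteq> orthant G \<and> (\<forall>v\<in>V. \<forall>i. v i \<in> \<int>) \<and>
     (\<forall>y\<in>orthant G. (\<forall>v. 0 \<le> c y v) \<and> (\<forall>v. v \<notin> V \<longrightarrow> c y v = 0) \<and> (\<forall>i. (\<Sum>v\<in>V. c y v * v i) = y i)) \<and>
     (\<forall>y\<in>orthant G. (\<forall>i. y i \<in> \<int>) \<longrightarrow> (\<forall>v. c y v \<in> \<int>)) \<and>
     (\<forall>y\<in>orthant G. \<forall>t. (\<forall>v. 0 \<le> t v) \<and> (\<forall>v. c y v = 0 \<longrightarrow> t v = 0) \<longrightarrow> c (\<lambda>i. \<Sum>v\<in>V. t v * v i) = t) \<and>
     (\<forall>v\<in>V. c v v = 1)"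

lemma fanD:
  assumes "fan G V c"
  shows "finite V" "V \<subseteq> orthant G" "\<And>v i. v \<in> V \<Longrightarrow> v i \<in> \<int>"
    "\<And>y v. y \<in> orthant G \<Longrightarrow> 0 \<le> c y v" "\<And>y v. y \<in> orthant G \<Longrightarrow> v \<notin> V \<Longrightarrow> c y v = 0"
    "\<And>y i. y \<in> orthant G \<Longrightarrow> (\<Sum>v\<in>V. c y v * v i) = y i"
    "\<And>y v. y \<in> orthant G \<Longrightarrow> (\<And>i. y i \<in> \<int>) \<Longrightarrow> c y v \<in> \<int>"
    "\<And>y t. y \<in> orthant G \<Longrightarrow> (\<And>v. 0 \<le> t v) \<Longrightarrow> (\<And>v. c y v = 0 \<Longrightarrow> t v = 0) \<Longrightarrow> c (\<lambda>i. \<Sum>v\<in>V. t v * v i) = t"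
    "\<And>v. v \<in> V \<Longrightarrow> c v v = 1"
  using assms by (auto simp: fan_def)

text \<open>Since \<open>c v v = 1\<close>, the clause against overlaps admits the coefficients 1 at
  \<open>v\<close> and 0 elsewhere, and their combination is \<open>v\<close> itself.\<close>

lemma fan_vertex_coords:
  assumes "fan G V c" "v \<in> V" "w \<noteq> v"
  shows "c v w = 0"
proof -
  note F = fanD[OF assms(1)]
  define t :: "('a \<Rightarrow> real) \<Rightarrow> real" where "t x = (if x = v then 1 else 0)" for x
  have "c (\<lambda>i. \<Sum>x\<in>V. t x * x i) = t"
    using F(2,9) assms(2) by (intro F(8)[of v]) (auto simp: t_def split: if_splits)
  moreover have "(\<lambda>i. \<Sum>x\<in>V. t x * x i) = v"
    using F(1) assms(2) by (auto simp: t_def of_bool_def if_distribR if_distrib cong: if_cong)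
  ultimately show ?thesis using assms(3) by (simp add: t_def)
qed

text \<open>Zero coefficients are admissible in the clause against overlaps, so the origin has only
  zero coordinates, whereas \<open>c v v = 1\<close>.\<close>

lemma fan_vertex_nonzero:
  assumes "fan G V c" "v \<in> V"
  shows "v \<noteq> (\<lambda>i. 0)"
proof
  note F = fanD[OF assms(1)]
  assume v: "v = (\<lambda>i. 0)"
  have "c (\<lambda>i. \<Sum>x\<in>V. 0 * x i) = (\<lambda>x. 0)"
    using F(2) assms(2) by (intro F(8)[of v]) auto
  then show False using F(9)[OF assms(2)] v by simp
qed

text \<open>With \<open>m = min a b\<close>, one has
  \<open>a v + b w = m (v + w) + (a - m) v + (b - m) w\<close>. One of the last two coefficients
  vanishes, so no new cone contains both \<open>v\<close> and \<open>w\<close>.\<close>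

definition subdivide_coords :: "('k \<Rightarrow> real) \<Rightarrow> ('k \<Rightarrow> real) \<Rightarrow> (('k \<Rightarrow> real) \<Rightarrow> ('k \<Rightarrow> real) \<Rightarrow> real) \<Rightarrow> ('k \<Rightarrow> real) \<Rightarrow> ('k \<Rightarrow> real) \<Rightarrow> real" where
  "subdivide_coords v w c y x =
     (if x = (\<lambda>i. v i + w i) then min (c y v) (c y w)
      else if x = v \<or> x = w then c y x - min (c y v) (c y w) else c y x)"

text \<open>The point \<open>y0\<close> witnesses that \<open>v\<close> and \<open>w\<close> belong
  to a common cone, as cones are not named explicitly.\<close>

locale fan_edge =
  fixes G :: "'k set" and V and c and v w :: "'k \<Rightarrow> real" and y0
  assumes fan: "fan G V c" and neq: "v \<noteq> w"
    and y0: "y0 \<in> orthant G" "c y0 v > 0" "c y0 w > 0"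
begin

lemmas F = fanD[OF fan]

abbreviation (input) "u \<equiv> (\<lambda>i. v i + w i)"
abbreviation (input) "V' \<equiv> insert u V"
abbreviation (input) "c' \<equiv> subdivide_coords v w c"

lemma vw: "v \<in> V" "w \<in> V" using F(5)[OF y0(1)] y0 by force+

lemma coords_u: "c u = (\<lambda>x. if x = v \<or> x = w then 1 else 0)"
proof -
  define t :: "('k \<Rightarrow> real) \<Rightarrow> real" where "t x = (if x = v \<or> x = w then 1 else 0)" for x
  have "c (\<lambda>i. \<Sum>x\<in>V. t x * x i) = t"
    using y0 by (intro F(8)[of y0]) (auto simp: t_def split: if_splits)
  moreover have "(\<Sum>x\<in>V. t x * x i) = u i" for i
  proof -
    have "(\<Sum>x\<in>V. t x * x i) = (\<Sum>x\<in>V. (if x = v then v i else 0) + (if x = w then w i else 0))"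
      using neq by (intro sum.cong) (auto simp: t_def)
    then show ?thesis using F(1) vw by (simp add: sum.distrib)
  qed
  ultimately show ?thesis by (simp add: t_def[abs_def])
qed

text \<open>An old vector has coordinate 1 at itself, so by \<open>coords_u\<close> the sum would
  equal \<open>v\<close> or \<open>w\<close>, and the other summand would be zero.\<close>

lemma u_notin: "u \<notin> V"
proof
  assume "u \<in> V"
  then have "u = v \<or> u = w" using F(9)[of u] coords_u by (metis zero_neq_one)
  then have "(\<forall>i. w i = 0) \<or> (\<forall>i. v i = 0)" by (auto simp: fun_eq_iff)
  then show False using fan_vertex_nonzero[OF fan] vw by (metis ext)
qed

lemma u_neq: "v \<noteq> u" "w \<noteq> u" using u_notin vw by metis+

lemma u_orthant: "u \<in> orthant G" using subsetD[OF F(2) vw(1)] subsetD[OF F(2) vw(2)] by (simp add: orthant_def)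

lemma sum_subdivide:
  assumes "t u = 0"
  shows "(\<Sum>x\<in>V'. (if x = u then m else if x = v \<or> x = w then t x - m else t x) * x i) = (\<Sum>x\<in>V. t x * x i)"
proof -
  have "(\<Sum>x\<in>V'. (if x = u then m else if x = v \<or> x = w then t x - m else t x) * x i)
      = m * u i + (\<Sum>x\<in>V. (if x = u then m else if x = v \<or> x = w then t x - m else t x) * x i)"
    using F(1) u_notin by simp
  also have "(\<Sum>x\<in>V. (if x = u then m else if x = v \<or> x = w then t x - m else t x) * x i)
      = (\<Sum>x\<in>V. t x * x i - (if x = v then m * v i else 0) - (if x = w then m * w i else 0))"
    using neq u_notin by (intro sum.cong) (auto simp: algebra_simps)
  also have "\<dots> = (\<Sum>x\<in>V. t x * x i) - m * v i - m * w i"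
    using F(1) vw by (simp add: sum_subtractf)
  finally show ?thesis by (simp add: algebra_simps)
qed

lemma subdivide_simps [simp]:
  "c' y u = min (c y v) (c y w)" "c' y v = c y v - min (c y v) (c y w)"
  "c' y w = c y w - min (c y v) (c y w)"
  "x \<noteq> u \<Longrightarrow> x \<noteq> v \<Longrightarrow> x \<noteq> w \<Longrightarrow> c' y x = c y x"
  using u_neq by (simp_all add: subdivide_coords_def)

lemma subdivide_le: "y \<in> orthant G \<Longrightarrow> x \<noteq> u \<Longrightarrow> c' y x \<le> c y x"
  using F(4)[of y] by (simp add: subdivide_coords_def)

lemma subdivide_nonneg: "y \<in> orthant G \<Longrightarrow> 0 \<le> c' y x"
  using F(4)[of y] by (auto simp: subdivide_coords_def)

text \<open>Expanding the new vector as \<open>v + w\<close> turns \<open>t\<close> into old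
  coefficients \<open>s\<close>, to which the clause for the old fan applies. As one of the new
  coordinates of \<open>y\<close> at \<open>v\<close> and \<open>w\<close> is zero, so is one of
  \<open>t v\<close> and \<open>t w\<close>; hence the coefficient of the new vector is recovered as
  \<open>min (s v) (s w)\<close>.\<close>

lemma subdivide_recombine:
  assumes y: "y \<in> orthant G" and t: "\<And>x. 0 \<le> t x" "\<And>x. c' y x = 0 \<Longrightarrow> t x = 0"
  shows "c' (\<lambda>i. \<Sum>x\<in>V'. t x * x i) = t"
proof -
  define s where "s x = (if x = u then 0 else if x = v \<or> x = w then t x + t u else t x)" for x
  have "c (\<lambda>i. \<Sum>x\<in>V. s x * x i) = s"
  proof (rule F(8)[OF y])
    show "0 \<le> s x" for x using t(1) by (simp add: s_def)
    fix x assume x: "c y x = 0"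
    have tu: "t u = 0" if "x = v \<or> x = w"
      by (rule t(2)) (use that x F(4)[OF y] in auto)
    have tx: "t x = 0" if "x \<noteq> u"
    proof (rule t(2))
      have "0 \<le> c' y x" "c' y x \<le> c y x" using subdivide_nonneg[OF y] subdivide_le[OF y that] by auto
      then show "c' y x = 0" using x by simp
    qed
    show "s x = 0" using tx tu by (auto simp: s_def)
  qed
  moreover have "(\<Sum>x\<in>V'. t x * x i) = (\<Sum>x\<in>V. s x * x i)" for i
  proof -
    have "(\<Sum>x\<in>V'. t x * x i) = (\<Sum>x\<in>V'. (if x = u then t u else if x = v \<or> x = w then s x - t u else s x) * x i)"
      using u_neq by (intro sum.cong) (auto simp: s_def)
    also have "\<dots> = (\<Sum>x\<in>V. s x * x i)" by (rule sum_subdivide) (simp add: s_def)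
    finally show ?thesis .
  qed
  ultimately have cs: "c (\<lambda>i. \<Sum>x\<in>V'. t x * x i) = s" by simp
  have "c' y v = 0 \<or> c' y w = 0" by (auto simp: min_def)
  then have "t v = 0 \<or> t w = 0" using t(2) by blast
  then have m: "min (s v) (s w) = t u" using u_neq t(1)[of v] t(1)[of w] t(1)[of u] by (auto simp: s_def)
  show ?thesis
    by (rule ext) (simp add: subdivide_coords_def cs m, simp add: s_def u_neq)
qed

lemma fan_subdivide: "fan G V' c'"
  unfolding fan_def
proof (intro conjI ballI allI impI)
  show "finite V'" using F(1) by simp
  show "V' \<subseteq> orthant G" using F(2) u_orthant by simp
  show "x i \<in> \<int>" if "x \<in> V'" for x i using that F(3) vw by auto
  show "0 \<le> c' y x" if "y \<in> orthant G" for x y using subdivide_nonneg[OF that] .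
  show "c' y x = 0" if "y \<in> orthant G" "x \<notin> V'" for x y
  proof -
    have "x \<noteq> u" "x \<noteq> v" "x \<noteq> w" using that vw by auto
    then show ?thesis using F(5)[OF that(1)] that(2) by simp
  qed
  show "(\<Sum>x\<in>V'. c' y x * x i) = y i" if y: "y \<in> orthant G" for y i
    using sum_subdivide[of "c y" "min (c y v) (c y w)" i] F(5)[OF y u_notin] F(6)[OF y]
    by (simp add: subdivide_coords_def)
  show "c' y x \<in> \<int>" if "y \<in> orthant G" "\<forall>i. y i \<in> \<int>" for y x
    using F(7)[OF that(1)] that(2) by (auto simp: subdivide_coords_def min_def)
  show "c' (\<lambda>i. \<Sum>x\<in>V'. t x * x i) = t" if "y \<in> orthant G" "(\<forall>v. 0 \<le> t v) \<and> (\<forall>v. c' y v = 0 \<longrightarrow> t v = 0)" for y t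
    by (rule subdivide_recombine[OF that(1)]) (use that(2) in auto)
  show "c' x x = 1" if "x \<in> V'" for x
  proof (cases "x = u")
    case True
    then show ?thesis using coords_u by simp
  next
    case False
    then have x: "x \<in> V" using that by simp
    have "min (c x v) (c x w) = 0" if "x = v \<or> x = w"
      using that fan_vertex_coords[OF fan x] F(9)[OF x] neq by auto
    then show ?thesis using False F(9)[OF x] by (simp add: subdivide_coords_def)
  qed
qed

end

section \<open>Subdividing until functionals have constant sign on the cones\<close>

definition int_functional :: "(('k \<Rightarrow> real) \<Rightarrow> real) \<Rightarrow> bool" where
  "int_functional \<phi> \<longleftrightarrow> (\<forall>x y. \<phi> (\<lambda>i. x i + y i) = \<phi> x + \<phi> y) \<and> (\<forall>r x. \<phi> (\<lambda>i. r * x i) = r * \<phi> x) \<and>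
     (\<forall>x. (\<forall>i. x i \<in> \<int>) \<longrightarrow> \<phi> x \<in> \<int>)"

definition coherent :: "'k set \<Rightarrow> (('k \<Rightarrow> real) \<Rightarrow> ('k \<Rightarrow> real) \<Rightarrow> real) \<Rightarrow> (('k \<Rightarrow> real) \<Rightarrow> real) \<Rightarrow> bool" where
  "coherent G c \<phi> \<longleftrightarrow> (\<forall>y\<in>orthant G. \<forall>v w. c y v > 0 \<and> c y w > 0 \<longrightarrow> \<not> (\<phi> v > 0 \<and> \<phi> w < 0))"

text \<open>A positive or negative sign at \<open>v + w\<close> already occurs at \<open>v\<close>
  or at \<open>w\<close>, and a point with positive new coordinate at \<open>v + w\<close> has
  positive old coordinates at both. So functionals treated earlier stay coherent.\<close>

lemma coherent_subdivide:
  assumes "fan_edge G V c v w y0" "int_functional \<phi>" "coherent G c \<phi>"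
  shows "coherent G (subdivide_coords v w c) \<phi>"
proof -
  interpret fan_edge G V c v w y0 by fact
  have add: "\<phi> (\<lambda>i. v i + w i) = \<phi> v + \<phi> w" using assms(2) by (simp add: int_functional_def)
  have coh: "\<not> (\<phi> p > 0 \<and> \<phi> q < 0)" if "y \<in> orthant G" "c y p > 0" "c y q > 0" for y p q
    using assms(3) that unfolding coherent_def by blast
  show ?thesis
    unfolding coherent_def
  proof (intro ballI allI impI notI)
    fix y p q assume y: "y \<in> orthant G" and pq: "subdivide_coords v w c y p > 0 \<and> subdivide_coords v w c y q > 0"
      and s: "\<phi> p > 0 \<and> \<phi> q < 0"
    have l: "c y x > 0" if "subdivide_coords v w c y x > 0" "x \<noteq> (\<lambda>i. v i + w i)" for x
      using subdivide_le[OF y that(2)] that(1) by linarith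
    have uu: "c y v > 0 \<and> c y w > 0" if "subdivide_coords v w c y (\<lambda>i. v i + w i) > 0"
      using that by simp
    consider "p = (\<lambda>i. v i + w i)" "q \<noteq> (\<lambda>i. v i + w i)" | "q = (\<lambda>i. v i + w i)" "p \<noteq> (\<lambda>i. v i + w i)"
      | "p \<noteq> (\<lambda>i. v i + w i)" "q \<noteq> (\<lambda>i. v i + w i)" using s by force
    then show False
    proof cases
      case 1
      then have "c y v > 0" "c y w > 0" "c y q > 0" using uu l pq by auto
      then show False using coh[OF y, of v q] coh[OF y, of w q] s add 1 by auto
    next
      case 2
      then have "c y v > 0" "c y w > 0" "c y p > 0" using uu l pq by auto
      then show False using coh[OF y, of p v] coh[OF y, of p w] s add 2 by auto
    next
      case 3
      then show False using coh[OF y, of p q] l pq s by auto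
    qed
  qed
qed

definition crossing_pairs :: "'k set \<Rightarrow> (('k \<Rightarrow> real) \<Rightarrow> ('k \<Rightarrow> real) \<Rightarrow> real) \<Rightarrow> (('k \<Rightarrow> real) \<Rightarrow> real) \<Rightarrow> (('k \<Rightarrow> real) \<times> ('k \<Rightarrow> real)) set" where
  "crossing_pairs G c \<phi> = {(p, q). (\<exists>y\<in>orthant G. c y p > 0 \<and> c y q > 0) \<and> \<phi> p > 0 \<and> \<phi> q < 0}"

text \<open>For a new pair \<open>(v + w, q)\<close> the pair \<open>(v, q)\<close> was crossing
  before, and \<phi> is smaller at \<open>v + w\<close> than at \<open>v\<close> because
  \<open>\<phi> w < 0\<close>; the case \<open>(p, v + w)\<close> is symmetric. The pair
  \<open>(v, w)\<close> itself is gone, since its new coordinates are never both positive.\<close>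

lemma crossing_pairs_subdivide:
  assumes "fan_edge G V c v w y0" "int_functional \<phi>" "\<phi> v > 0" "\<phi> w < 0"
    and pq: "(p, q) \<in> crossing_pairs G (subdivide_coords v w c) \<phi>"
    and le: "\<And>p q. (p, q) \<in> crossing_pairs G c \<phi> \<Longrightarrow> \<phi> p - \<phi> q \<le> N"
  shows "(p, q) \<in> crossing_pairs G c \<phi> \<and> (p, q) \<noteq> (v, w) \<or> \<phi> p - \<phi> q < N"
proof -
  interpret fan_edge G V c v w y0 by fact
  have add: "\<phi> (\<lambda>i. v i + w i) = \<phi> v + \<phi> w" using assms(2) by (simp add: int_functional_def)
  obtain y where y: "y \<in> orthant G" and p: "subdivide_coords v w c y p > 0" and q: "subdivide_coords v w c y q > 0"
    and s: "\<phi> p > 0" "\<phi> q < 0" using pq by (auto simp: crossing_pairs_def)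
  have l: "c y x > 0" if "subdivide_coords v w c y x > 0" "x \<noteq> (\<lambda>i. v i + w i)" for x
    using subdivide_le[OF y that(2)] that(1) by linarith
  have uu: "c y v > 0 \<and> c y w > 0" if "subdivide_coords v w c y (\<lambda>i. v i + w i) > 0"
    using that by simp
  consider "p = (\<lambda>i. v i + w i)" "q \<noteq> (\<lambda>i. v i + w i)" | "q = (\<lambda>i. v i + w i)" "p \<noteq> (\<lambda>i. v i + w i)"
    | "p \<noteq> (\<lambda>i. v i + w i)" "q \<noteq> (\<lambda>i. v i + w i)" using s by force
  then show ?thesis
  proof cases
    case 1
    then have "c y v > 0" "c y q > 0" using uu l p q by auto
    then have "(v, q) \<in> crossing_pairs G c \<phi>" using y s assms(3) by (auto simp: crossing_pairs_def)
    from le[OF this] show ?thesis using 1 add assms(4) by simp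
  next
    case 2
    then have "c y w > 0" "c y p > 0" using uu l p q by auto
    then have "(p, w) \<in> crossing_pairs G c \<phi>" using y s assms(4) by (auto simp: crossing_pairs_def)
    from le[OF this] show ?thesis using 2 add assms(3) by simp
  next
    case 3
    then have "(p, q) \<in> crossing_pairs G c \<phi>" using y s l p q by (auto simp: crossing_pairs_def)
    moreover have "(p, q) \<noteq> (v, w)" using p q by (auto simp: min_def split: if_splits)
    ultimately show ?thesis by blast
  qed
qed

text \<open>Subdividing a crossing pair with the largest difference \<open>\<phi> p - \<phi> q\<close> destroys it and creates only
  crossing pairs with a smaller difference, so the process terminates.\<close>

lemma exists_coherent_subdivision:
  assumes \<phi>: "int_functional \<phi>"
    and step: "\<And>V c v w y0. fan_edge G V c v w y0 \<Longrightarrow> I V c \<Longrightarrow> I (insert (\<lambda>i. v i + w i) V) (subdivide_coords v w c)"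
    and init: "fan G V c" "I V c"
  shows "\<exists>V c. fan G V c \<and> I V c \<and> coherent G c \<phi>"
proof -
  have fin: "finite (crossing_pairs G c \<phi>)" "crossing_pairs G c \<phi> \<subseteq> V \<times> V" if "fan G V c" for V c
  proof -
    show "crossing_pairs G c \<phi> \<subseteq> V \<times> V" using fanD(5)[OF that] by (force simp: crossing_pairs_def)
    then show "finite (crossing_pairs G c \<phi>)" using fanD(1)[OF that] by (metis finite_SigmaI finite_subset)
  qed
  \<comment> \<open>The property \<open>I\<close> is an invariant of subdivision; in the end it
    contains the generation of \<open>A\<close> and the coherence of the functionals treated
    before.\<close>
  have *: "\<exists>V c. fan G V c \<and> I V c \<and> coherent G c \<phi>"
    if "fan G V c" "I V c" "\<And>p q. (p, q) \<in> crossing_pairs G c \<phi> \<Longrightarrow> \<phi> p - \<phi> q \<le> real N" for N :: nat and V c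
    using that
  proof (induction N arbitrary: V c)
    case 0
    \<comment> \<open>Crossing pairs have positive differences, so the bound 0 excludes
      them.\<close>
    have "coherent G c \<phi>"
      unfolding coherent_def using "0.prems"(3) by (force simp: crossing_pairs_def)
    with 0 show ?case by blast
  next
    case (Suc N)
    note outer = Suc.IH
    show ?case
      using Suc.prems
    \<comment> \<open>The inner induction counts the pairs that attain the bound
      \<open>Suc N\<close>. Once there are none, integrality of the differences lowers the bound to
      \<open>N\<close>.\<close>
    proof (induction "card {(p, q) \<in> crossing_pairs G c \<phi>. \<phi> p - \<phi> q = real (Suc N)}" arbitrary: V c rule: less_induct)
      case (less c V)
      define M where "M c = {(p, q) \<in> crossing_pairs G c \<phi>. \<phi> p - \<phi> q = real (Suc N)}" for c
      show ?case
      proof (cases "M c = {}")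
        case True
        have "\<phi> p - \<phi> q \<le> real N" if pq: "(p, q) \<in> crossing_pairs G c \<phi>" for p q
        proof -
          have "p \<in> V" "q \<in> V" using fin(2)[OF less.prems(1)] pq by auto
          then have "\<phi> p - \<phi> q \<in> \<int>" using \<phi> fanD(3)[OF less.prems(1)] by (auto simp: int_functional_def)
          then obtain z where z: "\<phi> p - \<phi> q = of_int z" by (auto elim: Ints_cases)
          have "\<phi> p - \<phi> q \<noteq> real (Suc N)" using True pq by (auto simp: M_def)
          with less.prems(3)[OF pq] have "of_int z < (of_int (int (Suc N)) :: real)" using z by simp
          then have "z \<le> int N" by (simp only: of_int_less_iff)
          then show ?thesis by (simp add: z)
        qed
        with less.prems outer show ?thesis by blast
      next
        case False
        then obtain v w where vw: "(v, w) \<in> M c" by auto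
        then obtain y0 where e: "y0 \<in> orthant G" "c y0 v > 0" "c y0 w > 0" "\<phi> v > 0" "\<phi> w < 0"
          by (auto simp: M_def crossing_pairs_def)
        then have edge: "fan_edge G V c v w y0" using less.prems(1) by unfold_locales auto
        let ?c = "subdivide_coords v w c" and ?V = "insert (\<lambda>i. v i + w i) V"
        have fan': "fan G ?V ?c" using fan_edge.fan_subdivide[OF edge] .
        note cp = crossing_pairs_subdivide[OF edge \<phi> e(4,5) _ less.prems(3), of _ _]
        have le: "\<phi> p - \<phi> q \<le> real (Suc N)" if "(p, q) \<in> crossing_pairs G ?c \<phi>" for p q
          using cp[OF that] less.prems(3)[of p q] by fastforce
        have "M ?c \<subseteq> M c - {(v, w)}"
        proof
          fix z assume "z \<in> M ?c"
          then obtain p q where "z = (p, q)" "(p, q) \<in> crossing_pairs G ?c \<phi>" "\<phi> p - \<phi> q = real (Suc N)"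
            by (auto simp: M_def)
          with cp[of p q] show "z \<in> M c - {(v, w)}" by (auto simp: M_def)
        qed
        moreover have "finite (M c)" by (rule finite_subset[OF _ fin(1)[OF less.prems(1)]]) (auto simp: M_def)
        ultimately have "card (M ?c) < card (M c)" using vw by (intro psubset_card_mono) auto
        from less.hyps[OF this[unfolded M_def] fan' step[OF edge less.prems(2)] le] show ?thesis by blast
      qed
    qed
  qed
  define N where "N = Max (insert 0 ((\<lambda>(p, q). nat \<lceil>\<phi> p - \<phi> q\<rceil>) ` crossing_pairs G c \<phi>))"
  have "\<phi> p - \<phi> q \<le> real N" if "(p, q) \<in> crossing_pairs G c \<phi>" for p q
  proof -
    have "nat \<lceil>\<phi> p - \<phi> q\<rceil> \<le> N"
      unfolding N_def using fin(1)[OF init(1)] that by (intro Max_ge) (auto intro: rev_image_eqI)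
    then show ?thesis by linarith
  qed
  from *[OF init this] show ?thesis .
qed

lemma exists_coherent_subdivision_finite:
  assumes "finite \<Phi>" "\<And>\<phi>. \<phi> \<in> \<Phi> \<Longrightarrow> int_functional \<phi>"
    and step: "\<And>V c v w y0. fan_edge G V c v w y0 \<Longrightarrow> I V c \<Longrightarrow> I (insert (\<lambda>i. v i + w i) V) (subdivide_coords v w c)"
    and init: "fan G V c" "I V c"
  shows "\<exists>V c. fan G V c \<and> I V c \<and> (\<forall>\<phi>\<in>\<Phi>. coherent G c \<phi>)"
  using assms(1,2)
proof (induction \<Phi>)
  case empty
  then show ?case using init by blast
next
  case (insert \<psi> \<Phi>)
  then obtain V c where Vc: "fan G V c" "I V c \<and> (\<forall>\<phi>\<in>\<Phi>. coherent G c \<phi>)" by auto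
  \<comment> \<open>Coherence of the functionals treated so far joins the invariant.\<close>
  have "\<exists>V c. fan G V c \<and> (I V c \<and> (\<forall>\<phi>\<in>\<Phi>. coherent G c \<phi>)) \<and> coherent G c \<psi>"
    using Vc insert.prems
    by (intro exists_coherent_subdivision[where I="\<lambda>V c. I V c \<and> (\<forall>\<phi>\<in>\<Phi>. coherent G c \<phi>)"])
       (auto intro: step coherent_subdivide)
  then show ?case by auto
qed

definition unit_vec :: "'k \<Rightarrow> 'k \<Rightarrow> real" where "unit_vec i = (\<lambda>j. if j = i then 1 else 0)"

text \<open>At a unit vector the sum picks one entry of \<open>y\<close>, without recovering the
  index from the vector.\<close>

definition orthant_coords :: "'k set \<Rightarrow> ('k \<Rightarrow> real) \<Rightarrow> ('k \<Rightarrow> real) \<Rightarrow> real" where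
  "orthant_coords G y x = (if x \<in> unit_vec ` G then \<Sum>i\<in>G. x i * y i else 0)"

lemma inj_unit_vec: "inj unit_vec"
  by (rule injI) (metis unit_vec_def zero_neq_one)

lemma orthant_coords_unit_vec:
  assumes "finite G" "i \<in> G"
  shows "orthant_coords G y (unit_vec i) = y i"
proof -
  have "(\<Sum>j\<in>G. unit_vec i j * y j) = (\<Sum>j\<in>G. if j = i then y j else 0)"
    by (rule sum.cong) (auto simp: unit_vec_def)
  then show ?thesis using assms by (simp add: orthant_coords_def)
qed

lemma sum_unit_vecs:
  assumes "finite G"
  shows "(\<Sum>v\<in>unit_vec ` G. t v * v i) = (if i \<in> G then t (unit_vec i) else 0)"
proof -
  have "(\<Sum>v\<in>unit_vec ` G. t v * v i) = (\<Sum>j\<in>G. t (unit_vec j) * unit_vec j i)"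
    by (subst sum.reindex) (auto intro: inj_on_subset[OF inj_unit_vec])
  also have "\<dots> = (\<Sum>j\<in>G. if j = i then t (unit_vec j) else 0)"
    by (rule sum.cong) (auto simp: unit_vec_def)
  finally show ?thesis using assms by simp
qed

lemma fan_orthant:
  assumes G: "finite G"
  shows "fan G (unit_vec ` G) (orthant_coords G)"
  unfolding fan_def
proof (intro conjI ballI allI impI)
  show "orthant_coords G (\<lambda>i. \<Sum>v\<in>unit_vec ` G. t v * v i) = t"
    if "(\<forall>v. 0 \<le> t v) \<and> (\<forall>v. orthant_coords G y v = 0 \<longrightarrow> t v = 0)" for y t
  proof
    fix x show "orthant_coords G (\<lambda>i. \<Sum>v\<in>unit_vec ` G. t v * v i) x = t x"
    proof (cases "x \<in> unit_vec ` G")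
      case True
      then show ?thesis using G by (auto simp: orthant_coords_unit_vec sum_unit_vecs)
    next
      case False
      then show ?thesis using that by (auto simp: orthant_coords_def)
    qed
  qed
next
  fix y :: "'a \<Rightarrow> real" and i assume "y \<in> orthant G"
  then show "(\<Sum>v\<in>unit_vec ` G. orthant_coords G y v * v i) = y i"
    using G by (simp add: sum_unit_vecs orthant_coords_unit_vec orthant_def)
next
  fix v :: "'a \<Rightarrow> real" assume "v \<in> unit_vec ` G"
  then show "orthant_coords G v v = 1"
    using G by (auto simp: orthant_coords_unit_vec) (simp add: unit_vec_def)
next
  fix y :: "'a \<Rightarrow> real" and v :: "'a \<Rightarrow> real"
  assume y: "y \<in> orthant G"
  then show "0 \<le> orthant_coords G y v"
    by (auto simp: orthant_coords_def orthant_def unit_vec_def intro!: sum_nonneg)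
  assume "\<forall>i. y i \<in> \<int>"
  then show "orthant_coords G y v \<in> \<int>"
    using G by (cases "v \<in> unit_vec ` G") (auto simp: orthant_coords_unit_vec, simp add: orthant_coords_def)
qed (use G in \<open>auto simp: orthant_def unit_vec_def orthant_coords_def\<close>)

section \<open>Cells of linearity and integral functionals\<close>

lemma int_affine_inner:
  assumes "int_affine p"
  shows "\<exists>b c. (\<forall>i. b $ i \<in> \<int>) \<and> c \<in> \<int> \<and> (\<forall>x. p x = b \<bullet> x + c)"
proof -
  obtain b :: "int^'a" and c :: int where p: "\<And>x. p x = (\<Sum>i\<in>UNIV. of_int (b $ i) * x $ i) + of_int c"
    using assms by (auto simp: int_affine_def)
  show ?thesis
    by (rule exI[of _ "\<chi> i. of_int (b $ i)"], rule exI[of _ "of_int c"]) (simp add: p inner_vec_def)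
qed

lemma int_affine_continuous:
  assumes "int_affine p" shows "continuous_on S p"
proof -
  obtain b c where "\<And>x. p x = b \<bullet> x + c" using int_affine_inner[OF assms] by blast
  then have "p = (\<lambda>x. b \<bullet> x + c)" by auto
  then show ?thesis by (auto intro!: continuous_intros)
qed

lemma int_affine_diff:
  assumes "int_affine p" "int_affine q"
  shows "int_affine (\<lambda>x. p x - q x)"
proof -
  obtain b :: "int^'a" and c :: int where p: "\<And>x. p x = (\<Sum>i\<in>UNIV. of_int (b $ i) * x $ i) + of_int c"
    using assms(1) by (auto simp: int_affine_def)
  obtain b' :: "int^'a" and c' :: int where q: "\<And>x. q x = (\<Sum>i\<in>UNIV. of_int (b' $ i) * x $ i) + of_int c'"
    using assms(2) by (auto simp: int_affine_def)
  show ?thesis unfolding int_affine_def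
    by (rule exI[of _ "b - b'"], rule exI[of _ "c - c'"]) (simp add: p q algebra_simps sum_subtractf)
qed

lemma int_affine_const: "int_affine (\<lambda>x. of_int c)"
  unfolding int_affine_def by (rule exI[of _ 0], rule exI[of _ c]) simp

lemma int_affine_coordinate: "int_affine (\<lambda>x. x $ i)"
proof -
  have "(\<Sum>j\<in>UNIV. of_int (axis i 1 $ j) * x $ j) = x $ i" for x :: "real^'a"
    using sum_int_coeff_minus_axis[of 0 i x] by (simp add: sum_negf)
  then show ?thesis unfolding int_affine_def by (intro exI[of _ "axis i 1"] exI[of _ 0]) simp
qed

lemma exists_piece_above:
  fixes f :: "real^'n \<Rightarrow> real"
  assumes cont: "continuous_on cube f" and P: "finite P" "\<And>p. p \<in> P \<Longrightarrow> int_affine p"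
    and cover: "\<And>x. x \<in> cube \<Longrightarrow> \<exists>p\<in>P. f x = p x"
    and xy: "x \<in> cube" "y \<in> cube"
  shows "\<exists>p\<in>P. p y \<le> f y \<and> f x \<le> p x"
proof -
  have "\<exists>p\<in>(\<lambda>p x. - p x) ` P. - f y \<le> p y \<and> p x \<le> - f x"
  proof (rule exists_piece_below[OF _ _ _ _ xy])
    show "continuous_on cube (\<lambda>x. - f x)" using cont by (intro continuous_intros)
    show "int_affine p" if "p \<in> (\<lambda>p x. - p x) ` P" for p
      using that int_affine_diff[OF int_affine_const[of 0] P(2)] by auto
    show "\<exists>p\<in>(\<lambda>p x. - p x) ` P. - f x = p x" if "x \<in> cube" for x using cover[OF that] by auto
  qed (use P in auto)
  then show ?thesis by auto
qed

lemma interior_int_affine_eq: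
  assumes "int_affine p" "int_affine q" "p \<noteq> q"
  shows "closed {x. p x = q x}" "interior {x. p x = q x} = {}"
proof -
  obtain b c where bc: "\<And>x. p x - q x = b \<bullet> x + c"
    using int_affine_inner[OF int_affine_diff[OF assms(1,2)]] by blast
  have eq: "{x. p x = q x} = {x. b \<bullet> x = - c}" using bc by (force simp: algebra_simps)
  show "closed {x. p x = q x}" unfolding eq by (rule closed_hyperplane)
  show "interior {x. p x = q x} = {}"
  proof (cases "b = 0")
    case True
    then have "c \<noteq> 0" using bc assms(3) by (metis add.right_neutral eq_iff_diff_eq_0 ext inner_zero_left)
    then show ?thesis unfolding eq using True by simp
  next
    case False
    then show ?thesis unfolding eq by simp
  qed
qed

lemma dense_outside_closed_Union:
  assumes "finite \<C>" "\<And>C. C \<in> \<C> \<Longrightarrow> closed C \<and> interior C = {}"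
  shows "closed (\<Union>\<C>) \<and> interior (\<Union>\<C>) = {}"
  using assms
proof (induction \<C>)
  case (insert C \<C>)
  then show ?case using interior_closed_Un_empty_interior[of C "\<Union>\<C>"] by auto
qed simp

lemma det_Ints:
  fixes M :: "real^'n^'n"
  assumes "\<And>i j. M $ i $ j \<in> \<int>"
  shows "det M \<in> \<int>"
  unfolding det_def by (intro Ints_sum Ints_mult Ints_prod assms) simp_all

lemma int_functional_coordinate: "int_functional (\<lambda>y. y k)"
  by (simp add: int_functional_def)

lemma int_functional_add: "int_functional \<phi> \<Longrightarrow> int_functional \<psi> \<Longrightarrow> int_functional (\<lambda>y. \<phi> y + \<psi> y)"
  by (simp add: int_functional_def algebra_simps)

lemma int_functional_diff: "int_functional \<phi> \<Longrightarrow> int_functional \<psi> \<Longrightarrow> int_functional (\<lambda>y. \<phi> y - \<psi> y)"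
  by (simp add: int_functional_def algebra_simps)

lemma int_functional_scale: "r \<in> \<int> \<Longrightarrow> int_functional \<phi> \<Longrightarrow> int_functional (\<lambda>y. r * \<phi> y)"
  by (simp add: int_functional_def algebra_simps)

lemma int_functional_sum: "(\<And>i. i \<in> I \<Longrightarrow> int_functional (\<phi> i)) \<Longrightarrow> int_functional (\<lambda>y. \<Sum>i\<in>I. \<phi> i y)"
  by (auto simp: int_functional_def sum.distrib sum_distrib_left intro!: Ints_sum)

lemmas int_functional_intros = int_functional_coordinate int_functional_add
  int_functional_diff int_functional_scale int_functional_sum

lemma int_functional_det_row:
  fixes M :: "real^'n^'n"
  assumes "\<And>i j. M $ i $ j \<in> \<int>" "\<And>i. int_functional (r i)"
  shows "int_functional (\<lambda>y. det (\<chi> i. if i = k then (\<chi> j. r j y) else M $ i))"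
  unfolding int_functional_def
proof (intro conjI allI impI)
  fix x y
  have eq: "(\<chi> j. r j (\<lambda>i. x i + y i)) = (\<chi> j. r j x) + (\<chi> j. r j y)"
    using assms(2) by (simp add: vec_eq_iff int_functional_def)
  show "det (\<chi> i. if i = k then (\<chi> j. r j (\<lambda>i. x i + y i)) else M $ i)
     = det (\<chi> i. if i = k then (\<chi> j. r j x) else M $ i) + det (\<chi> i. if i = k then (\<chi> j. r j y) else M $ i)"
    unfolding eq by (rule det_row_add[of k "\<lambda>_. \<chi> j. r j x" "\<lambda>_. \<chi> j. r j y" "\<lambda>i. M $ i"])
next
  fix s x
  have eq: "(\<chi> j. r j (\<lambda>i. s * x i)) = s *s (\<chi> j. r j x)"
    using assms(2) by (simp add: vec_eq_iff int_functional_def)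
  show "det (\<chi> i. if i = k then (\<chi> j. r j (\<lambda>i. s * x i)) else M $ i)
     = s * det (\<chi> i. if i = k then (\<chi> j. r j x) else M $ i)"
    unfolding eq by (rule det_row_mul[of k s "\<lambda>_. \<chi> j. r j x" "\<lambda>i. M $ i"])
next
  fix x :: "'a \<Rightarrow> real" assume "\<forall>i. x i \<in> \<int>"
  then show "det (\<chi> i. if i = k then (\<chi> j. r j x) else M $ i) \<in> \<int>"
    using assms by (intro det_Ints) (auto simp: int_functional_def)
qed

text \<open>A point \<open>x\<close> of the open box outside \<open>N\<close>, the set where two
  distinct pieces coincide, orders all pieces strictly; its cell consists of the points that respect
  this order weakly. The strict inequalities give the cell an interior. There are finitely many
  cells, they are closed, and such points \<open>x\<close> are dense, so the cells cover the
  cube.\<close>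

lemma linear_cells:
  fixes S :: "(real^'n \<Rightarrow> real) set"
  assumes S: "finite S" "S \<subseteq> McNaughton"
  shows "\<exists>\<Q>. finite \<Q> \<and> \<Union>\<Q> = cube \<and> (\<forall>Q\<in>\<Q>. interior Q \<noteq> {} \<and>
    (\<exists>\<Lambda>. finite \<Lambda> \<and> (\<forall>l\<in>\<Lambda>. int_affine l) \<and> Q = {z. \<forall>l\<in>\<Lambda>. 0 \<le> l z}) \<and>
    (\<forall>f\<in>S. \<exists>p. int_affine p \<and> (\<forall>x\<in>Q. f x = p x)))"
proof -
  have "\<forall>f\<in>S. \<exists>P. finite P \<and> (\<forall>p\<in>P. int_affine p) \<and> (\<forall>x\<in>cube. \<exists>p\<in>P. f x = p x)"
    using S(2) by (auto simp: McNaughton_def)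
  then obtain Pf where Pf: "\<And>f. f \<in> S \<Longrightarrow> finite (Pf f)" "\<And>f p. f \<in> S \<Longrightarrow> p \<in> Pf f \<Longrightarrow> int_affine p"
    "\<And>f x. f \<in> S \<Longrightarrow> x \<in> cube \<Longrightarrow> \<exists>p\<in>Pf f. f x = p x"
    by metis
  define P where "P = (\<Union>f\<in>S. Pf f)"
  have P: "finite P" "\<And>p. p \<in> P \<Longrightarrow> int_affine p" using Pf S by (auto simp: P_def)
  define N where "N = \<Union>((\<lambda>(p, q). {x. p x = q x}) ` {(p, q) \<in> P \<times> P. p \<noteq> q})"
  have finPP: "finite {(p, q) \<in> P \<times> P. p \<noteq> q}" using P(1) by (rule_tac finite_subset[of _ "P \<times> P"]) auto
  have "closed N \<and> interior N = {}"
    unfolding N_def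
  proof (rule dense_outside_closed_Union)
    fix C assume "C \<in> (\<lambda>(p, q). {x. p x = q x}) ` {(p, q) \<in> P \<times> P. p \<noteq> q}"
    then obtain p q where "p \<in> P" "q \<in> P" "p \<noteq> q" "C = {x. p x = q x}" by auto
    then show "closed C \<and> interior C = {}" using interior_int_affine_eq[OF P(2) P(2)] by auto
  qed (use finPP in simp)
  then have N: "closed N" "interior N = {}" by auto
  define U where "U = box 0 1 - N"
  have "box (0::real^'n) 1 \<subseteq> closure U"
  proof -
    have "closure (- N) = UNIV" using N by (simp add: closure_complement)
    then have "box 0 1 \<subseteq> closure (box 0 1 \<inter> - N)" using open_Int_closure_subset[of "box 0 1" "- N"] by (simp add: open_box)
    then show ?thesis by (simp add: U_def Diff_eq)
  qed
  moreover have "box (0::real^'n) 1 \<noteq> {}" by (simp add: interval_ne_empty_cart)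
  then have "closure (box 0 1) = (cube :: (real^'n) set)" by (rule closure_box)
  ultimately have cubeU: "cube \<subseteq> closure U" using closure_minimal[of "box 0 1" "closure U"] by simp
  have Ubox: "x \<in> cube" if "x \<in> U" for x using that box_subset_cbox by (auto simp: U_def)
  have Uneq: "p x \<noteq> q x" if "x \<in> U" "p \<in> P" "q \<in> P" "p \<noteq> q" for x p q
    using that by (auto simp: U_def N_def)
  define R where "R x = {(p, q) \<in> P \<times> P. p x < q x}" for x
  define cell where "cell r = {z\<in>cube. \<forall>(p, q)\<in>r. p z \<le> q z}" for r :: "((real^'n \<Rightarrow> real) \<times> (real^'n \<Rightarrow> real)) set"
  define \<Q> where "\<Q> = cell ` R ` U"
  have finR: "finite (R x)" for x using P(1) by (rule_tac finite_subset[of _ "P \<times> P"]) (auto simp: R_def)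
  have "R ` U \<subseteq> Pow (P \<times> P)" by (auto simp: R_def)
  then have finQ: "finite \<Q>" using P(1) unfolding \<Q>_def by (metis finite_Pow_iff finite_SigmaI finite_imageI finite_subset)
  have xcell: "x \<in> cell (R x)" if "x \<in> U" for x using Ubox[OF that] by (auto simp: cell_def R_def)
  have halfspaces: "\<exists>\<Lambda>. finite \<Lambda> \<and> (\<forall>l\<in>\<Lambda>. int_affine l) \<and> cell (R x) = {z. \<forall>l\<in>\<Lambda>. 0 \<le> l z}" for x
  proof -
    define \<Lambda> where "\<Lambda> = (\<lambda>(p, q) z. q z - p z) ` R x \<union> (range (\<lambda>i z. z $ i) \<union> range (\<lambda>i z. 1 - z $ i))"
    have "finite \<Lambda>" unfolding \<Lambda>_def using finR[of x] by (auto intro!: finite_imageI)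
    moreover have "\<forall>l\<in>\<Lambda>. int_affine l"
      unfolding \<Lambda>_def using int_affine_diff[OF int_affine_const[of 1] int_affine_coordinate] int_affine_diff[OF P(2) P(2)]
      by (auto simp: R_def int_affine_coordinate)
    moreover have "cell (R x) = {z. \<forall>l\<in>\<Lambda>. 0 \<le> l z}"
      unfolding cell_def \<Lambda>_def ball_Un by (auto simp: mem_box_cart image_iff)
    ultimately show ?thesis by blast
  qed
  have closed_cell: "closed (cell (R x))" for x
  proof -
    obtain \<Lambda> where L: "finite \<Lambda>" "\<And>l. l \<in> \<Lambda> \<Longrightarrow> int_affine l" "cell (R x) = {z. \<forall>l\<in>\<Lambda>. 0 \<le> l z}"
      using halfspaces[of x] by (elim exE conjE) (rule that, auto)
    have "closed {z. 0 \<le> l z}" if "l \<in> \<Lambda>" for l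
      by (rule closed_Collect_le[OF continuous_on_const int_affine_continuous[OF L(2)[OF that]]])
    then have "closed (\<Inter>l\<in>\<Lambda>. {z. 0 \<le> l z})" by (intro closed_INT) blast
    moreover have "(\<Inter>l\<in>\<Lambda>. {z. 0 \<le> l z}) = {z. \<forall>l\<in>\<Lambda>. 0 \<le> l z}" by blast
    ultimately show ?thesis unfolding L(3) by (simp only:)
  qed
  have "\<Union>\<Q> = cube"
  proof
    show "\<Union>\<Q> \<subseteq> cube" by (auto simp: \<Q>_def cell_def)
    have "closed C" if "C \<in> \<Q>" for C using that closed_cell unfolding \<Q>_def by blast
    then have "closed (\<Union>\<Q>)" using finQ by (intro closed_Union) auto
    moreover have "U \<subseteq> \<Union>\<Q>" using xcell unfolding \<Q>_def by blast
    ultimately have "closure U \<subseteq> \<Union>\<Q>" by (intro closure_minimal)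
    with cubeU show "cube \<subseteq> \<Union>\<Q>" by (rule order_trans)
  qed
  moreover have "interior (cell (R x)) \<noteq> {}" if x: "x \<in> U" for x
  proof -
    define W where "W = box 0 1 \<inter> (\<Inter>(p, q)\<in>R x. {z. p z < q z})"
    have "open W"
      unfolding W_def using finR P(2)
      by (auto simp: R_def intro!: open_Int open_box open_INT open_Collect_less int_affine_continuous)
    moreover have "W \<subseteq> cell (R x)"
      using box_subset_cbox[of 0 "1 :: real^'n"] by (force simp: W_def cell_def)
    moreover have "x \<in> W" using x by (auto simp: W_def U_def R_def)
    ultimately show ?thesis using interior_maximal by blast
  qed
  moreover have "\<exists>p. int_affine p \<and> (\<forall>z\<in>cell (R x). f z = p z)" if x: "x \<in> U" and f: "f \<in> S" for x f
  proof -
    have cont: "continuous_on cube f" using S f by (auto simp: McNaughton_def)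
    obtain p where p: "p \<in> Pf f" "f x = p x" using Pf(3)[OF f Ubox[OF x]] by auto
    have pP: "q \<in> P" if "q \<in> Pf f" for q using that f by (auto simp: P_def)
    have "f z = p z" if z: "z \<in> cell (R x)" for z
    proof (rule antisym)
      have zc: "z \<in> cube" using z by (simp add: cell_def)
      \<comment> \<open>The piece \<open>q\<close> is at least \<open>p\<close> at \<open>x\<close>,
        and this order persists on the cell, so \<open>p z \<le> q z \<le> f z\<close>. The other
        inequality is dual.\<close>
      obtain q where q: "q \<in> Pf f" "f x \<le> q x" "q z \<le> f z"
        using exists_piece_below[OF cont Pf(1)[OF f] Pf(2)[OF f] Pf(3)[OF f] zc Ubox[OF x]] p(2) by blast
      have "p z \<le> q z"
      proof (cases "p = q")
        case False
        then have "p x \<noteq> q x" using Uneq[OF x] pP q(1) p(1) by blast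
        then have "(p, q) \<in> R x" using pP q p unfolding R_def by simp
        then show ?thesis using z unfolding cell_def by blast
      qed simp
      then show "p z \<le> f z" using q by simp
      obtain q where q: "q \<in> Pf f" "q x \<le> f x" "f z \<le> q z"
        using exists_piece_above[OF cont Pf(1)[OF f] Pf(2)[OF f] Pf(3)[OF f] zc Ubox[OF x]] p(2) by blast
      have "q z \<le> p z"
      proof (cases "p = q")
        case False
        then have "p x \<noteq> q x" using Uneq[OF x] pP q(1) p(1) by blast
        then have "(q, p) \<in> R x" using pP q p unfolding R_def by simp
        then show ?thesis using z unfolding cell_def by blast
      qed simp
      then show "f z \<le> p z" using q by simp
    qed
    then show ?thesis using Pf(2)[OF f p(1)] by blast
  qed
  note * = calculation this
  show ?thesis
  proof (intro exI[of _ \<Q>] conjI ballI)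
    fix Q assume "Q \<in> \<Q>"
    then obtain x where x: "x \<in> U" and Q: "Q = cell (R x)" unfolding \<Q>_def by blast
    show "interior Q \<noteq> {}" unfolding Q by (rule *(2)[OF x])
    show "\<exists>\<Lambda>. finite \<Lambda> \<and> (\<forall>l\<in>\<Lambda>. int_affine l) \<and> Q = {z. \<forall>l\<in>\<Lambda>. 0 \<le> l z}" unfolding Q by (rule halfspaces)
    show "\<exists>p. int_affine p \<and> (\<forall>x\<in>Q. f x = p x)" if "f \<in> S" for f unfolding Q by (rule *(3)[OF x that])
  qed (rule finQ, rule *(1))
qed

section \<open>The homogeneous embedding and the cones over the cells\<close>

lemma gram_row_sum:
  fixes b :: "'s \<Rightarrow> real^'n"
  shows "(\<Sum>i\<in>UNIV. x $ i *s row i (\<chi> i j. \<Sum>f\<in>S. b f $ i * b f $ j)) = (\<chi> j. \<Sum>f\<in>S. b f $ j * (b f \<bullet> x))"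
proof -
  have "(\<Sum>i\<in>UNIV. x $ i * (\<Sum>f\<in>S. b f $ i * b f $ j)) = (\<Sum>f\<in>S. b f $ j * (\<Sum>i\<in>UNIV. b f $ i * x $ i))" for j
    unfolding sum_distrib_left by (subst sum.swap) (simp add: mult_ac)
  then show ?thesis by (simp add: vec_eq_iff row_def inner_vec_def)
qed

text \<open>Pairing \<open>M *v x = 0\<close> with \<open>x\<close> gives a sum of the squares of
  \<open>b f \<bullet> x\<close>, so all of these vanish.\<close>

lemma gram_det_nonzero:
  fixes b :: "'s \<Rightarrow> real^'n"
  assumes "finite S" and inj: "\<And>x. (\<And>f. f \<in> S \<Longrightarrow> b f \<bullet> x = 0) \<Longrightarrow> x = 0"
  shows "det (\<chi> i j. \<Sum>f\<in>S. b f $ i * b f $ j) \<noteq> 0"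
proof -
  define M where "M = (\<chi> i j. \<Sum>f\<in>S. b f $ i * b f $ j)"
  have "x = 0" if "M *v x = 0" for x
  proof -
    have "(M *v x) $ i = (\<Sum>f\<in>S. b f $ i * (b f \<bullet> x))" for i
      unfolding M_def matrix_vector_mult_def inner_vec_def
      by (simp add: sum_distrib_left sum_distrib_right) (subst sum.swap, simp add: mult_ac)
    then have "0 = (\<Sum>i\<in>UNIV. (\<Sum>f\<in>S. b f $ i * (b f \<bullet> x)) * x $ i)" using that by simp
    also have "\<dots> = (\<Sum>f\<in>S. \<Sum>i\<in>UNIV. (b f \<bullet> x) * (b f $ i * x $ i))"
      unfolding sum_distrib_right by (subst sum.swap) (simp add: mult_ac)
    also have "\<dots> = (\<Sum>f\<in>S. (b f \<bullet> x) * (b f \<bullet> x))"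
      by (simp add: inner_vec_def flip: sum_distrib_left)
    finally have "\<forall>f\<in>S. (b f \<bullet> x) * (b f \<bullet> x) = 0"
      using assms(1) by (subst (asm) eq_commute, subst (asm) sum_nonneg_eq_0_iff) auto
    then show "x = 0" by (intro inj) simp
  qed
  then have "invertible M" by (simp add: invertible_left_inverse matrix_left_invertible_ker)
  then show ?thesis by (simp add: invertible_det_nz M_def)
qed

text \<open>The embedding into the orthant lists, for every generator \<open>f\<close>, both \<open>f x\<close> and \<open>1 - f x\<close>. It is
  homogenized by the degree, on the cone over its image the common value of the sums
  \<open>y (f, True) + y (f, False)\<close>.\<close>

definition cube_embedding :: "(real^'n \<Rightarrow> real) set \<Rightarrow> real^'n \<Rightarrow> (real^'n \<Rightarrow> real) \<times> bool \<Rightarrow> real" where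
  "cube_embedding S x = (\<lambda>(f, s). if f \<in> S then if s then f x else 1 - f x else 0)"

definition degree_at :: "'s \<Rightarrow> ('s \<times> bool \<Rightarrow> real) \<Rightarrow> real" where
  "degree_at f y = y (f, True) + y (f, False)"

lemma int_functional_degree: "int_functional (degree_at f)"
  unfolding degree_at_def[abs_def] by (intro int_functional_intros)

lemma degree_cube_embedding: "f \<in> S \<Longrightarrow> degree_at f (cube_embedding S x) = 1"
  by (simp add: degree_at_def cube_embedding_def)

text \<open>The cone over the image of a cell is cut out by integral functionals: the Gram matrix of the linear
  parts of the generators is invertible, and by Cramer's rule a multiple of the inverse of the
  embedding is integral.\<close>

lemma cell_functionals:
  fixes S :: "(real^'n \<Rightarrow> real) set"
  assumes S: "finite S" "f0 \<in> S" and \<Lambda>: "finite \<Lambda>" "\<And>l. l \<in> \<Lambda> \<Longrightarrow> int_affine l"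
    and Q: "Q = {z. \<forall>l\<in>\<Lambda>. 0 \<le> l z}" "interior Q \<noteq> {}"
    and aff: "\<And>f. f \<in> S \<Longrightarrow> \<exists>p. int_affine p \<and> (\<forall>x\<in>Q. f x = p x)"
    and inj: "\<And>x y. x \<in> Q \<Longrightarrow> y \<in> Q \<Longrightarrow> (\<And>f. f \<in> S \<Longrightarrow> f x = f y) \<Longrightarrow> x = y"
  shows "\<exists>\<Phi>. finite \<Phi> \<and> (\<forall>\<phi>\<in>\<Phi>. int_functional \<phi> \<and> (\<forall>x\<in>Q. 0 \<le> \<phi> (cube_embedding S x))) \<and>
    (\<forall>y\<in>orthant (S \<times> UNIV). y \<noteq> (\<lambda>k. 0) \<longrightarrow> (\<forall>\<phi>\<in>\<Phi>. 0 \<le> \<phi> y) \<longrightarrow>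
      (\<exists>x\<in>Q. 0 < degree_at f0 y \<and> y = (\<lambda>k. degree_at f0 y * cube_embedding S x k) \<and>
        ((\<forall>k. y k \<in> \<int>) \<longrightarrow> (\<forall>i. x $ i \<in> \<rat>))))"
proof -
  have "\<exists>b c. (\<forall>i. b $ i \<in> \<int>) \<and> c \<in> \<int> \<and> (\<forall>x\<in>Q. f x = b \<bullet> x + c)" if "f \<in> S" for f
    using aff[OF that] int_affine_inner by metis
  then obtain b c where bc: "\<And>f i. f \<in> S \<Longrightarrow> b f $ i \<in> \<int>" "\<And>f. f \<in> S \<Longrightarrow> c f \<in> \<int>"
    "\<And>f x. f \<in> S \<Longrightarrow> x \<in> Q \<Longrightarrow> f x = b f \<bullet> x + c f" by metis
  have "\<exists>b c. (\<forall>i. b $ i \<in> \<int>) \<and> c \<in> \<int> \<and> (\<forall>x. l x = b \<bullet> x + c)" if "l \<in> \<Lambda>" for l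
    using int_affine_inner[OF \<Lambda>(2)[OF that]] .
  then obtain lb lc where l: "\<And>f i. f \<in> \<Lambda> \<Longrightarrow> lb f $ i \<in> \<int>" "\<And>f. f \<in> \<Lambda> \<Longrightarrow> lc f \<in> \<int>"
    "\<And>f x. f \<in> \<Lambda> \<Longrightarrow> f x = lb f \<bullet> x + lc f" by metis
  define M where "M = (\<chi> i j. \<Sum>f\<in>S. b f $ i * b f $ j)"
  have Mint: "M $ i $ j \<in> \<int>" for i j unfolding M_def using bc by (auto intro!: Ints_sum)
  \<comment> \<open>A nonzero vector orthogonal to all linear parts, suitably scaled, would lead
    from an interior point of \<open>Q\<close> to another point of \<open>Q\<close> with the same
    values of all generators.\<close>
  have "det M \<noteq> 0"
    unfolding M_def
  proof (rule gram_det_nonzero[OF S(1)])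
    fix w assume w: "\<And>f. f \<in> S \<Longrightarrow> b f \<bullet> w = 0"
    obtain x0 e where e: "e > 0" "cball x0 e \<subseteq> Q" using Q(2) by (metis all_not_in_conv mem_interior_cball)
    show "w = 0"
    proof (rule ccontr)
      assume "w \<noteq> 0"
      define w' where "w' = (e / norm w) *\<^sub>R w"
      have w': "norm w' = e" using \<open>w \<noteq> 0\<close> e by (simp add: w'_def)
      have "x0 \<in> Q" "x0 + w' \<in> Q" using e w' by (auto simp: dist_norm)
      moreover have "f x0 = f (x0 + w')" if "f \<in> S" for f
        using bc(3)[OF that \<open>x0 \<in> Q\<close>] bc(3)[OF that \<open>x0 + w' \<in> Q\<close>] w[OF that]
        by (simp add: inner_add_right w'_def)
      ultimately have "x0 = x0 + w'" by (rule inj)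
      then show False using w' e by auto
    qed
  qed
  \<comment> \<open>A square, so that the common denominator is positive and inequalities keep their
    direction; this accounts for the extra factor \<open>det M\<close> in
    \<open>\<kappa>\<close>.\<close>
  define N where "N = det M * det M"
  have N: "N > 0" "N \<in> \<int>" using \<open>det M \<noteq> 0\<close> det_Ints[OF Mint] by (auto simp: N_def zero_less_mult_iff)
  define d where "d = degree_at f0"
  \<comment> \<open>If \<open>y\<close> has degree \<open>t\<close> and lies over the point
    \<open>x\<close>, the vector of the \<open>r j y\<close> is \<open>M\<close> applied to
    \<open>t *\<^sub>R x\<close>, and Cramer's rule yields
    \<open>\<kappa> k y = N * (t * x $ k)\<close>.\<close>
  define r where "r j y = (\<Sum>f\<in>S. b f $ j * (y (f, True) - c f * d y))" for j y
  define \<kappa> where "\<kappa> k y = det M * det (\<chi> i. if i = k then (\<chi> j. r j y) else M $ i)" for k y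
  have d: "int_functional d" unfolding d_def by (rule int_functional_degree)
  have "int_functional (r j)" for j
    unfolding r_def[abs_def] using bc d by (intro int_functional_intros) auto
  then have \<kappa>: "int_functional (\<kappa> k)" for k
    unfolding \<kappa>_def[abs_def] by (intro int_functional_scale int_functional_det_row det_Ints Mint)
  have \<kappa>_eq: "\<kappa> k y = N * (t * x $ k)" if "\<And>f. f \<in> S \<Longrightarrow> y (f, True) = t * (b f \<bullet> x + c f)" "d y = t" for k y t x
  proof -
    have "(\<chi> j. r j y) = (\<Sum>i\<in>UNIV. (t *\<^sub>R x) $ i *s row i M)"
      unfolding M_def gram_row_sum r_def using that by (auto simp: vec_eq_iff algebra_simps intro!: sum.cong)
    moreover have "M $ i = row i M" for i by (simp add: row_def)
    ultimately have "det (\<chi> i. if i = k then (\<chi> j. r j y) else M $ i) = (t *\<^sub>R x) $ k * det M"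
      by (simp only: cramer_lemma_transpose)
    then show ?thesis by (simp add: \<kappa>_def N_def)
  qed
  \<comment> \<open>Homogeneous conditions, cleared of denominators: \<open>\<psi> f y = 0\<close>
    says that \<open>f\<close> has the right value at the recovered point,
    \<open>\<delta> f y = 0\<close> that the degrees agree, and \<open>0 \<le> \<theta> m y\<close>
    that the point satisfies the inequality of \<open>m\<close>.\<close>
  define \<psi> where "\<psi> f y = N * y (f, True) - ((\<Sum>i\<in>UNIV. b f $ i * \<kappa> i y) + N * c f * d y)" for f y
  define \<delta> where "\<delta> f y = degree_at f y - d y" for f y
  define \<theta> where "\<theta> m y = (\<Sum>i\<in>UNIV. lb m $ i * \<kappa> i y) + N * lc m * d y" for m y
  have \<psi>: "int_functional (\<psi> f)" if "f \<in> S" for f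
    unfolding \<psi>_def[abs_def] using bc that N d \<kappa> by (intro int_functional_intros Ints_mult) auto
  have \<delta>: "int_functional (\<delta> f)" for f
    unfolding \<delta>_def[abs_def] by (intro int_functional_intros int_functional_degree d)
  have \<theta>: "int_functional (\<theta> m)" if "m \<in> \<Lambda>" for m
    unfolding \<theta>_def[abs_def] using l that N d \<kappa> by (intro int_functional_intros Ints_mult) auto
  \<comment> \<open>Each equation enters as two opposite inequalities, so that the cone is described
    by nonnegativity alone.\<close>
  define \<Phi> where "\<Phi> = \<psi> ` S \<union> (\<lambda>f y. (-1) * \<psi> f y) ` S \<union> \<delta> ` S \<union> (\<lambda>f y. (-1) * \<delta> f y) ` S \<union> \<theta> ` \<Lambda>"
  have fin: "finite \<Phi>" unfolding \<Phi>_def using S \<Lambda> by auto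
  have int: "int_functional \<phi>" if "\<phi> \<in> \<Phi>" for \<phi>
    using that \<psi> \<delta> \<theta> int_functional_scale[of "-1", OF _ \<psi>] int_functional_scale[of "-1", OF _ \<delta>]
    unfolding \<Phi>_def by auto
  have sum_eq: "(\<Sum>i\<in>UNIV. w $ i * (N * (t * x $ i))) = N * t * (w \<bullet> x)" for w x :: "real^'n" and t
    by (simp add: inner_vec_def sum_distrib_left mult_ac)
  have pos: "0 \<le> \<phi> (cube_embedding S x)" if \<phi>: "\<phi> \<in> \<Phi>" and x: "x \<in> Q" for \<phi> x
  proof -
    let ?y = "cube_embedding S x"
    have yt: "?y (f, True) = 1 * (b f \<bullet> x + c f)" if "f \<in> S" for f
      using bc(3)[OF that x] that by (simp add: cube_embedding_def)
    have dy: "d ?y = 1" unfolding d_def using S by (intro degree_cube_embedding)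
    have lam: "\<kappa> k ?y = N * (1 * x $ k)" for k by (rule \<kappa>_eq[OF yt dy])
    have "\<psi> f ?y = 0" if "f \<in> S" for f
      unfolding \<psi>_def lam sum_eq using that by (simp add: yt dy algebra_simps)
    moreover have "\<delta> f ?y = 0" if "f \<in> S" for f
      using degree_cube_embedding[OF that] dy by (simp add: \<delta>_def)
    moreover have "0 \<le> \<theta> m ?y" if "m \<in> \<Lambda>" for m
    proof -
      have "\<theta> m ?y = N * m x" unfolding \<theta>_def lam sum_eq using l(3)[OF that] by (simp add: dy algebra_simps)
      moreover have "0 \<le> m x" using x that Q by auto
      ultimately show ?thesis using N by simp
    qed
    ultimately show ?thesis using \<phi> unfolding \<Phi>_def by auto
  qed
  have cone: "\<exists>x\<in>Q. 0 < d y \<and> y = (\<lambda>k. d y * cube_embedding S x k) \<and> ((\<forall>k. y k \<in> \<int>) \<longrightarrow> (\<forall>i. x $ i \<in> \<rat>))"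
    if y: "y \<in> orthant (S \<times> UNIV)" "y \<noteq> (\<lambda>k. 0)" "\<And>\<phi>. \<phi> \<in> \<Phi> \<Longrightarrow> 0 \<le> \<phi> y" for y
  proof -
    have "0 \<le> \<psi> f y \<and> 0 \<le> (-1) * \<psi> f y \<and> 0 \<le> \<delta> f y \<and> 0 \<le> (-1) * \<delta> f y" if "f \<in> S" for f
      using that by (intro conjI y(3)) (auto simp: \<Phi>_def)
    then have z: "\<psi> f y = 0" "\<delta> f y = 0" if "f \<in> S" for f using that by force+
    have th: "0 \<le> \<theta> m y" if "m \<in> \<Lambda>" for m using that by (intro y(3)) (auto simp: \<Phi>_def)
    have ynn: "0 \<le> y k" for k using y(1) unfolding orthant_def by blast
    have y0: "y (f, s) = 0" if "f \<notin> S" for f s using y(1) that by (simp add: orthant_def)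
    have deg: "y (f, True) + y (f, False) = d y" if "f \<in> S" for f
      using z(2)[OF that] by (simp add: \<delta>_def degree_at_def)
    \<comment> \<open>The two entries of each generator are nonnegative with sum \<open>d y\<close>,
      so a point without positive degree would be the origin. This is the use of listing
      \<open>1 - f\<close> besides \<open>f\<close>.\<close>
    have dpos: "d y > 0"
    proof (rule ccontr)
      assume "\<not> d y > 0"
      then have "y (f, True) + y (f, False) \<le> 0" if "f \<in> S" for f using deg[OF that] by simp
      then have "y (f, True) = 0 \<and> y (f, False) = 0" for f
        using ynn[of "(f, True)"] ynn[of "(f, False)"] y0 by (cases "f \<in> S") fastforce+
      then have "y (f, s) = 0" for f s by (cases s) auto
      then show False using y(2) by auto
    qed
    define x where "x = (\<chi> k. \<kappa> k y / (N * d y))"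
    have lam: "\<kappa> k y = N * (d y * x $ k)" for k using dpos N by (simp add: x_def)
    have yT: "y (f, True) = d y * (b f \<bullet> x + c f)" if "f \<in> S" for f
    proof -
      have "N * y (f, True) = N * (d y * (b f \<bullet> x + c f))"
        using z(1)[OF that] unfolding \<psi>_def lam sum_eq by (simp add: algebra_simps)
      then show ?thesis using N by simp
    qed
    have "0 \<le> m x" if "m \<in> \<Lambda>" for m
    proof -
      have "\<theta> m y = N * d y * m x" unfolding \<theta>_def lam sum_eq using l(3)[OF that] by (simp add: algebra_simps)
      then show ?thesis using th[OF that] mult_pos_pos[OF N(1) dpos] by (metis linorder_not_less mult_pos_neg)
    qed
    then have x: "x \<in> Q" using Q(1) by auto
    have "y (f, s) = d y * cube_embedding S x (f, s)" for f s
    proof (cases "f \<in> S")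
      case True
      then have "y (f, True) = d y * f x" using yT[OF True] bc(3)[OF True x] by simp
      with deg[OF True] have "y (f, s) = (if s then d y * f x else d y - d y * f x)" by (cases s) auto
      then show ?thesis using True by (simp add: cube_embedding_def algebra_simps)
    qed (simp add: y0 cube_embedding_def)
    then have "y = (\<lambda>k. d y * cube_embedding S x k)" by auto
    moreover have "x $ i \<in> \<rat>" if "\<forall>k. y k \<in> \<int>" for i
    proof -
      have "\<kappa> i y \<in> \<int>" "d y \<in> \<int>" using \<kappa>[of i] d that unfolding int_functional_def by blast+
      then show ?thesis using N Ints_subset_Rats by (auto simp: x_def intro!: Rats_divide Rats_mult)
    qed
    ultimately show ?thesis using x dpos by blast
  qed
  show ?thesis
    using fin int pos cone unfolding d_def by (intro exI[of _ \<Phi>]) blast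
qed

section \<open>The triangulation given by a coherent fan\<close>

lemma int_functional_combination:
  assumes "int_functional \<phi>"
  shows "\<phi> (\<lambda>i. \<Sum>v\<in>V. t v * v i) = (\<Sum>v\<in>V. t v * \<phi> v)"
proof -
  have add: "\<phi> (\<lambda>i. x i + y i) = \<phi> x + \<phi> y" and scale: "\<phi> (\<lambda>i. r * x i) = r * \<phi> x" for x y r
    using assms unfolding int_functional_def by blast+
  have zero: "\<phi> (\<lambda>i. 0) = 0" using scale[of 0 "\<lambda>i. 0"] by simp
  show ?thesis
    by (induction V rule: infinite_finite_induct) (simp_all add: add scale zero)
qed

text \<open>A dependency \<open>u\<close> perturbs the barycentre: the weights
  \<open>1 / n + e * u v\<close> give the same point. They are nonnegative because \<open>B\<close>
  exceeds every \<open>\<bar>u v\<bar>\<close> and \<open>e = 1 / (n * B)\<close>.\<close>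

lemma affine_independent_if_convex_coordinates_unique:
  fixes S :: "'a::real_vector set"
  assumes S: "finite S"
    and unique: "\<And>u w. (\<And>v. v \<in> S \<Longrightarrow> 0 \<le> u v \<and> 0 \<le> w v) \<Longrightarrow> sum u S = 1 \<Longrightarrow> sum w S = (1::real) \<Longrightarrow>
      (\<Sum>v\<in>S. u v *\<^sub>R v) = (\<Sum>v\<in>S. w v *\<^sub>R v) \<Longrightarrow> (\<And>v. v \<in> S \<Longrightarrow> u v = w v)"
  shows "\<not> affine_dependent S"
proof
  assume "affine_dependent S"
  then obtain u v where u: "sum u S = 0" "v \<in> S" "u v \<noteq> 0" "(\<Sum>v\<in>S. u v *\<^sub>R v) = 0"
    using affine_dependent_explicit_finite[OF S] by blast
  define n where "n = real (card S)"
  have n: "n > 0" using S u(2) by (auto simp: n_def card_gt_0_iff)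
  define B where "B = 1 + (\<Sum>v\<in>S. \<bar>u v\<bar>)"
  have B: "B > 0" unfolding B_def by (intro add_pos_nonneg sum_nonneg) auto
  define e where "e = 1 / (n * B)"
  have e: "e > 0" using n B by (simp add: e_def)
  have nn: "0 \<le> 1 / n + e * u w" if "w \<in> S" for w
  proof -
    have "\<bar>u w\<bar> \<le> B" unfolding B_def using member_le_sum[OF that, of "\<lambda>v. \<bar>u v\<bar>"] S by auto
    then have "e * \<bar>u w\<bar> \<le> e * B" using e by simp
    also have "e * B = 1 / n" using B by (simp add: e_def)
    finally have "e * \<bar>u w\<bar> \<le> 1 / n" .
    moreover have "- (e * \<bar>u w\<bar>) \<le> e * u w"
      using e mult_left_mono[of "- \<bar>u w\<bar>" "u w" e] by simp
    ultimately show ?thesis by linarith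
  qed
  have "1 / n + e * u v = 1 / n"
  proof (rule unique[OF _ _ _ _ u(2), of "\<lambda>w. 1 / n + e * u w" "\<lambda>w. 1 / n"])
    show "(\<Sum>w\<in>S. 1 / n + e * u w) = 1" "(\<Sum>w\<in>S. 1 / n) = 1"
      using n u(1) by (simp_all add: sum.distrib n_def flip: sum_distrib_left)
    have "(\<Sum>v\<in>S. (1 / n + e * u v) *\<^sub>R v) = (\<Sum>v\<in>S. (1 / n) *\<^sub>R v) + e *\<^sub>R (\<Sum>v\<in>S. u v *\<^sub>R v)"
      by (simp add: scaleR_add_left sum.distrib scaleR_sum_right)
    then show "(\<Sum>v\<in>S. (1 / n + e * u v) *\<^sub>R v) = (\<Sum>v\<in>S. (1 / n) *\<^sub>R v)" using u(4) by simp
  qed (use nn n in auto)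
  then show False using e u(3) by simp
qed

text \<open>The clause \<open>cell\<close> is what coherence provides: the vectors carrying
  \<open>E x\<close> lie over rational points of one convex set on which \<open>E\<close> is affine.
  The clause \<open>E_den\<close> makes the weights integral.\<close>

locale fan_chart =
  fixes G :: "'k set" and V c and E :: "real^'n \<Rightarrow> 'k \<Rightarrow> real" and d
  assumes fan: "fan G V c" and d: "int_functional d"
    and E_orthant: "x \<in> cube \<Longrightarrow> E x \<in> orthant G"
    and E_degree: "x \<in> cube \<Longrightarrow> d (E x) = 1"
    and E_inj: "inj_on E cube"
    and cell: "x \<in> cube \<Longrightarrow> \<exists>Q. Q \<subseteq> cube \<and> convex Q \<and> (\<forall>k. affine_fun_on Q (\<lambda>x. E x k)) \<and>
      (\<forall>v. c (E x) v > 0 \<longrightarrow> (\<exists>p\<in>Q. d v > 0 \<and> v = (\<lambda>k. d v * E p k) \<and> (\<forall>i. p $ i \<in> \<rat>)))"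
    and E_den: "x \<in> cube \<Longrightarrow> \<forall>i. x $ i \<in> \<rat> \<Longrightarrow> real (den x) * E x k \<in> \<int>"
begin

lemmas F = fanD[OF fan]

definition carrier :: "real^'n \<Rightarrow> ('k \<Rightarrow> real) set" where "carrier x = {v. c (E x) v > 0}"

text \<open>Vectors of \<open>V\<close> outside this set have coordinate zero on the whole image of
  the cube.\<close>

definition rays :: "('k \<Rightarrow> real) set" where "rays = (\<Union>x\<in>cube. carrier x)"

text \<open>The point of the cube over which the ray of \<open>v\<close> lies; on
  \<open>rays\<close> the choice is unique by \<open>pt_eqI\<close>.\<close>

definition pt :: "('k \<Rightarrow> real) \<Rightarrow> real^'n" where
  "pt v = (SOME p. p \<in> cube \<and> v = (\<lambda>k. d v * E p k))"

lemma carrier_subset: "x \<in> cube \<Longrightarrow> carrier x \<subseteq> V"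
  using F(5)[OF E_orthant] by (force simp: carrier_def)

lemma finite_carrier: "x \<in> cube \<Longrightarrow> finite (carrier x)"
  using carrier_subset F(1) finite_subset by blast

lemma rays_subset: "rays \<subseteq> V" and finite_rays: "finite rays"
proof -
  show "rays \<subseteq> V" using carrier_subset by (auto simp: rays_def)
  then show "finite rays" using F(1) finite_subset by blast
qed

lemma degree_pos:
  assumes "v \<in> rays" shows "d v > 0"
  using assms cell by (fastforce simp: rays_def carrier_def)

lemma pt_eqI:
  assumes "v \<in> rays" "p \<in> cube" "v = (\<lambda>k. d v * E p k)"
  shows "pt v = p"
proof -
  have "pt v \<in> cube \<and> v = (\<lambda>k. d v * E (pt v) k)"
    unfolding pt_def by (rule someI[of _ p]) (use assms in blast)
  then have pv: "pt v \<in> cube" and "(\<lambda>k. d v * E (pt v) k) = (\<lambda>k. d v * E p k)" using assms(3) by auto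
  then have "E (pt v) k = E p k" for k
    using degree_pos[OF assms(1)] by (metis less_irrefl mult_left_cancel)
  then show ?thesis using E_inj pv assms(2) by (meson ext inj_onD)
qed

lemma cell_pts:
  assumes "x \<in> cube"
  obtains Q where "Q \<subseteq> cube" "convex Q" "\<And>k. affine_fun_on Q (\<lambda>x. E x k)" "pt ` carrier x \<subseteq> Q"
    "\<And>v i. v \<in> carrier x \<Longrightarrow> pt v $ i \<in> \<rat>" "\<And>v. v \<in> carrier x \<Longrightarrow> v = (\<lambda>k. d v * E (pt v) k)"
proof -
  obtain Q where Q: "Q \<subseteq> cube" "convex Q" "\<And>k. affine_fun_on Q (\<lambda>x. E x k)"
    and p: "\<And>v. c (E x) v > 0 \<Longrightarrow> \<exists>p\<in>Q. d v > 0 \<and> v = (\<lambda>k. d v * E p k) \<and> (\<forall>i. p $ i \<in> \<rat>)"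
    using cell[OF assms] by blast
  have "pt v \<in> Q \<and> (\<forall>i. pt v $ i \<in> \<rat>) \<and> v = (\<lambda>k. d v * E (pt v) k)" if v: "v \<in> carrier x" for v
  proof -
    obtain p where "p \<in> Q" "v = (\<lambda>k. d v * E p k)" "\<forall>i. p $ i \<in> \<rat>"
      using p[of v] v unfolding carrier_def by blast
    moreover have "v \<in> rays" using v assms by (auto simp: rays_def)
    ultimately show ?thesis using pt_eqI[of v p] Q(1) by auto
  qed
  with Q show ?thesis by (intro that[of Q]) blast+
qed

lemma ray_pt:
  assumes "v \<in> rays"
  shows "pt v \<in> cube" "\<forall>i. pt v $ i \<in> \<rat>" "d v * E (pt v) k = v k"
proof -
  obtain x where x: "x \<in> cube" "v \<in> carrier x" using assms by (auto simp: rays_def)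
  show "pt v \<in> cube" "\<forall>i. pt v $ i \<in> \<rat>" "d v * E (pt v) k = v k"
    by (rule cell_pts[OF x(1)]; use x(2) in \<open>metis subsetD image_eqI\<close>)+
qed

text \<open>As \<open>E\<close> is affine on a convex set containing the points, it sends the
  combination to the sum of the vectors \<open>(u v / d v) v\<close>. These coefficients are
  supported on the carrier of \<open>x\<close>, so they are the coordinates.\<close>

lemma convex_combination_of_pts:
  assumes x: "x \<in> cube" and \<tau>: "\<tau> \<subseteq> carrier x" and u: "\<And>v. v \<in> \<tau> \<Longrightarrow> 0 \<le> u v" "sum u \<tau> = 1"
  shows "(\<Sum>v\<in>\<tau>. u v *\<^sub>R pt v) \<in> cube"
    "c (E (\<Sum>v\<in>\<tau>. u v *\<^sub>R pt v)) = (\<lambda>v. if v \<in> \<tau> then u v / d v else 0)"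
proof -
  obtain Q where Q: "Q \<subseteq> cube" "convex Q" "\<And>k. affine_fun_on Q (\<lambda>x. E x k)" "pt ` carrier x \<subseteq> Q"
    by (rule cell_pts[OF x]) blast
  have fin: "finite \<tau>" using finite_carrier[OF x] \<tau> finite_subset by blast
  have rays: "v \<in> rays" if "v \<in> \<tau>" for v using that \<tau> x by (auto simp: rays_def)
  have ptQ: "pt v \<in> Q" if "v \<in> \<tau>" for v using that \<tau> Q(4) by auto
  define z where "z = (\<Sum>v\<in>\<tau>. u v *\<^sub>R pt v)"
  have z: "z \<in> Q" unfolding z_def by (rule convex_sum[OF fin Q(2) u(2)]) (use u ptQ in auto)
  then show "(\<Sum>v\<in>\<tau>. u v *\<^sub>R pt v) \<in> cube" using Q(1) by (auto simp: z_def)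
  define t where "t v = (if v \<in> \<tau> then u v / d v else 0)" for v
  have "E z k = (\<Sum>v\<in>V. t v * v k)" for k
  proof -
    obtain b e where be: "\<And>x. x \<in> Q \<Longrightarrow> E x k = b \<bullet> x + e" using Q(3)[of k] unfolding affine_fun_on_def by blast
    have "(\<Sum>v\<in>V. t v * v k) = (\<Sum>v\<in>\<tau>. t v * v k)"
      by (rule sum.mono_neutral_right) (use F(1) \<tau> carrier_subset[OF x] in \<open>auto simp: t_def\<close>)
    also have "\<dots> = (\<Sum>v\<in>\<tau>. u v * E (pt v) k)"
    proof (rule sum.cong[OF refl])
      fix v assume v: "v \<in> \<tau>"
      have "t v * v k = t v * (d v * E (pt v) k)" by (simp only: ray_pt[OF rays[OF v]])
      then show "t v * v k = u v * E (pt v) k" using v degree_pos[OF rays[OF v]] by (simp add: t_def)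
    qed
    also have "\<dots> = (\<Sum>v\<in>\<tau>. u v * (b \<bullet> pt v + e))" using be ptQ by (intro sum.cong) auto
    also have "\<dots> = b \<bullet> z + e * sum u \<tau>"
      by (simp add: z_def algebra_simps sum.distrib inner_sum_right sum_distrib_left)
    also have "\<dots> = E z k" using be[OF z] u by simp
    finally show ?thesis by simp
  qed
  then have "E z = (\<lambda>k. \<Sum>v\<in>V. t v * v k)" by blast
  moreover have "c (\<lambda>k. \<Sum>v\<in>V. t v * v k) = t"
  proof (rule F(8)[OF E_orthant[OF x]])
    show "0 \<le> t v" for v using u(1) degree_pos[OF rays] by (force simp: t_def)
    show "t v = 0" if "c (E x) v = 0" for v using that \<tau> by (auto simp: t_def carrier_def)
  qed
  ultimately show "c (E (\<Sum>v\<in>\<tau>. u v *\<^sub>R pt v)) = (\<lambda>v. if v \<in> \<tau> then u v / d v else 0)"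
    by (simp add: z_def t_def[abs_def])
qed

lemma coords_pt:
  assumes "v \<in> rays"
  shows "c (E (pt v)) w = (if w = v then 1 / d v else 0)"
proof -
  obtain x where x: "x \<in> cube" "v \<in> carrier x" using assms by (auto simp: rays_def)
  show ?thesis using convex_combination_of_pts(2)[OF x(1), of "{v}" "\<lambda>v. 1"] x(2) by auto
qed

lemma inj_on_pt: "inj_on pt rays"
proof (rule inj_onI, rule ccontr)
  fix v w assume vw: "v \<in> rays" "w \<in> rays" "pt v = pt w" "v \<noteq> w"
  then show False using coords_pt[of v v] coords_pt[of w v] degree_pos[of v] by simp
qed

text \<open>Applying \<open>d\<close> to the expansion of \<open>E x\<close> gives total weight 1.
  The resulting convex combination has the same coordinates as \<open>x\<close>, hence the same
  image under \<open>E\<close>, which is injective.\<close>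

lemma cube_point_combination:
  assumes x: "x \<in> cube"
  shows "(\<Sum>v\<in>carrier x. d v * c (E x) v) = 1" "x = (\<Sum>v\<in>carrier x. (d v * c (E x) v) *\<^sub>R pt v)"
proof -
  have pos: "d v > 0" if "v \<in> carrier x" for v using that x degree_pos by (auto simp: rays_def)
  have nonneg: "0 \<le> c (E x) v" for v using F(4)[OF E_orthant[OF x]] .
  have zero: "c (E x) v = 0" if "v \<notin> carrier x" for v using that nonneg[of v] by (auto simp: carrier_def)
  have Ex: "E x = (\<lambda>k. \<Sum>v\<in>V. c (E x) v * v k)" using F(6)[OF E_orthant[OF x]] by auto
  have "1 = (\<Sum>v\<in>V. c (E x) v * d v)"
    using int_functional_combination[OF d, of "c (E x)" V] E_degree[OF x] Ex by simp
  also have "\<dots> = (\<Sum>v\<in>carrier x. d v * c (E x) v)"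
    by (rule sum.mono_neutral_cong_right) (use F(1) carrier_subset[OF x] zero in auto)
  finally show s: "(\<Sum>v\<in>carrier x. d v * c (E x) v) = 1" by simp
  define z where "z = (\<Sum>v\<in>carrier x. (d v * c (E x) v) *\<^sub>R pt v)"
  have u: "0 \<le> d v * c (E x) v" if "v \<in> carrier x" for v using pos[OF that] nonneg by simp
  have zc: "z \<in> cube" unfolding z_def by (rule convex_combination_of_pts(1)[OF x order_refl u s])
  have "c (E z) = (\<lambda>v. if v \<in> carrier x then d v * c (E x) v / d v else 0)"
    unfolding z_def by (rule convex_combination_of_pts(2)[OF x order_refl u s])
  also have "\<dots> = c (E x)" using pos zero by (force simp: fun_eq_iff)
  finally have "c (E z) = c (E x)" .
  then have "E z k = E x k" for k using F(6)[OF E_orthant[OF x], of k] F(6)[OF E_orthant[OF zc], of k] by simp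
  then have "x = z" using inj_onD[OF E_inj _ x zc] by (metis ext)
  then show "x = (\<Sum>v\<in>carrier x. (d v * c (E x) v) *\<^sub>R pt v)" by (simp add: z_def)
qed

section \<open>Faces and the simplicial complex that they span\<close>

definition faces :: "('k \<Rightarrow> real) set set" where "faces = {\<tau>. \<exists>x\<in>cube. \<tau> \<subseteq> carrier x}"

lemma faces_rays: "\<tau> \<in> faces \<Longrightarrow> \<tau> \<subseteq> rays" by (auto simp: faces_def rays_def)

lemma faces_subset: "\<tau> \<in> faces \<Longrightarrow> \<sigma> \<subseteq> \<tau> \<Longrightarrow> \<sigma> \<in> faces" by (auto simp: faces_def)

lemma finite_faces: "finite faces"
  by (rule finite_subset[of _ "Pow rays"]) (use faces_rays finite_rays in auto)

lemma finite_face: "\<tau> \<in> faces \<Longrightarrow> finite \<tau>"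
  using faces_rays finite_rays finite_subset by blast

lemma hull_of_face:
  assumes "\<tau> \<in> faces" "z \<in> convex hull (pt ` \<tau>)"
  obtains u where "\<And>v. v \<in> \<tau> \<Longrightarrow> 0 \<le> u v" "sum u \<tau> = 1" "z = (\<Sum>v\<in>\<tau>. u v *\<^sub>R pt v)"
    "z \<in> cube" "c (E z) = (\<lambda>v. if v \<in> \<tau> then u v / d v else 0)"
proof -
  have inj: "inj_on pt \<tau>" using inj_on_pt faces_rays[OF assms(1)] inj_on_subset by blast
  obtain w where w: "\<forall>p\<in>pt ` \<tau>. 0 \<le> w p" "sum w (pt ` \<tau>) = 1" "(\<Sum>p\<in>pt ` \<tau>. w p *\<^sub>R p) = z"
    using assms(2) finite_face[OF assms(1)] by (auto simp: convex_hull_finite)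
  define u where "u v = w (pt v)" for v
  have u: "0 \<le> u v" if "v \<in> \<tau>" for v using w that by (auto simp: u_def)
  have s: "sum u \<tau> = 1" "z = (\<Sum>v\<in>\<tau>. u v *\<^sub>R pt v)"
    using w inj by (simp_all add: sum.reindex u_def)
  obtain x where x: "x \<in> cube" "\<tau> \<subseteq> carrier x" using assms(1) by (auto simp: faces_def)
  show ?thesis
    using that[OF u s] convex_combination_of_pts[OF x u s(1)] s(2) by simp
qed

text \<open>Membership in a simplex becomes containment of carriers, so that two simplices meet in
  the simplex of the common rays.\<close>

lemma mem_hull_of_face_iff:
  assumes "\<tau> \<in> faces"
  shows "z \<in> convex hull (pt ` \<tau>) \<longleftrightarrow> z \<in> cube \<and> carrier z \<subseteq> \<tau>"
proof
  assume "z \<in> convex hull (pt ` \<tau>)"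
  then obtain u where "z \<in> cube" "c (E z) = (\<lambda>v. if v \<in> \<tau> then u v / d v else 0)"
    by (rule hull_of_face[OF assms]) blast
  then show "z \<in> cube \<and> carrier z \<subseteq> \<tau>" by (auto simp: carrier_def split: if_splits)
next
  assume z: "z \<in> cube \<and> carrier z \<subseteq> \<tau>"
  have nonneg: "0 \<le> d v * c (E z) v" if v: "v \<in> carrier z" for v
  proof -
    have "v \<in> rays" using v z by (auto simp: rays_def)
    then show ?thesis using degree_pos[of v] v by (simp add: carrier_def)
  qed
  have "(\<Sum>v\<in>carrier z. (d v * c (E z) v) *\<^sub>R pt v) \<in> convex hull (pt ` \<tau>)"
    by (rule convex_sum) (use z cube_point_combination(1) nonneg finite_carrier in \<open>auto intro!: hull_inc\<close>)
  then show "z \<in> convex hull (pt ` \<tau>)" using cube_point_combination(2) z by auto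
qed

text \<open>The coordinates of the image of a convex combination are its weights divided by the
  degrees, so they determine the weights.\<close>

lemma affine_independent_face:
  assumes \<tau>: "\<tau> \<in> faces"
  shows "\<not> affine_dependent (pt ` \<tau>)"
proof (rule affine_independent_if_convex_coordinates_unique)
  show fin: "finite (pt ` \<tau>)" using finite_face[OF \<tau>] by simp
  fix u w p
  assume uw: "\<And>v. v \<in> pt ` \<tau> \<Longrightarrow> 0 \<le> u v \<and> 0 \<le> w v" "sum u (pt ` \<tau>) = 1" "sum w (pt ` \<tau>) = (1::real)"
    "(\<Sum>v\<in>pt ` \<tau>. u v *\<^sub>R v) = (\<Sum>v\<in>pt ` \<tau>. w v *\<^sub>R v)" and "p \<in> pt ` \<tau>"
  then obtain v where v: "v \<in> \<tau>" "p = pt v" by auto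
  have inj: "inj_on pt \<tau>" using inj_on_pt faces_rays[OF \<tau>] inj_on_subset by blast
  obtain x where x: "x \<in> cube" "\<tau> \<subseteq> carrier x" using \<tau> by (auto simp: faces_def)
  have "c (E (\<Sum>v\<in>\<tau>. u (pt v) *\<^sub>R pt v)) = (\<lambda>v. if v \<in> \<tau> then u (pt v) / d v else 0)"
    by (rule convex_combination_of_pts(2)[OF x]) (use uw inj in \<open>auto simp: sum.reindex\<close>)
  moreover have "c (E (\<Sum>v\<in>\<tau>. w (pt v) *\<^sub>R pt v)) = (\<lambda>v. if v \<in> \<tau> then w (pt v) / d v else 0)"
    by (rule convex_combination_of_pts(2)[OF x]) (use uw inj in \<open>auto simp: sum.reindex\<close>)
  moreover have "(\<Sum>v\<in>\<tau>. u (pt v) *\<^sub>R pt v) = (\<Sum>v\<in>\<tau>. w (pt v) *\<^sub>R pt v)"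
    using uw(4) inj by (simp add: sum.reindex)
  ultimately have "(\<lambda>v. if v \<in> \<tau> then u (pt v) / d v else 0) = (\<lambda>v. if v \<in> \<tau> then w (pt v) / d v else 0)"
    by simp
  from fun_cong[OF this, of v] have "u (pt v) / d v = w (pt v) / d v" using v by simp
  then show "u p = w p" using v degree_pos[of v] faces_rays[OF \<tau>] by auto
qed

definition chart_complex :: "(real^'n) set set" where "chart_complex = (\<lambda>\<tau>. convex hull (pt ` \<tau>)) ` faces"

lemma simplicial_complex_chart_complex: "simplicial_complex chart_complex"
  unfolding simplicial_complex_def
proof (intro conjI ballI allI impI)
  show "finite chart_complex" unfolding chart_complex_def using finite_faces by simp
next
  fix T assume "T \<in> chart_complex"
  then obtain \<tau> where \<tau>: "\<tau> \<in> faces" "T = convex hull (pt ` \<tau>)" by (auto simp: chart_complex_def)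
  \<comment> \<open>The empty face belongs to \<open>faces\<close> and gives the empty simplex, of
    dimension \<open>-1\<close>; hence the dimension is computed as an integer.\<close>
  show "\<exists>n. n simplex T"
    unfolding simplex_def
    by (rule exI[of _ "int (card (pt ` \<tau>)) - 1"], rule exI[of _ "pt ` \<tau>"])
      (simp add: affine_independent_face[OF \<tau>(1)] \<tau>(2))
next
  fix F T assume "T \<in> chart_complex \<and> F face_of T"
  then obtain \<tau> where \<tau>: "\<tau> \<in> faces" "F face_of (convex hull (pt ` \<tau>))" unfolding chart_complex_def by blast
  then obtain C where "C \<subseteq> pt ` \<tau>" "F = convex hull C"
    using face_of_convex_hull_affine_independent[OF affine_independent_face[OF \<tau>(1)]] by blast
  then obtain \<sigma> where "\<sigma> \<subseteq> \<tau>" "F = convex hull (pt ` \<sigma>)" unfolding subset_image_iff by blast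
  then show "F \<in> chart_complex" using faces_subset[OF \<tau>(1)] unfolding chart_complex_def by blast
next
  fix S T assume "S \<in> chart_complex \<and> T \<in> chart_complex"
  then obtain \<sigma> \<tau> where *: "\<sigma> \<in> faces" "\<tau> \<in> faces" "S = convex hull (pt ` \<sigma>)" "T = convex hull (pt ` \<tau>)"
    unfolding chart_complex_def by blast
  have "\<sigma> \<inter> \<tau> \<in> faces" using faces_subset[OF *(1)] by simp
  from mem_hull_of_face_iff[OF this] have eq: "S \<inter> T = convex hull (pt ` (\<sigma> \<inter> \<tau>))"
    unfolding *(3,4) using mem_hull_of_face_iff[OF *(1)] mem_hull_of_face_iff[OF *(2)] by blast
  have "convex hull (pt ` (\<sigma> \<inter> \<tau>)) face_of convex hull (pt ` \<sigma>)"
    unfolding face_of_convex_hull_affine_independent[OF affine_independent_face[OF *(1)]]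
    by (rule exI[of _ "pt ` (\<sigma> \<inter> \<tau>)"]) auto
  then show "S \<inter> T face_of S" unfolding eq unfolding *(3) .
qed

lemma Union_chart_complex: "\<Union>chart_complex = cube"
proof
  show "\<Union>chart_complex \<subseteq> cube" by (auto simp: chart_complex_def mem_hull_of_face_iff simp del: mem_box)
  show "cube \<subseteq> \<Union>chart_complex"
  proof
    fix x :: "real^'n" assume x: "x \<in> cube"
    then have "carrier x \<in> faces" by (auto simp: faces_def)
    then show "x \<in> \<Union>chart_complex" using x mem_hull_of_face_iff[of "carrier x" x] by (auto simp: chart_complex_def)
  qed
qed

lemma vertices_chart_complex: "vertices chart_complex = pt ` rays"
proof
  show "vertices chart_complex \<subseteq> pt ` rays"
  proof
    fix p assume "p \<in> vertices chart_complex"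
    then obtain \<tau> where \<tau>: "\<tau> \<in> faces" "{p} = convex hull (pt ` \<tau>)" by (auto simp: vertices_def chart_complex_def)
    then have "pt ` \<tau> \<noteq> {}" "pt ` \<tau> \<subseteq> {p}" using hull_subset[of "pt ` \<tau>" convex] by auto
    then show "p \<in> pt ` rays" using faces_rays[OF \<tau>(1)] by auto
  qed
  show "pt ` rays \<subseteq> vertices chart_complex"
  proof
    fix p assume "p \<in> pt ` rays"
    then obtain v where v: "v \<in> rays" "p = pt v" by auto
    then have "{v} \<in> faces" by (auto simp: rays_def faces_def)
    then have "convex hull (pt ` {v}) \<in> chart_complex" unfolding chart_complex_def by (rule imageI)
    then show "p \<in> vertices chart_complex" using v by (simp add: vertices_def)
  qed
qed

section \<open>Weights and hats of the complex\<close>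

text \<open>The sum has a single nonzero term when \<open>p\<close> is a vertex, and its value is then \<open>den p / d v\<close> for the ray
  \<open>v\<close> through \<open>E p\<close>.\<close>

definition weight :: "real^'n \<Rightarrow> nat" where
  "weight p = nat \<lfloor>\<Sum>v\<in>V. real (den p) * c (E p) v\<rfloor>"

text \<open>The point \<open>y\<close>, which is \<open>den (pt v)\<close> times
  \<open>E (pt v)\<close>, is integral and equals \<open>r\<close> times \<open>v\<close>. Its only
  nonzero coordinate is \<open>r\<close>, an integer by unimodularity, so rounding in
  \<open>weight\<close> changes nothing.\<close>

lemma weight_pt:
  assumes v: "v \<in> rays"
  shows "real (weight (pt v)) = real (den (pt v)) / d v"
proof -
  define r where "r = real (den (pt v)) / d v"
  have dv: "d v > 0" by (rule degree_pos[OF v])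
  have vV: "v \<in> V" using v rays_subset by auto
  have r: "r > 0" unfolding r_def using dv den_pos[OF ray_pt(2)[OF v]] by simp
  have vo: "v \<in> orthant G" using vV F(2) by auto
  define y where "y = (\<lambda>k. r * v k)"
  define t where "t w = (if w = v then r else 0)" for w
  have "(\<Sum>w\<in>V. t w * w k) = y k" for k
  proof -
    have "(\<Sum>w\<in>V. t w * w k) = (\<Sum>w\<in>V. if w = v then r * v k else 0)" by (rule sum.cong) (auto simp: t_def)
    then show ?thesis using F(1) vV by (simp add: y_def)
  qed
  moreover have "c (\<lambda>k. \<Sum>w\<in>V. t w * w k) = t"
    by (rule F(8)[OF vo]) (use r F(9)[OF vV] in \<open>auto simp: t_def\<close>)
  ultimately have "c y = t" by simp
  moreover have "y k \<in> \<int>" for k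
  proof -
    have "y k = r * (d v * E (pt v) k)" by (simp only: y_def ray_pt[OF v])
    also have "\<dots> = real (den (pt v)) * E (pt v) k" using dv by (simp add: r_def)
    finally show ?thesis using E_den ray_pt[OF v] by simp
  qed
  moreover have "y \<in> orthant G" using vo r unfolding orthant_def y_def by simp
  ultimately have "t v \<in> \<int>" using F(7) by metis
  then have "r \<in> \<int>" by (simp add: t_def)
  then obtain z where z: "r = of_int z" by (auto elim: Ints_cases)
  have "(\<Sum>w\<in>V. real (den (pt v)) * c (E (pt v)) w) = (\<Sum>w\<in>V. if w = v then r else 0)"
    by (rule sum.cong) (auto simp: coords_pt[OF v] r_def)
  also have "\<dots> = r" using F(1) vV by simp
  finally have "weight (pt v) = nat z" by (simp add: weight_def z)
  moreover have "z > 0" using r z by simp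
  ultimately show ?thesis using z by (simp add: r_def)
qed

lemma weighted_triangulation_chart_complex: "weighted_triangulation chart_complex weight"
  unfolding weighted_triangulation_def
proof (intro conjI ballI)
  fix p assume "p \<in> vertices chart_complex"
  then obtain v where v: "v \<in> rays" "p = pt v" by (auto simp: vertices_chart_complex)
  show "\<forall>i. p $ i \<in> \<rat>" using ray_pt[OF v(1)] v by simp
  have dv: "d v > 0" by (rule degree_pos[OF v(1)])
  have den: "den p > 0" using den_pos ray_pt[OF v(1)] v by simp
  have w: "real (weight p) = real (den p) / d v" using weight_pt v by simp
  then show "weight p > 0" using dv den by (metis divide_pos_pos of_nat_0_less_iff)
  have "d v \<in> \<int>" using d F(3) v(1) rays_subset unfolding int_functional_def by blast
  then obtain z where z: "d v = of_int z" by (auto elim: Ints_cases)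
  then have "real (den p) = real (weight p * nat z)" using w dv by simp
  then have "den p = weight p * nat z" by (simp only: of_nat_eq_iff)
  then show "weight p dvd den p" by simp
qed (rule simplicial_complex_chart_complex, rule Union_chart_complex)

definition coord_fun :: "('k \<Rightarrow> real) \<Rightarrow> real^'n \<Rightarrow> real" where "coord_fun v = (\<lambda>x\<in>cube. c (E x) v)"

text \<open>On a simplex the coordinate at \<open>v\<close> is the barycentric weight of
  \<open>pt v\<close> divided by \<open>d v\<close>. The peak \<open>1 / d v\<close> is the
  prescribed height by \<open>weight_pt\<close>. The range condition will come from membership in
  \<open>A\<close>.\<close>

lemma is_hat_coord_fun:
  assumes v: "v \<in> rays" and range: "coord_fun v \<in> cube \<rightarrow>\<^sub>E {0..1}"
  shows "is_hat chart_complex weight (pt v) (coord_fun v)"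
  unfolding is_hat_def
proof (intro conjI ballI impI)
  fix T assume "T \<in> chart_complex"
  then obtain \<tau> where \<tau>: "\<tau> \<in> faces" "T = convex hull (pt ` \<tau>)" by (auto simp: chart_complex_def)
  obtain b e where be: "\<And>p. p \<in> pt ` \<tau> \<Longrightarrow> b \<bullet> p + e = coord_fun v p"
    using affine_independent_interpolation[OF affine_independent_face[OF \<tau>(1)]] by metis
  have "coord_fun v z = b \<bullet> z + e" if z: "z \<in> T" for z
  proof -
    obtain u where u: "\<And>v. v \<in> \<tau> \<Longrightarrow> 0 \<le> u v" "sum u \<tau> = 1" "z = (\<Sum>v\<in>\<tau>. u v *\<^sub>R pt v)"
      "z \<in> cube" "c (E z) = (\<lambda>v. if v \<in> \<tau> then u v / d v else 0)"
      by (rule hull_of_face[OF \<tau>(1) z[unfolded \<tau>(2)]]) blast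
    have "b \<bullet> z + e = (\<Sum>w\<in>\<tau>. u w * (b \<bullet> pt w + e))"
      using u(2) by (simp add: u(3) algebra_simps sum.distrib inner_sum_right flip: sum_distrib_left)
    also have "\<dots> = (\<Sum>w\<in>\<tau>. if w = v then u w / d w else 0)"
    proof (rule sum.cong[OF refl])
      fix w assume w: "w \<in> \<tau>"
      then have "w \<in> rays" using faces_rays[OF \<tau>(1)] by auto
      then have "coord_fun v (pt w) = (if v = w then 1 / d w else 0)"
        using ray_pt coords_pt by (simp add: coord_fun_def)
      then show "u w * (b \<bullet> pt w + e) = (if w = v then u w / d w else 0)" using be w by auto
    qed
    also have "\<dots> = coord_fun v z" using u(4) finite_face[OF \<tau>(1)] by (simp add: coord_fun_def u(5))
    finally show ?thesis by simp
  qed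
  then show "affine_fun_on T (coord_fun v)" unfolding affine_fun_on_def by blast
next
  show "coord_fun v (pt v) = real (weight (pt v)) / real (den (pt v))"
    using den_pos[OF ray_pt(2)[OF v]] ray_pt(1)[OF v] by (simp add: weight_pt[OF v] coord_fun_def coords_pt[OF v])
next
  fix p assume "p \<in> vertices chart_complex" "p \<noteq> pt v"
  then obtain w where "w \<in> rays" "p = pt w" "w \<noteq> v" by (auto simp: vertices_chart_complex)
  then show "coord_fun v p = 0" using ray_pt coords_pt by (simp add: coord_fun_def)
qed (rule range)

lemma hats_chart_complex:
  assumes "\<And>v. v \<in> rays \<Longrightarrow> coord_fun v \<in> cube \<rightarrow>\<^sub>E {0..1}"
  shows "hats chart_complex weight = coord_fun ` rays"
proof -
  have "h = coord_fun v" if "v \<in> rays" "is_hat chart_complex weight (pt v) h" for h v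
    using hat_ex1[OF weighted_triangulation_chart_complex, of "pt v"] is_hat_coord_fun[OF that(1) assms[OF that(1)]] that
    by (auto simp: vertices_chart_complex)
  then show ?thesis using is_hat_coord_fun assms unfolding hats_def vertices_chart_complex by blast
qed

text \<open>Since every closed set contains zero, the coordinates of the rays generate as much as
  those of all of \<open>V\<close>.\<close>

lemma coord_fun_zero:
  assumes "v \<notin> rays" shows "coord_fun v = mv_zero"
proof -
  have "c (E x) v = 0" if "x \<in> cube" for x
    using assms that F(4)[OF E_orthant[OF that], of v] by (force simp: rays_def carrier_def)
  then show ?thesis unfolding coord_fun_def mv_zero_def by (intro restrict_ext)
qed

end

section \<open>Existence of a generating set of hats\<close>

text \<open>The invariant carried through the subdivisions; its second half places \<open>S\<close>
  in the MV-closure of the pulled-back coordinates.\<close>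

definition coords_generate :: "(real^'n \<Rightarrow> real) set \<Rightarrow> (real^'n \<Rightarrow> real) set \<Rightarrow> (real^'n \<Rightarrow> 'k \<Rightarrow> real) \<Rightarrow>
    ('k \<Rightarrow> real) set \<Rightarrow> (('k \<Rightarrow> real) \<Rightarrow> ('k \<Rightarrow> real) \<Rightarrow> real) \<Rightarrow> bool" where
  "coords_generate A S E V c \<longleftrightarrow> (\<forall>v\<in>V. (\<lambda>x\<in>cube. c (E x) v) \<in> A) \<and>
    (\<forall>B. mv_closed B \<longrightarrow> (\<forall>v\<in>V. (\<lambda>x\<in>cube. c (E x) v) \<in> B) \<longrightarrow> S \<subseteq> B)"

text \<open>The differences \<open>h v - min (h v) (h w)\<close> are nonnegative, so truncated
  subtraction computes them exactly. Adding the minimum back returns \<open>h v\<close> without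
  truncation because \<open>h v\<close> is at most 1.\<close>

lemma coords_generate_subdivide:
  fixes E :: "real^'n \<Rightarrow> 'k \<Rightarrow> real"
  assumes edge: "fan_edge G V c v w y0" and A: "mv_closed A" "A \<subseteq> cube \<rightarrow>\<^sub>E {0..1}"
    and E: "\<And>x. x \<in> cube \<Longrightarrow> E x \<in> orthant G" and gen: "coords_generate A S E V c"
  shows "coords_generate A S E (insert (\<lambda>i. v i + w i) V) (subdivide_coords v w c)"
proof -
  interpret fan_edge G V c v w y0 by fact
  define h where "h z = (\<lambda>x\<in>cube. c (E x) z)" for z
  define h' where "h' z = (\<lambda>x\<in>cube. subdivide_coords v w c (E x) z)" for z
  have hA: "h z \<in> A" if "z \<in> V" for z using gen that by (simp add: coords_generate_def h_def)
  have h01: "0 \<le> c (E x) z \<and> c (E x) z \<le> 1" if "z \<in> V" "x \<in> cube" for x z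
  proof -
    have "h z \<in> cube \<rightarrow>\<^sub>E {0..1}" using hA[OF that(1)] A(2) by blast
    then have "h z x \<in> {0..1}" using that(2) by (rule PiE_mem)
    then show ?thesis using that(2) by (simp add: h_def)
  qed
  have m: "(\<lambda>x\<in>cube. min (h v x) (h w x)) \<in> A" using mv_closed_min[OF A hA hA] vw by simp
  have "h' z \<in> A" if z: "z \<in> insert (\<lambda>i. v i + w i) V" for z
  proof -
    consider "z = (\<lambda>i. v i + w i)" | "z = v" | "z = w" | "z \<in> V" "z \<noteq> v" "z \<noteq> w" "z \<noteq> (\<lambda>i. v i + w i)"
      using z by blast
    then show ?thesis
    proof cases
      case 1
      show ?thesis using m unfolding h'_def by (rule restrict_mem_by_cube) (simp_all add: 1 h_def)
    next
      case 2
      from mv_closed_diff[OF A(1) hA[OF vw(1)] m] show ?thesis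
        unfolding h'_def by (rule restrict_mem_by_cube) (simp_all add: 2 h_def)
    next
      case 3
      from mv_closed_diff[OF A(1) hA[OF vw(2)] m] show ?thesis
        unfolding h'_def by (rule restrict_mem_by_cube) (simp_all add: 3 h_def)
    next
      case 4
      from hA[OF 4(1)] show ?thesis
        unfolding h'_def by (rule restrict_mem_by_cube) (simp_all add: 4 h_def)
    qed
  qed
  moreover have "S \<subseteq> B" if B: "mv_closed B" "\<forall>z\<in>insert (\<lambda>i. v i + w i) V. h' z \<in> B" for B
  proof -
    have "h z \<in> B" if z: "z \<in> V" for z
    proof (cases "z = v \<or> z = w")
      case True
      have "mv_plus (h' z) (h' (\<lambda>i. v i + w i)) \<in> B" using B z unfolding mv_closed_def by blast
      then show ?thesis
        unfolding h_def by (rule restrict_mem_by_cube) (use True h01[OF z] in \<open>auto simp: mv_plus_def h'_def\<close>)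
    next
      case False
      have "z \<noteq> (\<lambda>i. v i + w i)" using z u_notin by blast
      then have eq: "subdivide_coords v w c y z = c y z" for y using False by simp
      have "h' z \<in> B" using B z by blast
      then show ?thesis unfolding h_def h'_def eq .
    qed
    then show ?thesis using gen B(1) unfolding coords_generate_def h_def by blast
  qed
  ultimately show ?thesis unfolding coords_generate_def h'_def by blast
qed

lemma coords_generate_orthant:
  assumes A: "mv_closed A" "S \<subseteq> A" "A \<subseteq> cube \<rightarrow>\<^sub>E {0..1}" and S: "finite S"
  shows "coords_generate A S (cube_embedding S) (unit_vec ` (S \<times> UNIV)) (orthant_coords (S \<times> UNIV))"
proof -
  have G: "finite (S \<times> (UNIV :: bool set))" using S by simp
  have T: "(\<lambda>x\<in>cube. orthant_coords (S \<times> UNIV) (cube_embedding S x) (unit_vec (f, True))) = f" if "f \<in> S" for f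
  proof (rule extensionalityI)
    show "f \<in> extensional cube" using that A by (auto simp: PiE_def)
  qed (use that G in \<open>simp_all add: orthant_coords_unit_vec cube_embedding_def\<close>)
  have F: "(\<lambda>x\<in>cube. orthant_coords (S \<times> UNIV) (cube_embedding S x) (unit_vec (f, False))) \<in> A" if f: "f \<in> S" for f
  proof -
    have "mv_neg f \<in> A" using A f unfolding mv_closed_def by blast
    then show ?thesis
      by (rule restrict_mem_by_cube) (use f G in \<open>simp_all add: orthant_coords_unit_vec cube_embedding_def mv_neg_def\<close>)
  qed
  show ?thesis
    unfolding coords_generate_def
  proof (intro conjI ballI allI impI subsetI)
    fix v assume "v \<in> unit_vec ` (S \<times> (UNIV :: bool set))"
    then obtain f s where f: "f \<in> S" and v: "v = unit_vec (f, s)" by blast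
    show "(\<lambda>x\<in>cube. orthant_coords (S \<times> UNIV) (cube_embedding S x) v) \<in> A"
    proof (cases s)
      case True
      then have "v = unit_vec (f, True)" using v by simp
      then show ?thesis using T[OF f] A(2) f by auto
    next
      case False
      then have "v = unit_vec (f, False)" using v by simp
      then show ?thesis using F[OF f] by simp
    qed
  next
    fix B f assume B: "\<forall>v\<in>unit_vec ` (S \<times> (UNIV :: bool set)). (\<lambda>x\<in>cube. orthant_coords (S \<times> UNIV) (cube_embedding S x) v) \<in> B"
      and f: "f \<in> S"
    have "unit_vec (f, True) \<in> unit_vec ` (S \<times> UNIV)" using f by simp
    from bspec[OF B this] show "f \<in> B" unfolding T[OF f] .
  qed
qed

lemma McNaughton_value_den:
  assumes f: "f \<in> McNaughton" and x: "x \<in> cube" "\<forall>i. x $ i \<in> \<rat>"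
  shows "real (den x) * f x \<in> \<int>"
proof -
  obtain p where p: "int_affine p" "f x = p x" using f x unfolding McNaughton_def by blast
  obtain b :: "int^'a" and c :: int where b: "p x = (\<Sum>i\<in>UNIV. of_int (b $ i) * x $ i) + of_int c"
    using p(1) by (auto simp: int_affine_def)
  have "real (den x) * f x = (\<Sum>i\<in>UNIV. of_int (b $ i) * (real (den x) * x $ i)) + real (den x) * of_int c"
    by (simp add: p(2) b distrib_left sum_distrib_left mult_ac)
  also have "\<dots> \<in> \<int>"
    using Ints_mult[OF Ints_of_int den_times_int[OF x(2)]] by (intro Ints_add Ints_sum) auto
  finally show ?thesis .
qed

lemma convex_int_affine_halfspaces:
  assumes "\<And>l. l \<in> \<Lambda> \<Longrightarrow> int_affine l"
  shows "convex {z. \<forall>l\<in>\<Lambda>. 0 \<le> l z}"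
proof -
  have "convex {z. 0 \<le> l z}" if l: "l \<in> \<Lambda>" for l
  proof -
    obtain b c where "\<And>z. l z = b \<bullet> z + c" using int_affine_inner[OF assms[OF l]] by blast
    then have "{z. 0 \<le> l z} = {z. b \<bullet> z \<ge> - c}" by (auto simp: algebra_simps)
    then show ?thesis by (simp add: convex_halfspace_ge)
  qed
  then have "convex (\<Inter>l\<in>\<Lambda>. {z. 0 \<le> l z})" by (intro convex_INT)
  moreover have "(\<Inter>l\<in>\<Lambda>. {z. 0 \<le> l z}) = {z. \<forall>l\<in>\<Lambda>. 0 \<le> l z}" by blast
  ultimately show ?thesis by (simp only:)
qed

text \<open>Coherence is what makes the carrier of a point of a cell lie in the cone over that cell: a
  functional which is nonnegative at the point cannot be negative on a vertex of the carrier.\<close>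

lemma coherent_nonneg_on_carrier:
  assumes fan: "fan G V c" and \<phi>: "int_functional \<phi>" "coherent G c \<phi>"
    and y: "y \<in> orthant G" "0 \<le> \<phi> y" and v: "c y v > 0"
  shows "0 \<le> \<phi> v"
proof (rule ccontr)
  note F = fanD[OF fan]
  assume neg: "\<not> 0 \<le> \<phi> v"
  have vV: "v \<in> V" using v F(5)[OF y(1)] by force
  have "(\<lambda>i. \<Sum>w\<in>V. c y w * w i) = y" using F(6)[OF y(1)] by (rule ext)
  then have "\<phi> y = (\<Sum>w\<in>V. c y w * \<phi> w)" using int_functional_combination[OF \<phi>(1), of "c y" V] by simp
  also have "\<dots> = c y v * \<phi> v + (\<Sum>w\<in>V - {v}. c y w * \<phi> w)"
    using F(1) vV by (simp add: sum.remove)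
  also have "\<dots> < 0"
  proof -
    have "c y w * \<phi> w \<le> 0" for w
    proof (cases "c y w > 0")
      case True
      then have "\<not> (\<phi> w > 0 \<and> \<phi> v < 0)" using \<phi>(2) y(1) v unfolding coherent_def by blast
      then have "\<not> \<phi> w > 0" using neg by simp
      then show ?thesis using True by (simp add: mult_nonneg_nonpos)
    next
      case False
      then have "c y w = 0" using F(4)[OF y(1), of w] by simp
      then show ?thesis by simp
    qed
    then have "(\<Sum>w\<in>V - {v}. c y w * \<phi> w) \<le> 0" by (intro sum_nonpos)
    moreover have "c y v * \<phi> v < 0" using v neg by (simp add: mult_pos_neg)
    ultimately show ?thesis by linarith
  qed
  finally show False using y(2) by simp
qed

text \<open>The functions with equal values at two given points form a closed set, so generators
  that fail to separate the points force all of \<open>A\<close> to fail.\<close>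

lemma separating_generators:
  assumes gen: "generates S A" and sep: "separating A"
    and xy: "x \<in> cube" "y \<in> cube" "\<And>f. f \<in> S \<Longrightarrow> f x = f y"
  shows "x = y"
proof (rule ccontr)
  assume "x \<noteq> y"
  then obtain f where f: "f \<in> A" "f x \<noteq> f y" using sep xy(1,2) unfolding separating_def by blast
  have "mv_closed {f. f x = f y}"
    using xy(1,2) by (auto simp: mv_closed_def mv_zero_def mv_plus_def mv_neg_def)
  then have "mv_closed hull S \<subseteq> {f. f x = f y}" using xy(3) by (intro hull_minimal) auto
  then have "f \<in> {f. f x = f y}" using f(1) gen unfolding generates_def by blast
  then show False using f(2) by simp
qed

theorem exists_generating_hats:
  fixes A :: "(real^'n \<Rightarrow> real) set"
  assumes A: "mv_subalgebra A" and fg: "finitely_generated A" and sep: "separating A"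
  shows "\<exists>\<Delta> a. weighted_triangulation \<Delta> a \<and> basic \<Delta> a \<and> generates (hats \<Delta> a) A"
proof -
  have AM: "A \<subseteq> McNaughton" and cl: "mv_closed A" using A by (auto simp: mv_subalgebra_def)
  have A01: "A \<subseteq> cube \<rightarrow>\<^sub>E {0..1}" using AM McNaughton_subset by blast
  obtain S0 where S0: "finite S0" "generates S0 A" using fg by (auto simp: finitely_generated_def)
  \<comment> \<open>The set of generators may be empty. Inserting zero provides the generator by
    which the degree \<open>d\<close> is defined.\<close>
  define S where "S = insert mv_zero S0"
  have zero: "mv_zero \<in> A" using cl by (simp add: mv_closed_def)
  have S: "finite S" "mv_zero \<in> S" "S \<subseteq> A"
    using S0 zero hull_subset[of S0 mv_closed] by (auto simp: S_def generates_def)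
  have SM: "S \<subseteq> McNaughton" using S AM by blast
  have inj: "x = y" if "x \<in> cube" "y \<in> cube" "\<And>f. f \<in> S \<Longrightarrow> f x = f y" for x y
    using separating_generators[OF S0(2) sep that(1,2)] that(3) by (simp add: S_def)
  define E where "E = cube_embedding S"
  define G where "G = S \<times> (UNIV :: bool set)"
  define d where "d = degree_at (mv_zero :: real^'n \<Rightarrow> real)"
  have E_orth: "E x \<in> orthant G" if x: "x \<in> cube" for x
  proof -
    have "0 \<le> f x \<and> f x \<le> 1" if "f \<in> S" for f
    proof -
      have "f \<in> cube \<rightarrow>\<^sub>E {0..1}" using S A01 that by blast
      then have "f x \<in> {0..1}" using x by (rule PiE_mem)
      then show ?thesis by simp
    qed
    then show ?thesis by (auto simp: E_def G_def orthant_def cube_embedding_def)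
  qed
  obtain \<Q> where \<Q>: "finite \<Q>" "\<Union>\<Q> = cube" and cells: "\<forall>Q\<in>\<Q>. interior Q \<noteq> {} \<and>
      (\<exists>\<Lambda>. finite \<Lambda> \<and> (\<forall>l\<in>\<Lambda>. int_affine l) \<and> Q = {z. \<forall>l\<in>\<Lambda>. 0 \<le> l z}) \<and>
      (\<forall>f\<in>S. \<exists>p. int_affine p \<and> (\<forall>x\<in>Q. f x = p x))"
    by (rule exE[OF linear_cells[OF S(1) SM]], elim conjE, rule that)
  have Qint: "interior Q \<noteq> {}" if "Q \<in> \<Q>" for Q
    using bspec[OF cells that] by (elim conjE)
  have Qhalf: "\<exists>\<Lambda>. finite \<Lambda> \<and> (\<forall>l\<in>\<Lambda>. int_affine l) \<and> Q = {z. \<forall>l\<in>\<Lambda>. 0 \<le> l z}" if "Q \<in> \<Q>" for Q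
    using bspec[OF cells that] by (elim conjE)
  have Qaff: "\<exists>p. int_affine p \<and> (\<forall>x\<in>Q. f x = p x)" if "Q \<in> \<Q>" "f \<in> S" for Q f
    using bspec[OF cells that(1)] that(2) by (elim conjE bspec)
  have Qcube: "Q \<subseteq> cube" if "Q \<in> \<Q>" for Q using \<Q>(2) that by blast
  define cuts where "cuts Q \<Phi> \<longleftrightarrow> finite \<Phi> \<and> (\<forall>\<phi>\<in>\<Phi>. int_functional \<phi> \<and> (\<forall>x\<in>Q. 0 \<le> \<phi> (E x))) \<and>
    (\<forall>y\<in>orthant G. y \<noteq> (\<lambda>k. 0) \<longrightarrow> (\<forall>\<phi>\<in>\<Phi>. 0 \<le> \<phi> y) \<longrightarrow>
      (\<exists>x\<in>Q. 0 < d y \<and> y = (\<lambda>k. d y * E x k) \<and> ((\<forall>k. y k \<in> \<int>) \<longrightarrow> (\<forall>i. x $ i \<in> \<rat>))))" for Q \<Phi>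
  have "\<exists>\<Phi>. cuts Q \<Phi>" if Q: "Q \<in> \<Q>" for Q
  proof -
    obtain \<Lambda> where \<Lambda>: "finite \<Lambda>" "\<forall>l\<in>\<Lambda>. int_affine l" "Q = {z. \<forall>l\<in>\<Lambda>. 0 \<le> l z}"
      by (rule exE[OF Qhalf[OF Q]], elim conjE, rule that)
    show ?thesis
      unfolding cuts_def E_def G_def d_def
    proof (rule cell_functionals[OF S(1,2) \<Lambda>(1) _ \<Lambda>(3) Qint[OF Q]])
      show "int_affine l" if "l \<in> \<Lambda>" for l using \<Lambda>(2) that by (rule bspec)
      show "\<exists>p. int_affine p \<and> (\<forall>x\<in>Q. f x = p x)" if "f \<in> S" for f by (rule Qaff[OF Q that])
      show "x = y" if "x \<in> Q" "y \<in> Q" "\<And>f. f \<in> S \<Longrightarrow> f x = f y" for x y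
        by (rule inj[OF subsetD[OF Qcube[OF Q] that(1)] subsetD[OF Qcube[OF Q] that(2)] that(3)])
    qed
  qed
  then have "\<forall>Q\<in>\<Q>. \<exists>\<Phi>. cuts Q \<Phi>" by (intro ballI)
  then obtain \<Phi> where "\<forall>Q\<in>\<Q>. cuts Q (\<Phi> Q)" unfolding bchoice_iff by (elim exE)
  then have \<Phi>: "finite (\<Phi> Q)" "\<And>\<phi>. \<phi> \<in> \<Phi> Q \<Longrightarrow> int_functional \<phi>"
    "\<And>\<phi> x. \<phi> \<in> \<Phi> Q \<Longrightarrow> x \<in> Q \<Longrightarrow> 0 \<le> \<phi> (E x)"
    "\<And>y. y \<in> orthant G \<Longrightarrow> y \<noteq> (\<lambda>k. 0) \<Longrightarrow> (\<And>\<phi>. \<phi> \<in> \<Phi> Q \<Longrightarrow> 0 \<le> \<phi> y) \<Longrightarrow>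
      \<exists>x\<in>Q. 0 < d y \<and> y = (\<lambda>k. d y * E x k) \<and> ((\<forall>k. y k \<in> \<int>) \<longrightarrow> (\<forall>i. x $ i \<in> \<rat>))"
    if "Q \<in> \<Q>" for Q
    using that unfolding cuts_def by blast+
  have "\<exists>V c. fan G V c \<and> coords_generate A S E V c \<and> (\<forall>\<phi>\<in>\<Union>(\<Phi> ` \<Q>). coherent G c \<phi>)"
  proof (rule exists_coherent_subdivision_finite)
    show "finite (\<Union>(\<Phi> ` \<Q>))" using \<Q>(1) \<Phi>(1) by blast
    show "int_functional \<phi>" if "\<phi> \<in> \<Union>(\<Phi> ` \<Q>)" for \<phi> using that \<Phi>(2) by blast
    show "fan G (unit_vec ` G) (orthant_coords G)" by (rule fan_orthant) (use S in \<open>simp add: G_def\<close>)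
    show "coords_generate A S E (unit_vec ` G) (orthant_coords G)"
      unfolding G_def E_def by (rule coords_generate_orthant[OF cl S(3) A01 S(1)])
    show "coords_generate A S E (insert (\<lambda>i. v i + w i) V) (subdivide_coords v w c)"
      if "fan_edge G V c v w y0" "coords_generate A S E V c" for V c v w y0
      by (rule coords_generate_subdivide[OF that(1) cl A01 E_orth that(2)])
  qed
  then obtain V c where fan: "fan G V c" and gen: "coords_generate A S E V c"
    and coh: "\<And>Q \<phi>. Q \<in> \<Q> \<Longrightarrow> \<phi> \<in> \<Phi> Q \<Longrightarrow> coherent G c \<phi>" by blast
  note F = fanD[OF fan]
  interpret fan_chart G V c E d
  proof
    show "fan G V c" by fact
    show "int_functional d" unfolding d_def by (rule int_functional_degree)
    show "E x \<in> orthant G" if "x \<in> cube" for x by (rule E_orth[OF that])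
    show "d (E x) = 1" for x unfolding d_def E_def by (rule degree_cube_embedding[OF S(2)])
    show "inj_on E cube"
    proof (rule inj_onI)
      fix x y assume xy: "x \<in> cube" "y \<in> cube" "E x = E y"
      have "f x = f y" if "f \<in> S" for f
        using fun_cong[OF xy(3), of "(f, True)"] that by (simp add: E_def cube_embedding_def)
      then show "x = y" by (rule inj[OF xy(1,2)])
    qed
    show "real (den x) * E x k \<in> \<int>" if x: "x \<in> cube" "\<forall>i. x $ i \<in> \<rat>" for x k
    proof -
      obtain f s where k: "k = (f, s)" by (cases k)
      have "real (den x) * f x \<in> \<int>" if "f \<in> S" for f
        using McNaughton_value_den[OF _ x] SM that by blast
      then show ?thesis by (auto simp: k E_def cube_embedding_def right_diff_distrib intro!: Ints_diff)
    qed
    fix x :: "real^'n" assume x: "x \<in> cube"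
    then obtain Q where Q: "Q \<in> \<Q>" "x \<in> Q" using \<Q>(2) by blast
    show "\<exists>Q. Q \<subseteq> cube \<and> convex Q \<and> (\<forall>k. affine_fun_on Q (\<lambda>x. E x k)) \<and>
      (\<forall>v. c (E x) v > 0 \<longrightarrow> (\<exists>p\<in>Q. d v > 0 \<and> v = (\<lambda>k. d v * E p k) \<and> (\<forall>i. p $ i \<in> \<rat>)))"
    proof (intro exI[of _ Q] conjI allI impI)
      show "Q \<subseteq> cube" by (rule Qcube[OF Q(1)])
      show "convex Q" by (rule exE[OF Qhalf[OF Q(1)]]) (elim conjE, simp add: convex_int_affine_halfspaces)
      show "affine_fun_on Q (\<lambda>x. E x k)" for k
      proof -
        obtain f s where k: "k = (f, s)" by (cases k)
        show ?thesis
        proof (cases "f \<in> S")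
          case True
          obtain p where p: "int_affine p" "\<And>x. x \<in> Q \<Longrightarrow> f x = p x" using Qaff[OF Q(1) True] by blast
          obtain b e where be: "\<And>x. p x = b \<bullet> x + e" using int_affine_inner[OF p(1)] by blast
          show ?thesis
            unfolding affine_fun_on_def
            by (rule exI[of _ "if s then b else - b"], rule exI[of _ "if s then e else 1 - e"])
              (simp add: k E_def cube_embedding_def True p(2) be)
        next
          case False
          show ?thesis
            unfolding affine_fun_on_def
            by (rule exI[of _ 0], rule exI[of _ 0]) (simp add: k E_def cube_embedding_def False)
        qed
      qed
      fix v assume v: "c (E x) v > 0"
      have vV: "v \<in> V" using v F(5)[OF E_orth[OF x]] by force
      have pos: "0 \<le> \<phi> v" if "\<phi> \<in> \<Phi> Q" for \<phi>
        by (rule coherent_nonneg_on_carrier[where \<phi>=\<phi> and y="E x", OF fan \<Phi>(2)[OF Q(1) that] coh[OF Q(1) that] E_orth[OF x] \<Phi>(3)[OF Q(1) that Q(2)] v])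
      \<comment> \<open>As a nonzero vector satisfying all inequalities of the cone over
        \<open>Q\<close>, \<open>v\<close> lies over a point of \<open>Q\<close>; integrality of
        \<open>v\<close> makes this point rational.\<close>
      have "\<exists>x\<in>Q. 0 < d v \<and> v = (\<lambda>k. d v * E x k) \<and> ((\<forall>k. v k \<in> \<int>) \<longrightarrow> (\<forall>i. x $ i \<in> \<rat>))"
        by (rule \<Phi>(4)[OF Q(1) subsetD[OF F(2) vV] fan_vertex_nonzero[OF fan vV]]) (rule pos)
      then
      obtain p where p: "p \<in> Q" "0 < d v" "v = (\<lambda>k. d v * E p k)" "(\<forall>k. v k \<in> \<int>) \<longrightarrow> (\<forall>i. p $ i \<in> \<rat>)"
        by (elim bexE conjE) (rule that)
      have "\<forall>i. p $ i \<in> \<rat>" by (rule mp[OF p(4)]) (intro allI F(3)[OF vV])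
      with p(1-3) show "\<exists>p\<in>Q. d v > 0 \<and> v = (\<lambda>k. d v * E p k) \<and> (\<forall>i. p $ i \<in> \<rat>)"
        by (intro bexI[of _ p] conjI)
    qed
  qed
  have cf: "coord_fun v \<in> A" if "v \<in> V" for v
    using gen that by (simp add: coords_generate_def coord_fun_def)
  have hats: "hats chart_complex weight = coord_fun ` rays"
    by (rule hats_chart_complex) (use cf A01 rays_subset in blast)
  have sub: "hats chart_complex weight \<subseteq> A" unfolding hats using cf rays_subset by blast
  then have "basic chart_complex weight" using AM by (auto simp: basic_def)
  moreover have "generates (hats chart_complex weight) A"
    unfolding generates_def
  proof
    show "mv_closed hull hats chart_complex weight \<subseteq> A" using sub cl by (rule hull_minimal)
    define B where "B = mv_closed hull hats chart_complex weight"
    have B: "mv_closed B" unfolding B_def by (rule mv_closed_hull)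
    \<comment> \<open>Needed for all of \<open>V\<close>, because \<open>coords_generate\<close>
      refers to every vector, whereas only the rays give hats.\<close>
    have "coord_fun v \<in> B" for v
    proof (cases "v \<in> rays")
      case True
      then have "coord_fun v \<in> hats chart_complex weight" unfolding hats by (rule imageI)
      then show ?thesis unfolding B_def by (rule hull_inc)
    next
      case False
      then show ?thesis using B by (simp add: coord_fun_zero mv_closed_def)
    qed
    then have "\<forall>v\<in>V. (\<lambda>x\<in>cube. c (E x) v) \<in> B" unfolding coord_fun_def by (intro ballI)
    then have "S \<subseteq> B" using gen B unfolding coords_generate_def by (elim conjE allE impE)
    then have "S0 \<subseteq> B" by (simp add: S_def)
    then have "mv_closed hull S0 \<subseteq> B" using B by (rule hull_minimal)
    then show "A \<subseteq> mv_closed hull hats chart_complex weight" using S0(2) by (simp add: generates_def B_def)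
  qed
  ultimately have "weighted_triangulation chart_complex weight \<and> basic chart_complex weight \<and>
      generates (hats chart_complex weight) A"
    using weighted_triangulation_chart_complex by (intro conjI)
  then show ?thesis by (intro exI)
qed

theorem theorem5p4:
  fixes A :: "(real^'n \<Rightarrow> real) set"
  assumes "mv_subalgebra A"
  shows "((finitely_generated A \<and> separating A \<and> A \<noteq> McNaughton) \<longleftrightarrow>
           (\<exists>\<Delta> a. weighted_triangulation \<Delta> a \<and> basic \<Delta> a \<and> generates (hats \<Delta> a) A \<and>
              (\<exists>v\<in>vertices \<Delta>. a v \<noteq> 1))) \<and>
         (finitely_generated A \<and> separating A \<and> A \<noteq> McNaughton \<longrightarrow>
           (\<forall>\<Delta> a. weighted_triangulation \<Delta> a \<and> basic \<Delta> a \<and> generates (hats \<Delta> a) A \<longrightarrow>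
              (\<exists>v\<in>vertices \<Delta>. a v \<noteq> 1)))"
proof -
  have AM: "A \<subseteq> McNaughton" using assms by (simp add: mv_subalgebra_def)
  have A01: "A \<subseteq> cube \<rightarrow>\<^sub>E {0..1}" using AM McNaughton_subset by blast
  have nonunit: "\<exists>v\<in>vertices \<Delta>. a v \<noteq> 1"
    if "A \<noteq> McNaughton" "weighted_triangulation \<Delta> a" "generates (hats \<Delta> a) A" for \<Delta> a
    using McNaughton_subset_if_unit_weights[OF that(2,3) A01] AM that(1) by blast
  have "finitely_generated A \<and> separating A \<and> A \<noteq> McNaughton"
    if "weighted_triangulation \<Delta> a" "generates (hats \<Delta> a) A" "v \<in> vertices \<Delta>" "a v \<noteq> 1" for \<Delta> a v
    using hats_finitely_generated_separating[OF that(1,2)] generated_by_hats_neq_McNaughton[OF that] by blast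
  then show ?thesis using exists_generating_hats[OF assms] nonunit by blast
qed

end
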